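(* For each $\epsilon>0$ and any fixed $r>0$, there is a randomized algorithm that, given an instance $(\{s_i\}_{i=1,\dots,n},k)$ of the optimization version of \textsc{Minimax Approval Voting} with $s_i\in\{0,1\}^m$, runs in time $n^{O\left(\frac{\log(1/\epsilon)}{\epsilon^2}\right)}\cdot\mathrm{poly}(m)$ and, with probability at least $1-r$, finds a $(1+\epsilon)$-approximate solution, i.e. a string $s\in\{0,1\}^m$ with exactly $k$ ones and $\max_i\mathrm{H}(s,s_i)\le(1+\epsilon)\mathrm{OPT}$.
   Context: $\mathrm{H}$ denotes Hamming distance. Optimization version of \textsc{Minimax Approval Voting}: given a multiset $\{s_1,\dots,s_n\}\subseteq\{0,1\}^m$ and an integer $k$, find $s\in\{0,1\}^m$ with exactly $k$ ones minimizing $\max_{i}\mathrm{H}(s,s_i)$; $\mathrm{OPT}$ is this minimum value. *)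

theory Defs
  imports
    "HOL-Probability.Probability"
    "HOL-Library.Landau_Symbols"
    "HOL-Computational_Algebra.Polynomial"
begin

section \<open>Minimax Approval Voting\<close>

definition hamming :: "bool list \<Rightarrow> bool list \<Rightarrow> nat" where
  "hamming s t = card {j. j < length s \<and> s ! j \<noteq> t ! j}"

text \<open>The multiset of votes is presented as the list \<open>[s\<^sub>1, \<dots>, s\<^sub>n]\<close>.
  The condition \<open>k \<le> m\<close> says that a string with exactly \<open>k\<close> ones exists, and
  \<open>ss \<noteq> []\<close> that the maximum defining the objective is over a nonempty set.\<close>

definition mav_instance :: "nat \<Rightarrow> nat \<Rightarrow> bool list list \<Rightarrow> bool" where
  "mav_instance m k ss \<longleftrightarrow> ss \<noteq> [] \<and> (\<forall>s\<in>set ss. length s = m) \<and> k \<le> m"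

definition mav_feasible :: "nat \<Rightarrow> nat \<Rightarrow> bool list set" where
  "mav_feasible m k = {s. length s = m \<and> count_list s True = k}"

definition mav_cost :: "bool list list \<Rightarrow> bool list \<Rightarrow> nat" where
  "mav_cost ss s = Max ((\<lambda>t. hamming s t) ` set ss)"

definition mav_opt :: "nat \<Rightarrow> nat \<Rightarrow> bool list list \<Rightarrow> nat" where
  "mav_opt m k ss = Min (mav_cost ss ` mav_feasible m k)"

definition mav_approx :: "real \<Rightarrow> nat \<Rightarrow> nat \<Rightarrow> bool list list \<Rightarrow> bool list \<Rightarrow> bool" where
  "mav_approx \<epsilon> m k ss s \<longleftrightarrow>
     s \<in> mav_feasible m k \<and> real (mav_cost ss s) \<le> (1 + \<epsilon>) * real (mav_opt m k ss)"


section \<open>Randomized random-access machines\<close>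

text \<open>
  Randomized algorithms are programs of a random-access machine with a coin-flip instruction,
  written with structured control flow. The machine has registers and arrays of natural numbers;
  a given program only refers to finitely many registers and arrays. The only arithmetic is
  addition and truncated subtraction, so that unit cost per instruction is polynomially
  related to Turing machine time (unit-cost multiplication would break this).
\<close>

datatype com =
    Const nat nat        \<comment> \<open>\<open>Const x c\<close>: \<open>x := c\<close>\<close>
  | Add nat nat nat      \<comment> \<open>\<open>Add x y z\<close>: \<open>x := y + z\<close>\<close>
  | Sub nat nat nat      \<comment> \<open>\<open>Sub x y z\<close>: \<open>x := y - z\<close>\<close>
  | Load nat nat nat     \<comment> \<open>\<open>Load x a y\<close>: \<open>x := a[y]\<close>\<close>
  | Store nat nat nat    \<comment> \<open>\<open>Store a x y\<close>: \<open>a[x] := y\<close>\<close>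
  | Flip nat             \<comment> \<open>\<open>Flip x\<close>: \<open>x :=\<close> fair coin in \<open>{0, 1}\<close>\<close>
  | Seq com com
  | Cond nat com com     \<comment> \<open>\<open>Cond x c d\<close>: if \<open>x \<noteq> 0\<close> then \<open>c\<close> else \<open>d\<close>\<close>
  | While nat com        \<comment> \<open>\<open>While x c\<close>: while \<open>x \<noteq> 0\<close> do \<open>c\<close>\<close>

record state =
  reg :: "nat \<Rightarrow> nat"
  arr :: "nat \<Rightarrow> nat \<Rightarrow> nat"

definition set_reg :: "nat \<Rightarrow> nat \<Rightarrow> state \<Rightarrow> state" where
  "set_reg x v s = s\<lparr>reg := (reg s)(x := v)\<rparr>"

definition set_arr :: "nat \<Rightarrow> nat \<Rightarrow> nat \<Rightarrow> state \<Rightarrow> state" where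
  "set_arr a i v s = s\<lparr>arr := (arr s)(a := (arr s a)(i := v))\<rparr>"

text \<open>A configuration is the stack of commands still to be executed together with the state;
  the machine has halted when the stack is empty.\<close>

type_synonym config = "com list \<times> state"

fun step :: "config \<Rightarrow> config pmf" where
  "step ([], s) = return_pmf ([], s)"
| "step (Const x c # K, s) = return_pmf (K, set_reg x c s)"
| "step (Add x y z # K, s) = return_pmf (K, set_reg x (reg s y + reg s z) s)"
| "step (Sub x y z # K, s) = return_pmf (K, set_reg x (reg s y - reg s z) s)"
| "step (Load x a y # K, s) = return_pmf (K, set_reg x (arr s a (reg s y)) s)"
| "step (Store a x y # K, s) = return_pmf (K, set_arr a (reg s x) (reg s y) s)"
| "step (Flip x # K, s) =
     map_pmf (\<lambda>b. (K, set_reg x (if b then 1 else 0) s)) (bernoulli_pmf (1/2))"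
| "step (Seq c d # K, s) = return_pmf (c # d # K, s)"
| "step (Cond x c d # K, s) = return_pmf ((if reg s x \<noteq> 0 then c else d) # K, s)"
| "step (While x c # K, s) =
     return_pmf (if reg s x \<noteq> 0 then c # While x c # K else K, s)"

fun steps :: "nat \<Rightarrow> config \<Rightarrow> config pmf" where
  "steps 0 cf = return_pmf cf"
| "steps (Suc t) cf = bind_pmf (step cf) (steps t)"

definition run :: "nat \<Rightarrow> com \<Rightarrow> state \<Rightarrow> config pmf" where
  "run t A s = steps t ([A], s)"

text \<open>Worst case over the coin flips.\<close>

definition halts_within :: "nat \<Rightarrow> com \<Rightarrow> state \<Rightarrow> bool" where
  "halts_within t A s \<longleftrightarrow> (\<forall>cf\<in>set_pmf (run t A s). fst cf = [])"

lemma steps_add: "steps (t + u) cf = bind_pmf (steps t cf) (steps u)"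
proof (induction t arbitrary: cf)
  case (Suc t)
  have "steps (t + u) = (\<lambda>x. bind_pmf (steps t x) (steps u))"
    using Suc by (rule ext)
  then show ?case by (simp add: bind_assoc_pmf)
qed (simp add: bind_return_pmf)

lemma steps_halted: "steps t ([], s) = return_pmf ([], s)"
  by (induction t) (simp_all add: bind_return_pmf)

text \<open>Once every computation has halted, the distribution of configurations is the output
  distribution of the program and no longer depends on the number of steps.\<close>

lemma run_halted:
  assumes "halts_within t A s" and "t \<le> u"
  shows "run u A s = run t A s"
proof -
  obtain d where u: "u = t + d" using assms(2) le_Suc_ex by blast
  have "steps d cf = return_pmf cf" if "cf \<in> set_pmf (steps t ([A], s))" for cf
    using assms(1) that steps_halted[of d "snd cf"]
    by (cases cf) (auto simp: halts_within_def run_def)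
  then have "bind_pmf (steps t ([A], s)) (steps d) = bind_pmf (steps t ([A], s)) return_pmf"
    by (intro bind_pmf_cong) auto
  then show ?thesis by (simp add: run_def u steps_add bind_return_pmf')
qed


section \<open>Input and output\<close>

text \<open>Registers 0, 1, 2 hold \<open>n\<close>, \<open>m\<close>, \<open>k\<close>, array 0 holds the \<open>n \<times> m\<close> input bits row by row,
  and everything else is 0. The output is read from the first \<open>m\<close> cells of array 1.\<close>

definition mav_input :: "nat \<Rightarrow> nat \<Rightarrow> bool list list \<Rightarrow> state" where
  "mav_input m k ss =
     \<lparr>reg = (\<lambda>_. 0)(0 := length ss, 1 := m, 2 := k),
      arr = (\<lambda>_ _. 0)(0 := (\<lambda>i. if i < length ss * m \<and> ss ! (i div m) ! (i mod m) then 1 else 0))\<rparr>"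

definition mav_output :: "nat \<Rightarrow> state \<Rightarrow> bool list" where
  "mav_output m s = map (\<lambda>j. arr s 1 j \<noteq> 0) [0..<m]"

end

theory Submission
  imports Defs
begin

text \<open>
  Let \<open>d\<close> be the optimum and \<open>x\<close> an optimal string. Two methods are tried repeatedly and the best
  string seen is returned.

  If \<open>d = O(log n / \<epsilon>\<^sup>2)\<close>, a random walk succeeds. It starts from the first vote, corrected to
  \<open>k\<close> ones, hence at distance at most \<open>2 d\<close> from \<open>x\<close>. As long as some vote is farther than
  \<open>(1 + \<epsilon>) d\<close> away, an \<open>\<Omega>(\<epsilon>)\<close> fraction of the positions where the current string has 0 and that
  vote has 1, and likewise of those with 1 and 0, are wrong with respect to \<open>x\<close>. Swapping a random
  pair of such positions therefore decreases the distance to \<open>x\<close> by 2 with probability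
  \<open>\<Omega>(\<epsilon>\<^sup>2)\<close>, so that a walk of length \<open>d\<close> succeeds with probability
  \<open>\<epsilon>\<^bsup>O(d)\<^esup> = n\<^bsup>-O(log(1/\<epsilon>)/\<epsilon>\<^sup>2)\<^esup>\<close>.

  If \<open>d\<close> is larger, the linear relaxation is solved approximately by multiplicative weights over
  the votes: the average of \<open>T \<ge> m\<close> best responses has distance at most \<open>(1 + O(\<epsilon>)) d\<close> to every
  vote. Choosing each position independently from a random one of these \<open>T\<close> strings changes the
  distances and the number of ones by at most \<open>O(\<epsilon> d)\<close> with probability at least \<open>1 / 2\<close>, by a
  Chernoff bound, and the number of ones is then corrected at cost \<open>O(\<epsilon> d)\<close>.
\<close>

section \<open>Timed big-step semantics\<close>

text \<open>The program does not know the optimum, so every trial runs both methods; only the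
  analysis separates \<open>d \<le> C * L\<close> from \<open>d > C * L\<close>, with
  \<open>L\<close> the logarithm of \<open>n\<close> rounded up. Precision is a power of two,
  \<open>E = 2 ^ l\<close> with \<open>1 / E \<le> \<epsilon>\<close>, so that the reciprocal
  success bound of a walk, \<open>(8 * E) ^ (2 * (C * L))\<close>, equals
  \<open>2 ^ (\<beta> * L)\<close>, which is reached by doubling. \<open>R\<close> times as many
  trials all fail with probability at most \<open>exp (- R)\<close>. All coins are flipped before
  the trials, in one subprogram; the rest is deterministic, and probabilities become counts of
  lists. As the machine cannot multiply or divide, weights are integers updated by a factor
  \<open>Q + h\<close> in place of \<open>1 + h / Q\<close>, \<open>T\<close> is a power of two, and
  indices arise by reduction modulo a list length, which costs a factor 2. The polynomial in
  \<open>m\<close> is fixed before \<epsilon>, so whatever depends on \<epsilon> must be paid by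
  powers of \<open>n\<close>. For \<open>n = 1\<close> nothing can be paid; there the repaired vote
  is itself optimal.\<close>

lemma set_reg_simps [simp]:
  "reg (set_reg x v s) = (reg s)(x := v)" "arr (set_reg x v s) = arr s"
  "reg (set_arr a i v s) = reg s" "arr (set_arr a i v s) = (arr s)(a := (arr s a)(i := v))"
  by (simp_all add: set_reg_def set_arr_def)

text \<open>There is deliberately no rule for \<open>Flip\<close>: the relation covers the
  deterministic fragment, and coins are confined to \<open>FILL\<close>. The counts are exact, with
  one step for each \<open>Seq\<close>, each \<open>Cond\<close> and each test of a
  \<open>While\<close>, as on the small-step machine.\<close>

inductive big_step :: "com \<Rightarrow> state \<Rightarrow> nat \<Rightarrow> state \<Rightarrow> bool" where
  Const: "big_step (Const x c) s 1 (set_reg x c s)"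
| Add: "big_step (Add x y z) s 1 (set_reg x (reg s y + reg s z) s)"
| Sub: "big_step (Sub x y z) s 1 (set_reg x (reg s y - reg s z) s)"
| Load: "big_step (Load x a y) s 1 (set_reg x (arr s a (reg s y)) s)"
| Store: "big_step (Store a x y) s 1 (set_arr a (reg s x) (reg s y) s)"
| Seq: "big_step c s t s' \<Longrightarrow> big_step d s' u s'' \<Longrightarrow> big_step (Seq c d) s (1 + t + u) s''"
| CondT: "reg s x \<noteq> 0 \<Longrightarrow> big_step c s t s' \<Longrightarrow> big_step (Cond x c d) s (1 + t) s'"
| CondF: "reg s x = 0 \<Longrightarrow> big_step d s t s' \<Longrightarrow> big_step (Cond x c d) s (1 + t) s'"
| WhileT: "reg s x \<noteq> 0 \<Longrightarrow> big_step c s t s' \<Longrightarrow> big_step (While x c) s' u s'' \<Longrightarrow>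
    big_step (While x c) s (1 + t + u) s''"
| WhileF: "reg s x = 0 \<Longrightarrow> big_step (While x c) s 1 s"

lemma steps_big_step:
  "big_step c s t s' \<Longrightarrow> steps t (c # K, s) = return_pmf (K, s')"
  by (induction arbitrary: K rule: big_step.induct)
     (simp_all add: steps_add bind_return_pmf del: set_reg_simps)

fun mod_regs :: "com \<Rightarrow> nat set" where
  "mod_regs (Const x c) = {x}"
| "mod_regs (Add x y z) = {x}"
| "mod_regs (Sub x y z) = {x}"
| "mod_regs (Load x a y) = {x}"
| "mod_regs (Store a x y) = {}"
| "mod_regs (Flip x) = {x}"
| "mod_regs (Seq c d) = mod_regs c \<union> mod_regs d"
| "mod_regs (Cond x c d) = mod_regs c \<union> mod_regs d"
| "mod_regs (While x c) = mod_regs c"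

fun mod_arrs :: "com \<Rightarrow> nat set" where
  "mod_arrs (Store a x y) = {a}"
| "mod_arrs (Seq c d) = mod_arrs c \<union> mod_arrs d"
| "mod_arrs (Cond x c d) = mod_arrs c \<union> mod_arrs d"
| "mod_arrs (While x c) = mod_arrs c"
| "mod_arrs _ = {}"

text \<open>The frame condition. Combined with the syntactic sets \<open>mod_regs\<close> and
  \<open>mod_arrs\<close> it carries untouched data across a subprogram, so that no postcondition
  has to list what is preserved.\<close>

definition agree_off :: "nat set \<Rightarrow> nat set \<Rightarrow> state \<Rightarrow> state \<Rightarrow> bool" where
  "agree_off X A s s' \<longleftrightarrow>
     (\<forall>x. x \<notin> X \<longrightarrow> reg s' x = reg s x) \<and> (\<forall>a. a \<notin> A \<longrightarrow> arr s' a = arr s a)"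

lemma agree_off_trans:
  "agree_off X A s s' \<Longrightarrow> agree_off Y B s' s'' \<Longrightarrow> X \<subseteq> Z \<Longrightarrow> Y \<subseteq> Z \<Longrightarrow> A \<subseteq> C \<Longrightarrow> B \<subseteq> C \<Longrightarrow>
   agree_off Z C s s''"
  unfolding agree_off_def by (metis subsetD)

lemma big_step_agree_off:
  "big_step c s t s' \<Longrightarrow> agree_off (mod_regs c) (mod_arrs c) s s'"
  by (induction rule: big_step.induct) (auto simp: agree_off_def)

text \<open>Total correctness within a given number of steps; the postcondition also receives the
  number of steps left over, so that the rules for loop-free code are equations.\<close>

definition wp :: "com \<Rightarrow> nat \<Rightarrow> (state \<Rightarrow> nat \<Rightarrow> bool) \<Rightarrow> state \<Rightarrow> bool" where
  "wp c B Q s \<longleftrightarrow> (\<exists>t s'. big_step c s t s' \<and> t \<le> B \<and> Q s' (B - t))"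

inductive_cases ConstE: "big_step (Const x c) s t s'"
inductive_cases AddE: "big_step (Add x y z) s t s'"
inductive_cases SubE: "big_step (Sub x y z) s t s'"
inductive_cases LoadE: "big_step (Load x y z) s t s'"
inductive_cases StoreE: "big_step (Store x y z) s t s'"
inductive_cases SeqE: "big_step (Seq c d) s t s'"
inductive_cases CondE: "big_step (Cond x c d) s t s'"

lemma wp_Const [simp]: "wp (Const x c) B Q s \<longleftrightarrow> 1 \<le> B \<and> Q (set_reg x c s) (B - 1)"
  unfolding wp_def by (rule iffI) (auto elim!: ConstE, use big_step.Const in force)

lemma wp_Add [simp]:
  "wp (Add x y z) B Q s \<longleftrightarrow> 1 \<le> B \<and> Q (set_reg x (reg s y + reg s z) s) (B - 1)"
  unfolding wp_def by (rule iffI) (auto elim!: AddE, use big_step.Add in force)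

lemma wp_Sub [simp]:
  "wp (Sub x y z) B Q s \<longleftrightarrow> 1 \<le> B \<and> Q (set_reg x (reg s y - reg s z) s) (B - 1)"
  unfolding wp_def by (rule iffI) (auto elim!: SubE, use big_step.Sub in force)

lemma wp_Load [simp]:
  "wp (Load x a y) B Q s \<longleftrightarrow> 1 \<le> B \<and> Q (set_reg x (arr s a (reg s y)) s) (B - 1)"
  unfolding wp_def by (rule iffI) (auto elim!: LoadE, use big_step.Load in force)

lemma wp_Store [simp]:
  "wp (Store a x y) B Q s \<longleftrightarrow> 1 \<le> B \<and> Q (set_arr a (reg s x) (reg s y) s) (B - 1)"
  unfolding wp_def by (rule iffI) (auto elim!: StoreE, use big_step.Store in force)

lemma wp_Seq [simp]:
  "wp (Seq c d) B Q s \<longleftrightarrow> 1 \<le> B \<and> wp c (B - 1) (\<lambda>s' B'. wp d B' Q s') s"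
proof
  assume "wp (Seq c d) B Q s"
  then obtain t s' where *: "big_step (Seq c d) s t s'" "t \<le> B" "Q s' (B - t)"
    unfolding wp_def by blast
  from *(1) obtain t1 s1 t2 where **: "t = 1 + t1 + t2" "big_step c s t1 s1" "big_step d s1 t2 s'"
    by (auto elim: SeqE)
  have "B - 1 - t1 - t2 = B - t" using **(1) by simp
  moreover have "t2 \<le> B - 1 - t1" "t1 \<le> B - 1" "1 \<le> B" using *(2) **(1) by auto
  ultimately show "1 \<le> B \<and> wp c (B - 1) (\<lambda>s' B'. wp d B' Q s') s"
    unfolding wp_def using * ** by metis
next
  assume *: "1 \<le> B \<and> wp c (B - 1) (\<lambda>s' B'. wp d B' Q s') s"
  then obtain t1 s1 t2 s2 where **: "big_step c s t1 s1" "t1 \<le> B - 1" "big_step d s1 t2 s2"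
    "t2 \<le> B - 1 - t1" "Q s2 (B - 1 - t1 - t2)" unfolding wp_def by blast
  have "B - 1 - t1 - t2 = B - (1 + t1 + t2)" by simp
  moreover have "big_step (Seq c d) s (1 + t1 + t2) s2" by (rule big_step.Seq) fact+
  ultimately show "wp (Seq c d) B Q s"
    unfolding wp_def using ** * by (intro exI[of _ "1 + t1 + t2"] exI[of _ s2]) auto
qed

lemma wp_Cond [simp]:
  "wp (Cond x c d) B Q s \<longleftrightarrow> 1 \<le> B \<and> wp (if reg s x \<noteq> 0 then c else d) (B - 1) Q s"
proof
  assume "wp (Cond x c d) B Q s"
  then obtain t s' where *: "big_step (Cond x c d) s t s'" "t \<le> B" "Q s' (B - t)"
    unfolding wp_def by blast
  from *(1) obtain t1 where **: "t = 1 + t1" "big_step (if reg s x \<noteq> 0 then c else d) s t1 s'"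
    by (auto elim: CondE)
  have "B - 1 - t1 = B - t" using **(1) by simp
  then show "1 \<le> B \<and> wp (if reg s x \<noteq> 0 then c else d) (B - 1) Q s"
    unfolding wp_def using * ** by (metis add_le_imp_le_diff add_leD1 add.commute)
next
  assume *: "1 \<le> B \<and> wp (if reg s x \<noteq> 0 then c else d) (B - 1) Q s"
  then obtain t1 s1 where **: "big_step (if reg s x \<noteq> 0 then c else d) s t1 s1" "t1 \<le> B - 1"
    "Q s1 (B - 1 - t1)" unfolding wp_def by blast
  have "big_step (Cond x c d) s (1 + t1) s1"
    using **(1) big_step.CondT[of s x c t1 s1 d] big_step.CondF[of s x d t1 s1 c] by (auto split: if_splits)
  with ** * show "wp (Cond x c d) B Q s"
    unfolding wp_def by (intro exI[of _ "1 + t1"] exI[of _ s1]) auto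
qed

text \<open>Rule of consequence and frame rule in one. Only a lower bound on the steps left over is
  passed on, since \<open>B\<close> is an upper bound on the time of \<open>c\<close>.\<close>

lemma wp_use:
  assumes "wp c B (\<lambda>s' _. R s') s" "B \<le> B'"
    and "\<And>s' b. R s' \<Longrightarrow> agree_off (mod_regs c) (mod_arrs c) s s' \<Longrightarrow> B' - B \<le> b \<Longrightarrow> Q s' b"
  shows "wp c B' Q s"
proof -
  obtain t s' where *: "big_step c s t s'" "t \<le> B" "R s'" using assms(1) unfolding wp_def by blast
  show ?thesis unfolding wp_def
    using * assms(2) assms(3)[OF *(3) big_step_agree_off[OF *(1)], of "B' - t"]
    by (intro exI[of _ t] exI[of _ s']) auto
qed

text \<open>Register 12 holds the constant 1.\<close>

definition For :: "nat \<Rightarrow> nat \<Rightarrow> nat \<Rightarrow> com \<Rightarrow> com" where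
  "For x y t c = Seq (Const x 0) (Seq (Sub t y x)
     (While t (Seq c (Seq (Add x x 12) (Sub t y x)))))"

lemma mod_For [simp]:
  "mod_regs (For x y t c) = {x, t} \<union> mod_regs c" "mod_arrs (For x y t c) = mod_arrs c"
  by (auto simp: For_def)

text \<open>Besides the body, an iteration costs 5 steps: the test, two \<open>Seq\<close>, the
  increment and the recomputation of \<open>t\<close>. The invariant must be insensitive to
  \<open>x\<close> and \<open>t\<close> because both change between the end of one body and the
  start of the next.\<close>

lemma wp_While_aux:
  assumes one: "reg s0 12 = 1" and len: "reg s0 y = N"
    and off: "x \<notin> mod_regs c" "y \<notin> mod_regs c \<union> {x, t}" "12 \<notin> mod_regs c \<union> {x, t}" "x \<noteq> t"
    and insens: "\<And>i s v. I i s \<Longrightarrow> I i (set_reg x v s)" "\<And>i s v. I i s \<Longrightarrow> I i (set_reg t v s)"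
    and body: "\<And>i s. i < N \<Longrightarrow> reg s x = i \<Longrightarrow>
        agree_off (mod_regs c \<union> {x, t}) (mod_arrs c) s0 s \<Longrightarrow> I i s \<Longrightarrow>
        wp c B (\<lambda>s' _. I (Suc i) s') s"
    and "agree_off (mod_regs c \<union> {x, t}) (mod_arrs c) s0 s"
    and "reg s x = i" "reg s t = N - i" "i \<le> N" "I i s"
  shows "\<exists>u s'. big_step (While t (Seq c (Seq (Add x x 12) (Sub t y x)))) s u s' \<and>
    u \<le> 1 + (N - i) * (B + 5) \<and> I N s'"
  using assms(10-)
proof (induction "N - i" arbitrary: i s)
  case 0
  then have "i = N" "reg s t = 0" by auto
  then show ?case using big_step.WhileF[of s t] 0 by force
next
  case (Suc r)
  have iN: "i < N" using Suc.hyps(2) by simp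
  from body[OF iN Suc.prems(2,1,5)] obtain u1 s1 where
    1: "big_step c s u1 s1" "u1 \<le> B" "I (Suc i) s1" unfolding wp_def by blast
  define s2 where "s2 = set_reg x (reg s1 x + reg s1 12) s1"
  define s3 where "s3 = set_reg t (reg s2 y - reg s2 x) s2"
  note ag1 = big_step_agree_off[OF 1(1)]
  have ag3: "agree_off (mod_regs c \<union> {x, t}) (mod_arrs c) s s3"
    using ag1 unfolding s3_def s2_def agree_off_def by auto
  have b: "big_step (Seq c (Seq (Add x x 12) (Sub t y x))) s (1 + u1 + (1 + 1 + 1)) s3"
    unfolding s3_def s2_def by (rule big_step.Seq[OF 1(1) big_step.Seq[OF big_step.Add big_step.Sub]])
  have ag: "agree_off (mod_regs c \<union> {x, t}) (mod_arrs c) s0 s3"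
    by (rule agree_off_trans[OF Suc.prems(1) ag3]) auto
  have x1: "reg s1 x = i" using ag1 off Suc.prems(2) by (auto simp: agree_off_def)
  have o1: "reg s1 12 = 1" "reg s1 y = N"
    using ag1 off Suc.prems(1) one len by (auto simp: agree_off_def)
  have x3: "reg s3 x = Suc i" "reg s3 t = N - Suc i"
    using x1 o1 off by (auto simp: s3_def s2_def)
  have I3: "I (Suc i) s3" unfolding s3_def s2_def using 1(3) insens by blast
  from Suc.hyps(2) have "r = N - Suc i" "Suc i \<le> N" by simp_all
  from Suc.hyps(1)[OF this(1) ag x3 this(2) I3] obtain u2 s4 where
    2: "big_step (While t (Seq c (Seq (Add x x 12) (Sub t y x)))) s3 u2 s4"
       "u2 \<le> 1 + (N - Suc i) * (B + 5)" "I N s4" by blast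
  have nz: "reg s t \<noteq> 0" using Suc.prems(3) iN by simp
  have "N - i = Suc (N - Suc i)" using iN by simp
  then have "1 + (1 + u1 + (1 + 1 + 1)) + u2 \<le> 1 + (N - i) * (B + 5)"
    using 1(2) 2(2) by simp
  with big_step.WhileT[OF nz b 2(1)] 2(3) show ?case by blast
qed

lemma wp_For:
  assumes "reg s0 12 = 1" "reg s0 y = N"
    and "x \<notin> mod_regs c" "y \<notin> mod_regs c \<union> {x, t}" "12 \<notin> mod_regs c \<union> {x, t}" "x \<noteq> t"
    and "\<And>i s v. I i s \<Longrightarrow> I i (set_reg x v s)" "\<And>i s v. I i s \<Longrightarrow> I i (set_reg t v s)"
    and "I 0 s0"
    and "\<And>i s. i < N \<Longrightarrow> reg s x = i \<Longrightarrow>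
        agree_off (mod_regs c \<union> {x, t}) (mod_arrs c) s0 s \<Longrightarrow> I i s \<Longrightarrow>
        wp c B (\<lambda>s' _. I (Suc i) s') s"
    and "5 + N * (B + 5) \<le> B'"
    and "\<And>s' b. I N s' \<Longrightarrow> agree_off (mod_regs c \<union> {x, t}) (mod_arrs c) s0 s' \<Longrightarrow>
        B' - (5 + N * (B + 5)) \<le> b \<Longrightarrow> Q s' b"
  shows "wp (For x y t c) B' Q s0"
proof -
  define s1 where "s1 = set_reg x 0 s0"
  define s2 where "s2 = set_reg t (reg s1 y - reg s1 x) s1"
  have ag: "agree_off (mod_regs c \<union> {x, t}) (mod_arrs c) s0 s2"
    by (auto simp: s2_def s1_def agree_off_def)
  have r: "reg s2 x = 0" "reg s2 t = N - 0" using assms(2,4,6) by (auto simp: s2_def s1_def)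
  have I2: "I 0 s2" unfolding s2_def s1_def using assms(7-9) by blast
  obtain u s' where b: "big_step (While t (Seq c (Seq (Add x x 12) (Sub t y x)))) s2 u s'"
    "u \<le> 1 + (N - 0) * (B + 5)" "I N s'"
    using wp_While_aux[of s0 y N x c t I B, OF assms(1-8,10) ag r _ I2] by blast
  have c: "big_step (For x y t c) s0 (1 + 1 + (1 + 1 + u)) s'"
    unfolding For_def
    by (rule big_step.Seq[OF big_step.Const big_step.Seq[OF big_step.Sub]])
       (rule b(1)[unfolded s2_def s1_def])
  have "wp (For x y t c) (5 + N * (B + 5)) (\<lambda>s' _. I N s') s0"
    unfolding wp_def using c b(2,3)
    by (intro exI[of _ "1 + 1 + (1 + 1 + u)"] exI[of _ s']) auto
  then show ?thesis
  proof (rule wp_use[OF _ assms(11)])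
    fix s' b assume "I N s'" "agree_off (mod_regs (For x y t c)) (mod_arrs (For x y t c)) s0 s'"
      "B' - (5 + N * (B + 5)) \<le> b"
    then show "Q s' b" using assms(12) by (simp add: Un_commute)
  qed
qed

section \<open>The programs\<close>

text \<open>Strings are predicates on positions, of which only those below \<open>m\<close> count,
  so that flips and swaps are plain function updates. The translation to lists is postponed to the
  end.\<close>

definition hdist :: "nat \<Rightarrow> (nat \<Rightarrow> bool) \<Rightarrow> (nat \<Rightarrow> bool) \<Rightarrow> nat" where
  "hdist m y z = (\<Sum>j<m. of_bool (y j \<noteq> z j))"

definition ones :: "nat \<Rightarrow> (nat \<Rightarrow> bool) \<Rightarrow> nat" where
  "ones m y = (\<Sum>j<m. of_bool (y j))"

definition holds_str :: "state \<Rightarrow> nat \<Rightarrow> nat \<Rightarrow> (nat \<Rightarrow> bool) \<Rightarrow> bool" where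
  "holds_str s a m y \<longleftrightarrow> (\<forall>j<m. arr s a j = of_bool (y j))"

lemma holds_str_cong: "arr s a = arr s' a \<Longrightarrow> holds_str s a m y = holds_str s' a m y"
  by (simp add: holds_str_def)

lemma holds_str_simps [simp]:
  "holds_str (set_reg x v s) a m y = holds_str s a m y"
  "a \<noteq> b \<Longrightarrow> holds_str (set_arr b i v s) a m y = holds_str s a m y"
  by (simp_all add: holds_str_def)

text \<open>Besides the input, the registers hold \<open>3: \<lceil>log\<^sub>2 n\<rceil>\<close>, \<open>4: T = 2\<^sup>b \<ge> m\<close>, \<open>5: b\<close>, \<open>6: D\<close> (length of a walk),
  \<open>7: N\<close> (number of trials), \<open>9:\<close> number of random numbers, \<open>10: Q\<close> (base factor of the weight updates),
  \<open>11:\<close> cost of the best string so far, \<open>12: 1\<close>, \<open>13: 0\<close>, \<open>15:\<close> position in the random numbers.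
  The arrays hold \<open>1:\<close> the best string, \<open>2:\<close> the current string, \<open>3:\<close> the start of the walks, \<open>4:\<close> weights,
  \<open>5:\<close> column scores, \<open>6:\<close> string \<open>t\<close> of the weights phase at positions \<open>j * T + t\<close>, \<open>7:\<close> random numbers,
  \<open>8\<close> and \<open>9:\<close> positions where the current string should gain or lose a one.\<close>

definition SKIP :: com where "SKIP = Const 39 0"

lemma SKIP_simps [simp]: "mod_regs SKIP = {39}" "mod_arrs SKIP = {}"
  "wp SKIP B Q s \<longleftrightarrow> 1 \<le> B \<and> Q (set_reg 39 0 s) (B - 1)"
  by (simp_all add: SKIP_def)

definition COPY :: "nat \<Rightarrow> nat \<Rightarrow> com" where
  "COPY a c = For 26 1 27 (Seq (Load 30 a 26) (Store c 26 30))"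

lemma mod_COPY [simp]: "mod_regs (COPY a c) = {26, 27, 30}" "mod_arrs (COPY a c) = {c}"
  by (auto simp: COPY_def)

text \<open>Register 32 is a running pointer into the input. It advances by \<open>m\<close> per
  vote, so that the offset \<open>i * m\<close> of a row never has to be multiplied out.\<close>

definition HAM :: com where
  "HAM = Seq (Const 31 0) (For 26 1 27 (Seq (Load 30 2 26) (Seq (Load 33 0 32) (Seq (Add 32 32 12)
     (Cond 30 (Cond 33 SKIP (Add 31 31 12)) (Cond 33 (Add 31 31 12) SKIP))))))"

lemma mod_HAM [simp]: "mod_regs HAM = {26, 27, 30, 31, 32, 33, 39}" "mod_arrs HAM = {}"
  by (auto simp: HAM_def)

text \<open>Truncated subtraction is the only comparison: a nonzero difference means strictly
  greater. Register 35 keeps the row offset of the farthest vote, which the subsequent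
  \<open>STEP\<close> needs.\<close>

definition EVAL :: com where
  "EVAL = Seq (Const 32 0) (Seq (Const 34 0) (Seq (Const 35 0)
    (Seq (For 24 0 25 (Seq (Add 37 32 13) (Seq HAM (Seq (Sub 36 31 34)
       (Cond 36 (Seq (Add 34 31 13) (Add 35 37 13)) SKIP)))))
    (Seq (Sub 36 11 34) (Cond 36 (Seq (Add 11 34 13) (COPY 2 1)) SKIP)))))"

lemma mod_EVAL [simp]:
  "mod_regs EVAL = {11, 24, 25, 26, 27, 30, 31, 32, 33, 34, 35, 36, 37, 39}" "mod_arrs EVAL = {1}"
  by (auto simp: EVAL_def)

definition FIX :: com where
  "FIX = Seq (Const 31 0) (Seq (For 26 1 27 (Seq (Load 30 2 26) (Add 31 31 30)))
    (For 26 1 27 (Seq (Load 30 2 26) (Cond 30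
       (Seq (Sub 33 31 2) (Cond 33 (Seq (Store 2 26 13) (Sub 31 31 12)) SKIP))
       (Seq (Sub 33 2 31) (Cond 33 (Seq (Store 2 26 12) (Add 31 31 12)) SKIP))))))"

lemma mod_FIX [simp]: "mod_regs FIX = {26, 27, 30, 31, 33, 39}" "mod_arrs FIX = {2}"
  by (auto simp: FIX_def)

definition LISTS :: com where
  "LISTS = Seq (Const 40 0) (Seq (Const 41 0) (Seq (Add 32 35 13)
     (For 26 1 27 (Seq (Load 30 2 26) (Seq (Load 33 0 32) (Seq (Add 32 32 12)
       (Cond 30 (Cond 33 SKIP (Seq (Store 9 41 26) (Add 41 41 12)))
                (Cond 33 (Seq (Store 8 40 26) (Add 40 40 12)) SKIP))))))))"

lemma mod_LISTS [simp]:
  "mod_regs LISTS = {26, 27, 30, 32, 33, 39, 40, 41}" "mod_arrs LISTS = {8, 9}"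
  by (auto simp: LISTS_def)

text \<open>Remainder by repeated conditional subtraction; adding 1 before subtracting
  \<open>g\<close> makes the test say \<open>g \<le> v\<close>.\<close>

definition MOD :: "nat \<Rightarrow> nat \<Rightarrow> com" where
  "MOD v g = For 26 4 27 (Seq (Add 33 v 12) (Seq (Sub 33 33 g) (Cond 33 (Sub v v g) SKIP)))"

lemma mod_MOD [simp]: "mod_regs (MOD v g) = {26, 27, 33, 39, v}" "mod_arrs (MOD v g) = {}"
  by (auto simp: MOD_def)

text \<open>Two random numbers are consumed even when no swap is possible. Hence every trial reads a
  block of exactly \<open>m + 2 * D\<close> numbers, at a position independent of earlier
  outcomes.\<close>

definition STEP :: com where
  "STEP = Seq LISTS (Seq (Load 42 7 15) (Seq (Add 15 15 12) (Seq (Load 43 7 15) (Seq (Add 15 15 12)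
     (Seq (MOD 42 40) (Seq (MOD 43 41)
     (Cond 40 (Cond 41 (Seq (Load 44 8 42) (Seq (Store 2 44 12) (Seq (Load 44 9 43) (Store 2 44 13))))
        SKIP) SKIP)))))))"

lemma mod_STEP [simp]:
  "mod_regs STEP = {15, 26, 27, 30, 32, 33, 39, 40, 41, 42, 43, 44}" "mod_arrs STEP = {2, 8, 9}"
  by (auto simp: STEP_def)

definition ROUNDING :: com where
  "ROUNDING = Seq (Const 45 0) (For 26 1 27 (Seq (Load 30 7 15) (Seq (Add 15 15 12)
     (Seq (Add 30 30 45) (Seq (Load 30 6 30) (Seq (Store 2 26 30) (Add 45 45 4)))))))"

lemma mod_ROUNDING [simp]: "mod_regs ROUNDING = {15, 26, 27, 30, 45}" "mod_arrs ROUNDING = {2}"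
  by (auto simp: ROUNDING_def)

definition TRIAL :: com where
  "TRIAL = Seq ROUNDING (Seq FIX (Seq EVAL (Seq (COPY 3 2) (For 22 6 23 (Seq EVAL STEP)))))"

lemma mod_TRIAL [simp]:
  "mod_regs TRIAL = {11, 15, 22, 23, 24, 25, 26, 27, 30, 31, 32, 33, 34, 35, 36, 37, 39, 40, 41, 42, 43, 44, 45}"
  "mod_arrs TRIAL = {1, 2, 8, 9}"
  unfolding TRIAL_def by auto

text \<open>The initial record \<open>m + 1\<close> exceeds every possible cost, so that the first
  string evaluated is saved.\<close>

definition TRIALS :: com where
  "TRIALS = Seq (Const 15 0) (Seq (Add 11 1 12) (For 20 7 21 TRIAL))"

definition SCORE :: com where
  "SCORE = For 22 1 23 (Seq (Const 31 0) (Seq (Add 32 22 13)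
     (Seq (For 26 0 27 (Seq (Load 30 0 32) (Seq (Load 33 4 26) (Seq (Add 32 32 1)
        (Cond 30 (Add 31 31 33) SKIP))))) (Store 5 22 31))))"

lemma mod_SCORE [simp]: "mod_regs SCORE = {22, 23, 26, 27, 30, 31, 32, 33, 39}" "mod_arrs SCORE = {5}"
  by (auto simp: SCORE_def)

text \<open>Scores are compared after adding 1, so that the value 0 of register 34 can mean that no
  column has been considered yet, and a column of score 0 can still be selected.\<close>

definition TOP :: com where
  "TOP = Seq (For 26 1 27 (Store 2 26 13)) (For 22 2 23 (Seq (Const 34 0) (Seq (Const 35 0)
     (Seq (For 26 1 27 (Seq (Load 30 2 26) (Cond 30 SKIP (Seq (Load 31 5 26) (Seq (Add 31 31 12)
       (Seq (Sub 33 31 34) (Cond 33 (Seq (Add 34 31 13) (Add 35 26 13)) SKIP)))))))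
     (Store 2 35 12)))))"

lemma mod_TOP [simp]: "mod_regs TOP = {22, 23, 26, 27, 30, 31, 33, 34, 35, 39}" "mod_arrs TOP = {2}"
  by (auto simp: TOP_def)

text \<open>The product of the old weight with \<open>Q\<close> plus the distance is computed by
  repeated addition, which is why the time bound contains \<open>Q\<close>.\<close>

definition UPDATE :: com where
  "UPDATE = Seq (Const 32 0) (For 22 0 23 (Seq HAM (Seq (Add 31 31 10) (Seq (Load 30 4 22)
     (Seq (Const 36 0) (Seq (For 24 31 25 (Add 36 36 30)) (Store 4 22 36)))))))"

lemma mod_UPDATE [simp]:
  "mod_regs UPDATE = {22, 23, 24, 25, 26, 27, 30, 31, 32, 33, 36, 39}" "mod_arrs UPDATE = {4}"
  by (auto simp: UPDATE_def)

definition SAVE :: com where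
  "SAVE = Seq (Add 45 20 13) (For 26 1 27 (Seq (Load 30 2 26) (Seq (Store 6 45 30) (Add 45 45 4))))"

lemma mod_SAVE [simp]: "mod_regs SAVE = {26, 27, 30, 45}" "mod_arrs SAVE = {6}"
  by (auto simp: SAVE_def)

definition WEIGHTS :: com where
  "WEIGHTS = Seq (For 26 0 27 (Store 4 26 12))
     (For 20 4 21 (Seq SCORE (Seq TOP (Seq UPDATE SAVE))))"

lemma mod_WEIGHTS [simp]:
  "mod_regs WEIGHTS = {20, 21, 22, 23, 24, 25, 26, 27, 30, 31, 32, 33, 34, 35, 36, 39, 45}"
  "mod_arrs WEIGHTS = {2, 4, 5, 6}"
  unfolding WEIGHTS_def by auto

section \<open>Instances in memory and the basic subroutines\<close>

locale votes =
  fixes n m k :: nat and V :: "nat \<Rightarrow> nat \<Rightarrow> bool"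
  assumes k_le_m: "k \<le> m" and n_pos: "n > 0"
begin

definition env :: "state \<Rightarrow> bool" where
  "env s \<longleftrightarrow> reg s 0 = n \<and> reg s 1 = m \<and> reg s 2 = k \<and> reg s 12 = 1 \<and> reg s 13 = 0 \<and>
     (\<forall>i<n. \<forall>j<m. arr s 0 (i * m + j) = of_bool (V i j))"

lemma envD:
  assumes "env s"
  shows "reg s 0 = n" "reg s (Suc 0) = m" "reg s 2 = k" "reg s 12 = 1" "reg s 13 = 0"
    "i < n \<Longrightarrow> j < m \<Longrightarrow> arr s 0 (i * m + j) = of_bool (V i j)"
  using assms by (auto simp: env_def)

lemma env_agree_off:
  assumes "agree_off X A s s'" "env s" "X \<inter> {0, 1, 2, 12, 13} = {}" "0 \<notin> A"
  shows "env s'"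
proof -
  have "reg s' x = reg s x" if "x \<in> {0, 1, 2, 12, 13}" for x
    using assms(1,3) that by (auto simp: agree_off_def)
  moreover have "arr s' 0 = arr s 0" using assms(1,4) by (auto simp: agree_off_def)
  ultimately show ?thesis using assms(2) by (auto simp: env_def)
qed

lemma env_simps [simp]:
  "x \<notin> {0, 1, 2, 12, 13} \<Longrightarrow> env (set_reg x v s) = env s"
  "a \<noteq> 0 \<Longrightarrow> env (set_arr a i v s) = env s"
  by (auto simp: env_def)

lemma wp_COPY:
  assumes "env s" "holds_str s a m y" "a \<noteq> c"
  shows "wp (COPY a c) (5 + 8 * m) (\<lambda>s' _. holds_str s' c m y) s"
  unfolding COPY_def
proof (rule wp_For[where N = m and B = 3 and I = "\<lambda>i s'. \<forall>j<i. arr s' c j = of_bool (y j)"], goal_cases)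
  case (10 i s')
  then have "arr s' a i = of_bool (y i)" "reg s' 26 = i"
    using assms by (auto simp: agree_off_def holds_str_def)
  with 10 show ?case using less_Suc_eq by auto
qed (use assms envD[OF assms(1)] in \<open>auto simp: holds_str_def\<close>)

lemma wp_HAM:
  assumes "env s" "holds_str s 2 m y" and row: "\<And>j. j < m \<Longrightarrow> arr s 0 (reg s 32 + j) = of_bool (z j)"
  shows "wp HAM (7 + 14 * m) (\<lambda>s' _. reg s' 31 = hdist m y z \<and> reg s' 32 = reg s 32 + m) s"
  unfolding HAM_def wp_Seq[of "Const 31 0"] wp_Const
proof (intro conjI, goal_cases)
  case 3
  show ?case
  proof (rule wp_For[where N = m and B = 9 and
      I = "\<lambda>i s'. reg s' 31 = hdist i y z \<and> reg s' 32 = reg s 32 + i"], goal_cases)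
    case (10 i s')
    then have "arr s' 2 i = of_bool (y i)" "arr s' 0 (reg s 32 + i) = of_bool (z i)"
       "reg s' 26 = i" "reg s' 12 = 1"
      using assms envD[OF assms(1)] by (auto simp: agree_off_def holds_str_def)
    with 10 show ?case by (auto simp: hdist_def)
  qed (use envD[OF assms(1)] in \<open>auto simp: hdist_def\<close>)
qed auto

end

section \<open>Farthest vote and cost of a string\<close>

context votes
begin

text \<open>The recursion mirrors the loop of \<open>EVAL\<close>, so that its invariant is
  literally \<open>far y i\<close>, the first among the farthest of the first \<open>i\<close>
  votes. The value at 0 is a default that is also correct for a single vote.\<close>

primrec far :: "(nat \<Rightarrow> bool) \<Rightarrow> nat \<Rightarrow> nat" where
  "far y 0 = 0"
| "far y (Suc i) = (if hdist m y (V (far y i)) < hdist m y (V i) then i else far y i)"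

definition cost :: "(nat \<Rightarrow> bool) \<Rightarrow> nat" where
  "cost y = hdist m y (V (far y n))"

lemma far_less: "i > 0 \<Longrightarrow> far y i < i"
proof (induction i)
  case (Suc i)
  then show ?case by (cases "i = 0") auto
qed simp

lemma far_max: "j < i \<Longrightarrow> hdist m y (V j) \<le> hdist m y (V (far y i))"
  by (induction i) (force simp: less_Suc_eq)+

lemma hdist_le_cost: "i < n \<Longrightarrow> hdist m y (V i) \<le> cost y"
  unfolding cost_def by (rule far_max)

lemma holds_agree_off: "agree_off X A s s' \<Longrightarrow> holds_str s a m y \<Longrightarrow> a \<notin> A \<Longrightarrow> holds_str s' a m y"
  by (auto simp: agree_off_def holds_str_def)

lemma wp_EVAL:
  assumes "env s" "holds_str s 2 m y"
  shows "wp EVAL (40 + 8 * m + n * (25 + 14 * m)) (\<lambda>s' _. reg s' 35 = far y n * m \<and>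
     reg s' 11 = min (reg s 11) (cost y) \<and>
     (if cost y < reg s 11 then holds_str s' 1 m y else arr s' 1 = arr s 1)) s"
  unfolding EVAL_def
  apply simp
  apply (rule wp_For[where N = n and B = "20 + 14 * m" and
      I = "\<lambda>i s'. reg s' 32 = i * m \<and> reg s' 35 = far y i * m \<and>
         reg s' 34 = (if i = 0 then 0 else hdist m y (V (far y i)))"])
             apply (use envD[OF assms(1)] in \<open>simp_all del: far.simps(2) split del: if_split\<close>)
  subgoal for i s'
    apply (rule wp_use[OF wp_HAM[where y = y and z = "V i"]])
    subgoal by (simp, erule env_agree_off) (use assms in simp_all)
    subgoal by (simp, erule holds_agree_off) (use assms in simp_all)
    subgoal using envD(6)[OF assms(1), of i] by (simp add: agree_off_def)
    subgoal by simp
    subgoal for s'' b by (auto simp: agree_off_def)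
    done
  subgoal premises prems for s' b
  proof -
    have e: "env s'" by (rule env_agree_off[OF prems(2)]) (use assms in simp_all)
    have h: "holds_str s' 2 m y" by (rule holds_agree_off[OF prems(2)]) (use assms in simp_all)
    have r: "reg s' 11 = reg s 11" "reg s' 34 = cost y" "reg s' 13 = 0" "arr s' 1 = arr s 1"
      "reg s' 35 = far y n * m"
      using prems n_pos by (auto simp: agree_off_def cost_def)
    show ?thesis
    proof (cases "cost y < reg s 11")
      case True
      then show ?thesis
        using prems(3) r n_pos apply (simp add: cost_def)
        apply (intro conjI, linarith, linarith, linarith, linarith)
        apply (rule wp_use[OF wp_COPY[where y = y]])
        using e h by (auto simp: agree_off_def)
    qed (use prems(3) r n_pos in \<open>auto simp: cost_def\<close>)
  qed
  done


section \<open>Repairing the number of ones\<close>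

lemma sum_upd:
  fixes f :: "nat \<Rightarrow> bool \<Rightarrow> nat"
  assumes "i < m"
  shows "(\<Sum>j<m. f j ((y(i := b)) j)) + f i (y i) = (\<Sum>j<m. f j (y j)) + f i b"
proof -
  have "(\<Sum>j<m. f j ((y(i := b)) j)) = f i b + (\<Sum>j\<in>{..<m}-{i}. f j (y j))"
    using assms by (subst sum.remove[of _ i]) auto
  moreover have "(\<Sum>j<m. f j (y j)) = f i (y i) + (\<Sum>j\<in>{..<m}-{i}. f j (y j))"
    using assms by (subst sum.remove[of _ i]) auto
  ultimately show ?thesis by simp
qed

lemma ones_upd: "i < m \<Longrightarrow> ones m (y(i := b)) + of_bool (y i) = ones m y + of_bool b"
  unfolding ones_def by (rule sum_upd)

lemma hdist_upd:
  "i < m \<Longrightarrow> hdist m (y(i := b)) z + of_bool (y i \<noteq> z i) = hdist m y z + of_bool (b \<noteq> z i)"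
  unfolding hdist_def by (rule sum_upd[where f = "\<lambda>j b. of_bool (b \<noteq> z j)"])

lemma holds_str_set_arr_reg [simp]:
  "holds_str (set_arr a i v (set_reg x w s)) b m y = holds_str (set_arr a i v s) b m y"
  by (simp add: holds_str_def)

lemma holds_str_upd:
  "holds_str s a m y \<Longrightarrow> holds_str (set_arr a i (of_bool b) s) a m (y(i := b))"
  by (auto simp: holds_str_def)

text \<open>Invariant of the repair scan. Every flip trades one unit of discrepancy in the number of
  ones for one unit of distance, and a discrepancy that persists forces the scanned prefix to be
  constant. After the last position that is impossible, because
  \<open>0 \<le> k \<le> m\<close>.\<close>

definition fixed :: "(nat \<Rightarrow> bool) \<Rightarrow> nat \<Rightarrow> (nat \<Rightarrow> bool) \<Rightarrow> bool" where
  "fixed y i y' \<longleftrightarrow> (\<forall>j\<ge>i. y' j = y j) \<and>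
     int (hdist m y' y) + \<bar>int (ones m y') - int k\<bar> = \<bar>int (ones m y) - int k\<bar> \<and>
     (\<forall>j<i. (ones m y' < k \<longrightarrow> y' j) \<and> (ones m y' > k \<longrightarrow> \<not> y' j))"

lemma wp_FIX:
  assumes "env s" "holds_str s 2 m y"
  shows "wp FIX (13 + 22 * m) (\<lambda>s' _. \<exists>y'. holds_str s' 2 m y' \<and> ones m y' = k \<and>
    int (hdist m y' y) = \<bar>int (ones m y) - int k\<bar>) s"
proof -
  have loop: "wp (For 26 1 27 (Seq (Load 30 2 26) (Cond 30
       (Seq (Sub 33 31 2) (Cond 33 (Seq (Store 2 26 13) (Sub 31 31 12)) SKIP))
       (Seq (Sub 33 2 31) (Cond 33 (Seq (Store 2 26 12) (Add 31 31 12)) SKIP)))))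
     (5 + 14 * m) (\<lambda>s' _. \<exists>y'. holds_str s' 2 m y' \<and> ones m y' = k \<and>
       int (hdist m y' y) = \<bar>int (ones m y) - int k\<bar>) s1"
    if s1: "env s1" "holds_str s1 2 m y" "reg s1 31 = ones m y" for s1
  proof (rule wp_For[where N = m and B = 9 and
      I = "\<lambda>i s'. \<exists>y'. holds_str s' 2 m y' \<and> reg s' 31 = ones m y' \<and> fixed y i y'"], goal_cases)
    case 9
    show ?case using s1 by (intro exI[of _ y]) (simp add: fixed_def hdist_def)
  next
    case (10 i s')
    then obtain y' where y': "holds_str s' 2 m y'" "reg s' 31 = ones m y'" "\<forall>j\<ge>i. y' j = y j"
      "int (hdist m y' y) + \<bar>int (ones m y') - int k\<bar> = \<bar>int (ones m y) - int k\<bar>"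
      "\<forall>j<i. (ones m y' < k \<longrightarrow> y' j) \<and> (ones m y' > k \<longrightarrow> \<not> y' j)" unfolding fixed_def by blast
    have e: "env s'" by (rule env_agree_off[OF 10(3)]) (use s1 in simp_all)
    have v: "arr s' 2 i = of_bool (y' i)" using y'(1) 10(1) by (simp add: holds_str_def)
    note o = ones_upd[OF 10(1), of y'] and h = hdist_upd[OF 10(1), of y' _ y]
    consider (down) "y' i" "ones m y' > k" | (up) "\<not> y' i" "ones m y' < k"
      | (same) "y' i \<longrightarrow> ones m y' \<le> k" "\<not> y' i \<longrightarrow> ones m y' \<ge> k" by linarith
    then show ?case
    proof cases
      case down
      define z where "z = y'(i := False)"
      have "holds_str (set_arr 2 i 0 s') 2 m z"
        using holds_str_upd[OF y'(1), of i False] by (simp add: z_def)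
      moreover have z: "Suc (ones m z) = ones m y'" "hdist m z y = Suc (hdist m y' y)"
        using down o[of False] h[of False] y'(3) by (simp_all add: z_def)
      moreover have "int (hdist m z y) + \<bar>int (ones m z) - int k\<bar> = \<bar>int (ones m y) - int k\<bar>"
        using y'(4) z down by linarith
      moreover have "\<forall>j\<ge>Suc i. z j = y j" using y'(3) by (simp add: z_def)
      moreover have "\<forall>j<Suc i. (ones m z < k \<longrightarrow> z j) \<and> (ones m z > k \<longrightarrow> \<not> z j)"
        using y'(5) down z by (auto simp: z_def less_Suc_eq)
      ultimately have "holds_str (set_arr 2 i 0 s') 2 m z" "fixed y (Suc i) z" "ones m z = ones m y' - 1"
        by (auto simp: fixed_def)
      then show ?thesis using down by (simp add: envD[OF e] v 10(2) y'(2)) (rule exI[of _ z], simp)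
    next
      case up
      define z where "z = y'(i := True)"
      have "holds_str (set_arr 2 i 1 s') 2 m z"
        using holds_str_upd[OF y'(1), of i True] by (simp add: z_def)
      moreover have z: "ones m z = Suc (ones m y')" "hdist m z y = Suc (hdist m y' y)"
        using up o[of True] h[of True] y'(3) by (simp_all add: z_def)
      moreover have "int (hdist m z y) + \<bar>int (ones m z) - int k\<bar> = \<bar>int (ones m y) - int k\<bar>"
        using y'(4) z up by linarith
      moreover have "\<forall>j\<ge>Suc i. z j = y j" using y'(3) by (simp add: z_def)
      moreover have "\<forall>j<Suc i. (ones m z < k \<longrightarrow> z j) \<and> (ones m z > k \<longrightarrow> \<not> z j)"
        using y'(5) up z by (auto simp: z_def less_Suc_eq)
      ultimately have "holds_str (set_arr 2 i 1 s') 2 m z" "fixed y (Suc i) z" "ones m z = ones m y' + 1"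
        by (auto simp: fixed_def)
      then show ?thesis using up by (simp add: envD[OF e] v 10(2) y'(2)) (rule exI[of _ z], simp)
    next
      case same
      then have "\<forall>j<Suc i. (ones m y' < k \<longrightarrow> y' j) \<and> (ones m y' > k \<longrightarrow> \<not> y' j)"
        using y'(5) by (auto simp: less_Suc_eq)
      with y'(3,4) have "fixed y (Suc i) y'" by (simp add: fixed_def)
      then show ?thesis using same y'(1)
        by (cases "y' i") (simp add: envD[OF e] v 10(2) y'(2), rule exI[of _ y'], simp)+
    qed
  next
    case (12 s' b)
    then obtain y' where y': "holds_str s' 2 m y'"
      "int (hdist m y' y) + \<bar>int (ones m y') - int k\<bar> = \<bar>int (ones m y) - int k\<bar>"
      "\<forall>j<m. (ones m y' < k \<longrightarrow> y' j) \<and> (ones m y' > k \<longrightarrow> \<not> y' j)" unfolding fixed_def by blast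
    have "ones m y' = k"
    proof (rule ccontr)
      assume "ones m y' \<noteq> k"
      then consider "ones m y' < k" | "ones m y' > k" by linarith
      then show False
      proof cases
        case 1
        then have "y' j" if "j < m" for j using y'(3) that by blast
        then have "ones m y' = (\<Sum>j<m. 1)" unfolding ones_def by (intro sum.cong refl) simp
        with 1 k_le_m show False by simp
      next
        case 2
        then have "\<not> y' j" if "j < m" for j using y'(3) that by blast
        then have "ones m y' = (\<Sum>j<m. 0)" unfolding ones_def by (intro sum.cong refl) simp
        with 2 show False by simp
      qed
    qed
    with y'(1,2) show ?case by (intro exI[of _ y']) simp
  qed (use envD[OF s1(1)] in simp_all)
  show ?thesis unfolding FIX_def
    apply simp
  proof (rule wp_For[where N = m and B = 3 and I = "\<lambda>i s'. reg s' 31 = ones i y"], goal_cases)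
    case (10 i s')
    then have "arr s' 2 i = of_bool (y i)" "reg s' 26 = i"
      using assms by (auto simp: agree_off_def holds_str_def)
    with 10 show ?case by (auto simp: ones_def)
  next
    case (12 s' b)
    have "env s'" by (rule env_agree_off[OF 12(2)]) (use assms in simp_all)
    moreover have "holds_str s' 2 m y" by (rule holds_agree_off[OF 12(2)]) (use assms in simp_all)
    ultimately show ?case using 12(1,3)
      by (intro wp_use[OF loop[simplified]]) auto
  qed (use envD[OF assms(1)] in \<open>auto simp: ones_def\<close>)
qed

end

section \<open>One step of the random walk\<close>

definition holds_list :: "state \<Rightarrow> nat \<Rightarrow> nat list \<Rightarrow> bool" where
  "holds_list s a xs \<longleftrightarrow> (\<forall>r<length xs. arr s a r = xs ! r)"

lemma holds_list_simps [simp]: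
  "holds_list s a []"
  "holds_list (set_reg x v s) a xs = holds_list s a xs"
  "a \<noteq> b \<Longrightarrow> holds_list (set_arr b i v s) a xs = holds_list s a xs"
  "holds_list (set_arr b i v (set_reg x w s)) a xs = holds_list (set_arr b i v s) a xs"
  by (simp_all add: holds_list_def)

lemma holds_list_snoc:
  "holds_list s a xs \<Longrightarrow> holds_list (set_arr a (length xs) x s) a (xs @ [x])"
  by (auto simp: holds_list_def nth_append less_Suc_eq)

context votes
begin

definition gains :: "(nat \<Rightarrow> bool) \<Rightarrow> nat \<Rightarrow> nat \<Rightarrow> nat list" where
  "gains y i j = filter (\<lambda>j. \<not> y j \<and> V i j) [0..<j]"

definition losses :: "(nat \<Rightarrow> bool) \<Rightarrow> nat \<Rightarrow> nat \<Rightarrow> nat list" where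
  "losses y i j = filter (\<lambda>j. y j \<and> \<not> V i j) [0..<j]"

lemma gains_losses_simps [simp]:
  "gains y i 0 = []" "losses y i 0 = []"
  "gains y i (Suc j) = (if \<not> y j \<and> V i j then gains y i j @ [j] else gains y i j)"
  "losses y i (Suc j) = (if y j \<and> \<not> V i j then losses y i j @ [j] else losses y i j)"
  by (simp_all add: gains_def losses_def)

definition swap_step :: "(nat \<Rightarrow> bool) \<Rightarrow> nat \<Rightarrow> nat \<Rightarrow> nat \<Rightarrow> (nat \<Rightarrow> bool)" where
  "swap_step y i v w = (let A = gains y i m; B = losses y i m in
     if A = [] \<or> B = [] then y
     else y(A ! (v mod length A) := True, B ! (w mod length B) := False))"

lemma wp_LISTS:
  assumes "env s" "holds_str s 2 m y" "reg s 35 = i * m" "i < n"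
  shows "wp LISTS (11 + 16 * m) (\<lambda>s' _. reg s' 40 = length (gains y i m) \<and>
     reg s' 41 = length (losses y i m) \<and> holds_list s' 8 (gains y i m) \<and>
     holds_list s' 9 (losses y i m)) s"
  unfolding LISTS_def
  apply simp
proof (rule wp_For[where N = m and B = 11 and
      I = "\<lambda>j s'. reg s' 32 = i * m + j \<and> reg s' 40 = length (gains y i j) \<and>
     reg s' 41 = length (losses y i j) \<and> holds_list s' 8 (gains y i j) \<and>
     holds_list s' 9 (losses y i j)"], goal_cases)
  case (10 j s')
  have "env s'" by (rule env_agree_off[OF 10(3)]) (use assms in simp_all)
  moreover have "holds_str s' 2 m y" by (rule holds_agree_off[OF 10(3)]) (use assms in simp_all)
  ultimately have "arr s' 2 j = of_bool (y j)" "arr s' 0 (i * m + j) = of_bool (V i j)"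
    "reg s' 12 = 1"
    using envD[of s'] 10(1) assms(4) by (auto simp: holds_str_def)
  with 10(1,2,4) show ?case
    using holds_list_snoc[of s' 8 "gains y i j" j] holds_list_snoc[of s' 9 "losses y i j" j]
    by (cases "y j"; cases "V i j") simp_all
qed (use assms envD[OF assms(1)] in simp_all)

text \<open>As long as \<open>g\<close> is positive and not above the value, each round lowers the
  value by at least 1, so \<open>T\<close> rounds are enough for a value below \<open>T\<close>. For
  \<open>g = 0\<close> both the loop and \<open>mod\<close> leave the value as it is.\<close>

lemma wp_MOD:
  assumes "env s" "reg s 4 = T" "reg s v < T" "v \<notin> {0, 1, 2, 4, 12, 13, 26, 27, 33, 39}" "g \<notin> {26, 27, 33, 39, v}"
  shows "wp (MOD v g) (5 + 11 * T) (\<lambda>s' _. reg s' v = reg s v mod reg s g) s"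
  unfolding MOD_def
proof (rule wp_For[where N = T and B = 6 and
      I = "\<lambda>i s'. reg s' v mod reg s g = reg s v mod reg s g \<and>
         (reg s' v + i \<le> reg s v \<or> reg s' v < reg s g \<or> reg s g = 0)"], goal_cases)
  case (10 i s')
  have "env s'" by (rule env_agree_off[OF 10(3)]) (use assms in auto)
  moreover have g: "reg s' g = reg s g" using 10(3) assms by (auto simp: agree_off_def)
  have m: "reg s g \<le> reg s' v \<Longrightarrow> (reg s' v - reg s g) mod reg s g = reg s' v mod reg s g"
    by (rule le_mod_geq[symmetric])
  show ?case
  proof (cases "reg s g \<le> reg s' v")
    case True
    then show ?thesis using 10(4) assms envD[OF calculation] g m[OF True] by auto
  next
    case False
    then show ?thesis using 10(4) assms envD[OF calculation] g by auto
  qed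
next
  case (12 s' b)
  then have "reg s' v < reg s g \<or> reg s g = 0" using assms(3) by auto
  with 12(1) show ?case by auto
qed (use assms envD[OF assms(1)] in auto)

lemma set_gains: "set (gains y i m) = {j. j < m \<and> \<not> y j \<and> V i j}"
  and set_losses: "set (losses y i m) = {j. j < m \<and> y j \<and> \<not> V i j}"
  by (auto simp: gains_def losses_def)

lemma nth_gains: "gains y i m \<noteq> [] \<Longrightarrow> gains y i m ! (v mod length (gains y i m)) \<in> {j. j < m \<and> \<not> y j \<and> V i j}"
  and nth_losses: "losses y i m \<noteq> [] \<Longrightarrow> losses y i m ! (v mod length (losses y i m)) \<in> {j. j < m \<and> y j \<and> \<not> V i j}"
  unfolding set_gains[symmetric] set_losses[symmetric] by simp_all

lemma ones_swap_step: "ones m (swap_step y i v w) = ones m y"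
proof (cases "gains y i m = [] \<or> losses y i m = []")
  case False
  define a b where "a = gains y i m ! (v mod length (gains y i m))"
    and "b = losses y i m ! (w mod length (losses y i m))"
  have ab: "a < m" "\<not> y a" "b < m" "y b"
    using nth_gains[of y i v] nth_losses[of y i w] False by (auto simp: a_def b_def)
  then have "a \<noteq> b" by auto
  have "swap_step y i v w = y(a := True, b := False)"
    using False by (auto simp: swap_step_def Let_def a_def b_def)
  then show ?thesis
    using ones_upd[OF ab(3), of "y(a := True)" False] ones_upd[OF ab(1), of y True] ab \<open>a \<noteq> b\<close> by simp
qed (auto simp: swap_step_def Let_def)

lemma wp_STEP:
  assumes "env s" "holds_str s 2 m y" "reg s 35 = i * m" "i < n" "reg s 4 = T"
    and "arr s 7 (reg s 15) < T" "arr s 7 (Suc (reg s 15)) < T"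
  shows "wp STEP (60 + 16 * m + 22 * T) (\<lambda>s' _.
     holds_str s' 2 m (swap_step y i (arr s 7 (reg s 15)) (arr s 7 (Suc (reg s 15)))) \<and>
     reg s' 15 = reg s 15 + 2) s"
proof -
  let ?v = "arr s 7 (reg s 15)" and ?w = "arr s 7 (Suc (reg s 15))"
  let ?A = "gains y i m" and ?B = "losses y i m"
  show ?thesis unfolding STEP_def wp_Seq[of LISTS]
  proof (intro conjI, simp, rule wp_use[OF wp_LISTS[OF assms(1-4)]], simp, goal_cases)
    case (1 s1 b1)
    note e1 = env_agree_off[OF 1(2) assms(1), simplified]
    note h1 = holds_agree_off[OF 1(2) assms(2), simplified]
    have r1: "reg s1 15 = reg s 15" "arr s1 7 = arr s 7" "reg s1 4 = T" "reg s1 12 = 1"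
      using 1(2) assms envD[OF e1] by (auto simp: agree_off_def)
    have b: "48 + 22 * T \<le> b1" using 1(3) by simp
    show ?case
      apply (simp add: r1)
      apply (intro conjI; (use b in linarith)?)
      apply (rule wp_use[OF wp_MOD[where T = T]])
      subgoal using e1 by simp
      subgoal using r1 by simp
      subgoal using assms by simp
      subgoal by simp
      subgoal by simp
      subgoal using b by simp
      subgoal premises p2 for s2 b2
        apply (rule conjI, use b p2(3) in arith)
        apply (rule wp_use[OF wp_MOD[where T = T]])
        subgoal using env_agree_off[OF p2(2)] e1 by simp
        subgoal using p2(2) r1 by (simp add: agree_off_def)
        subgoal using p2(2) assms by (simp add: agree_off_def)
        subgoal by simp
        subgoal by simp
        subgoal using b p2(3) by simp
        subgoal premises p3 for s3 b3
        proof -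
          have b3: "20 \<le> b3" using b p2(3) p3(3) by linarith
          have r: "reg s3 40 = length ?A" "reg s3 41 = length ?B" "reg s3 12 = 1" "reg s3 13 = 0"
            "holds_list s3 8 ?A" "holds_list s3 9 ?B" "holds_str s3 2 m y" "reg s3 15 = reg s 15 + 2"
            "reg s3 42 = ?v mod length ?A" "reg s3 43 = ?w mod length ?B"
            using p2(1,2) p3(1,2) 1(1) r1 envD[OF e1] h1
            by (simp_all add: agree_off_def holds_list_def holds_str_def)
          show ?thesis
          proof (cases "?A = [] \<or> ?B = []")
            case True
            then have "swap_step y i ?v ?w = y" by (auto simp: swap_step_def Let_def)
            then show ?thesis using r b3 True by auto
          next
            case False
            define a c where "a = ?A ! (?v mod length ?A)" and "c = ?B ! (?w mod length ?B)"
            have q: "arr s3 8 (?v mod length ?A) = a" "arr s3 9 (?w mod length ?B) = c"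
              using r(5,6) False by (auto simp: holds_list_def a_def c_def)
            have sw: "swap_step y i ?v ?w = y(a := True, c := False)"
              using False by (simp add: swap_step_def Let_def a_def c_def)
            have "holds_str (set_arr 2 c (of_bool False) (set_arr 2 a (of_bool True) s3)) 2 m
                    (swap_step y i ?v ?w)"
              unfolding sw by (intro holds_str_upd r(7))
            then have "holds_str (set_arr 2 c 0 (set_reg 44 c (set_arr 2 a 1 (set_reg 44 a s3)))) 2 m
                    (swap_step y i ?v ?w)"
              by (subst holds_str_cong[where s' = "set_arr 2 c (of_bool False) (set_arr 2 a (of_bool True) s3)"])
                 simp_all
            then show ?thesis using r(1-4,8-10) b3 False q by simp (intro conjI; linarith)
          qed
        qed
        done
      done
  qed
qed

end

section \<open>Trials as functions of the random numbers\<close>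

locale trials = votes +
  fixes T D :: nat and z :: "nat \<Rightarrow> nat \<Rightarrow> bool" and y0 :: "nat \<Rightarrow> bool"
  assumes ones_y0: "ones m y0 = k"
begin

text \<open>The coins are an arbitrary function \<open>c\<close>, read from offset \<open>p\<close>:
  a trial is thereby a deterministic function of them, and probability enters only when such
  functions are counted.\<close>

definition rounded :: "(nat \<Rightarrow> nat) \<Rightarrow> nat \<Rightarrow> (nat \<Rightarrow> bool)" where
  "rounded c p j = z (c (p + j)) j"

primrec walk :: "(nat \<Rightarrow> nat) \<Rightarrow> nat \<Rightarrow> nat \<Rightarrow> (nat \<Rightarrow> bool)" where
  "walk c p 0 = y0"
| "walk c p (Suc h) =
     swap_step (walk c p h) (far (walk c p h) n) (c (p + 2 * h)) (c (Suc (p + 2 * h)))"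

definition env2 :: "state \<Rightarrow> bool" where
  "env2 s \<longleftrightarrow> env s \<and> reg s 4 = T \<and> reg s 6 = D \<and> holds_str s 3 m y0 \<and>
     (\<forall>j<m. \<forall>t<T. arr s 6 (j * T + t) = of_bool (z t j))"

lemma env2_agree_off:
  assumes "agree_off X A s s'" "env2 s" "X \<inter> {0, 1, 2, 4, 6, 12, 13} = {}" "A \<inter> {0, 3, 6} = {}"
  shows "env2 s'"
proof -
  have "env s'" by (rule env_agree_off[OF assms(1)]) (use assms in \<open>auto simp: env2_def\<close>)
  moreover have "reg s' x = reg s x" if "x \<in> {4, 6}" for x
    using assms(1,3) that by (auto simp: agree_off_def)
  moreover have "arr s' x = arr s x" if "x \<in> {3, 6}" for x
    using assms(1,4) that by (auto simp: agree_off_def)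
  ultimately show ?thesis using assms(2) by (auto simp: env2_def holds_str_def)
qed

lemma env2_simps [simp]:
  "x \<notin> {0, 1, 2, 4, 6, 12, 13} \<Longrightarrow> env2 (set_reg x v s) = env2 s"
  by (auto simp: env2_def)

lemma env2_env: "env2 s \<Longrightarrow> env s" by (simp add: env2_def)

lemma ones_walk: "ones m (walk c p h) = k"
  by (induction h) (simp_all add: ones_y0 ones_swap_step)

text \<open>The value \<open>m + 1\<close> is the sentinel for an empty record.\<close>

definition out_ok :: "state \<Rightarrow> bool" where
  "out_ok s \<longleftrightarrow> reg s 11 = m + 1 \<or> (\<exists>y. holds_str s 1 m y \<and> ones m y = k \<and> cost y = reg s 11)"

lemma out_ok_agree_off:
  "agree_off X A s s' \<Longrightarrow> out_ok s \<Longrightarrow> 11 \<notin> X \<Longrightarrow> 1 \<notin> A \<Longrightarrow> out_ok s'"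
  by (simp add: out_ok_def agree_off_def holds_str_def)

lemma out_ok_simps [simp]: "x \<noteq> 11 \<Longrightarrow> out_ok (set_reg x v s) = out_ok s"
  by (simp add: out_ok_def)

text \<open>The repaired string is described only by what \<open>FIX\<close> guarantees about it,
  hence the existential quantifier. The walk is evaluated before each of its \<open>D\<close> swaps,
  so its strings count up to index \<open>D - 1\<close>, and the one after the last swap is never
  evaluated.\<close>

definition trial_ok :: "(nat \<Rightarrow> nat) \<Rightarrow> nat \<Rightarrow> nat \<Rightarrow> bool" where
  "trial_ok c p b \<longleftrightarrow>
     (\<exists>y. ones m y = k \<and> int (hdist m y (rounded c p)) = \<bar>int (ones m (rounded c p)) - int k\<bar> \<and>
        b \<le> cost y) \<and>
     (\<forall>h<D. b \<le> cost (walk c (p + m) h))"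

lemma trial_ok_mono: "trial_ok c p b \<Longrightarrow> b' \<le> b \<Longrightarrow> trial_ok c p b'"
  unfolding trial_ok_def using order_trans by blast

abbreviation eval_time :: nat where "eval_time \<equiv> 40 + 8 * m + n * (25 + 14 * m)"
abbreviation trial_time :: nat where
  "trial_time \<equiv> 40 + 46 * m + eval_time + D * (66 + 16 * m + 22 * T + eval_time)"

lemma wp_EVAL':
  assumes "env s" "holds_str s 2 m y" "out_ok s" "ones m y = k"
  shows "wp EVAL eval_time (\<lambda>s' _. reg s' 35 = far y n * m \<and> out_ok s' \<and>
     reg s' 11 \<le> reg s 11 \<and> reg s' 11 \<le> cost y) s"
proof (rule wp_use[OF wp_EVAL[OF assms(1,2)] order_refl], goal_cases)
  case (1 s' b)
  have "out_ok s'"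
  proof (cases "cost y < reg s 11")
    case True
    then show ?thesis using 1(1) assms(4) by (auto simp: out_ok_def)
  next
    case False
    then show ?thesis using 1(1) assms(3) by (auto simp: out_ok_def holds_str_def)
  qed
  with 1 show ?case by auto
qed

lemma wp_ROUNDING:
  assumes "env2 s" "\<And>j. j < m \<Longrightarrow> arr s 7 (reg s 15 + j) < T"
  shows "wp ROUNDING (7 + 16 * m) (\<lambda>s' _. holds_str s' 2 m (rounded (arr s 7) (reg s 15)) \<and>
     reg s' 15 = reg s 15 + m) s"
  unfolding ROUNDING_def
  apply simp
proof (rule wp_For[where N = m and B = 11 and I = "\<lambda>j s'. reg s' 15 = reg s 15 + j \<and> reg s' 45 = j * T \<and>
    (\<forall>i<j. arr s' 2 i = of_bool (rounded (arr s 7) (reg s 15) i))"], goal_cases)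
  case (10 j s')
  have e: "env2 s'" by (rule env2_agree_off[OF 10(3)]) (use assms in simp_all)
  have "arr s' 7 = arr s 7" using 10(3) by (simp add: agree_off_def)
  moreover have "arr s' 6 (arr s 7 (reg s 15 + j) + j * T) = of_bool (rounded (arr s 7) (reg s 15) j)"
    using e 10(1) assms(2)[OF 10(1)] unfolding env2_def rounded_def
    by (metis add.commute)
  ultimately show ?case using 10(1,2,4) e envD[OF env2_env[OF e]]
    by (simp add: env2_def less_Suc_eq)
next
  case (12 s' b)
  then show ?case by (simp add: holds_str_def)
qed (use envD[OF env2_env[OF assms(1)]] in simp_all)

lemma wp_TRIAL:
  assumes "env2 s" "out_ok s" "\<And>j. j < m + 2 * D \<Longrightarrow> arr s 7 (reg s 15 + j) < T"
  shows "wp TRIAL trial_time (\<lambda>s' _. out_ok s' \<and> reg s' 15 = reg s 15 + (m + 2 * D) \<and>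
     reg s' 11 \<le> reg s 11 \<and> trial_ok (arr s 7) (reg s 15) (reg s' 11)) s"
proof -
  let ?c = "arr s 7" and ?p = "reg s 15"
  show ?thesis unfolding TRIAL_def wp_Seq
  proof (intro conjI, simp, rule wp_use[OF wp_ROUNDING], goal_cases)
    case (4 s1 b1)
    have e1: "env2 s1" by (rule env2_agree_off[OF 4(2)]) (use assms in simp_all)
    have o1: "out_ok s1" by (rule out_ok_agree_off[OF 4(2)]) (use assms in simp_all)
    have r1: "arr s1 7 = ?c" "reg s1 11 = reg s 11" using 4(2) by (simp_all add: agree_off_def)
    show ?case
    proof (intro conjI, use 4(3) in linarith,
        rule wp_use[OF wp_FIX[OF env2_env[OF e1] conjunct1[OF 4(1)]]], goal_cases)
      case (2 s2 b2)
      then obtain y where y: "holds_str s2 2 m y" "ones m y = k"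
        "int (hdist m y (rounded ?c ?p)) = \<bar>int (ones m (rounded ?c ?p)) - int k\<bar>" by blast
      have e2: "env2 s2" by (rule env2_agree_off[OF 2(2) e1]) simp_all
      have o2: "out_ok s2" by (rule out_ok_agree_off[OF 2(2) o1]) simp_all
      have r2: "arr s2 7 = ?c" "reg s2 11 = reg s 11" "reg s2 15 = ?p + m"
        using 2(2) r1 4(1) by (simp_all add: agree_off_def)
      show ?case
      proof (intro conjI, use 4(3) 2(3) in linarith,
          rule wp_use[OF wp_EVAL'[OF env2_env[OF e2] y(1) o2 y(2)]], goal_cases)
        case (2 s3 b3)
        have e3: "env2 s3" by (rule env2_agree_off[OF 2(2) e2]) simp_all
        have r3: "arr s3 7 = ?c" "reg s3 11 \<le> reg s 11" "reg s3 15 = ?p + m" "reg s3 11 \<le> cost y"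
          using 2(1,2) r2 by (simp_all add: agree_off_def)
        have b3: "7 + 8 * m + (5 + D * (66 + 16 * m + 22 * T + eval_time)) \<le> b3"
          using 4(3) \<open>b1 - 1 - (13 + 22 * m) \<le> b2\<close> 2(3) by linarith
        show ?case
        proof (intro conjI, use b3 in linarith,
            rule wp_use[OF wp_COPY[OF env2_env[OF e3], of 3 y0]], goal_cases)
          case 1 show ?case using e3 by (simp add: env2_def)
        next
          case 2 show ?case by simp
        next
          case 3 show ?case using b3 by linarith
        next
          case (4 s4 b4)
          have e4: "env2 s4" by (rule env2_agree_off[OF 4(2) e3]) simp_all
          have o4: "out_ok s4" by (rule out_ok_agree_off[OF 4(2)]) (use 2(1) in simp_all)
          have r4: "arr s4 7 = ?c" "reg s4 11 \<le> reg s 11" "reg s4 15 = ?p + m" "reg s4 11 \<le> cost y"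
            using 4(2) r3 by (simp_all add: agree_off_def)
          have b4: "5 + D * (66 + 16 * m + 22 * T + eval_time) \<le> b4" using b3 4(3) by linarith
          show ?case
          proof (rule wp_For[where N = D and B = "61 + 16 * m + 22 * T + eval_time" and
              I = "\<lambda>h s'. out_ok s' \<and> reg s' 11 \<le> reg s4 11 \<and> reg s' 15 = ?p + m + 2 * h \<and>
                 holds_str s' 2 m (walk ?c (?p + m) h) \<and>
                 (\<forall>g<h. reg s' 11 \<le> cost (walk ?c (?p + m) g))"], goal_cases)
            case (10 h s')
            have e: "env2 s'" by (rule env2_agree_off[OF 10(3) e4]) simp_all
            have r: "arr s' 7 = ?c" using 10(3) r4 by (simp add: agree_off_def)
            show ?case unfolding wp_Seq
            proof (intro conjI, simp, rule wp_use[OF wp_EVAL'[OF env2_env[OF e], where y = "walk ?c (?p + m) h"]], goal_cases)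
              case (5 s5 b5)
              have e5: "env2 s5" by (rule env2_agree_off[OF 5(2) e]) simp_all
              have h5: "holds_str s5 2 m (walk ?c (?p + m) h)"
                by (rule holds_agree_off[OF 5(2)]) (use 10(4) in simp_all)
              have r5: "arr s5 7 = ?c" "reg s5 15 = ?p + m + 2 * h"
                using 5(2) 10(4) r by (simp_all add: agree_off_def)
              show ?case
              proof (rule wp_use[OF wp_STEP[OF env2_env[OF e5] h5 conjunct1[OF 5(1)], where T = T]], goal_cases)
                case (6 s6 b6)
                have "out_ok s6" by (rule out_ok_agree_off[OF 6(2)]) (use 5(1) in simp_all)
                moreover have "reg s6 11 = reg s5 11" using 6(2) by (simp add: agree_off_def)
                ultimately show ?case using 5(1) 6(1) r5 10(4) by (auto simp: less_Suc_eq)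
              next
                case 1 show ?case using far_less n_pos by simp
              next
                case 3 show ?case using assms(3)[of "m + 2 * h"] 10(1) r5 by (simp add: add.assoc)
              next
                case 4 show ?case using assms(3)[of "Suc (m + 2 * h)"] 10(1) r5 by (simp add: add.assoc)
              qed (use e5 5(3) in \<open>auto simp: env2_def\<close>)
            qed (use 10(4) ones_walk in auto)
          next
            case (12 s' b)
            then show ?case using r4 y unfolding trial_ok_def by fastforce
          next
            case 11 show ?case using b4 by (simp add: algebra_simps)
          qed (use e4 o4 r4 4(1) envD[OF env2_env[OF e4]] in \<open>auto simp: env2_def\<close>)
        qed
      qed (use 4(3) 2(3) in linarith)
    qed (use 4(3) in linarith)
  qed (use assms in simp_all)
qed

lemma wp_TRIALS:
  assumes "env2 s" "reg s 7 = N" "\<And>j. j < N * (m + 2 * D) \<Longrightarrow> arr s 7 j < T"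
  shows "wp TRIALS (9 + N * (trial_time + 5)) (\<lambda>s' _. out_ok s' \<and>
     (\<forall>u<N. trial_ok (arr s 7) (u * (m + 2 * D)) (reg s' 11))) s"
  unfolding TRIALS_def
  apply simp
proof (rule wp_For[where N = N and B = trial_time and
    I = "\<lambda>u s'. out_ok s' \<and> reg s' 15 = u * (m + 2 * D) \<and>
       (\<forall>i<u. trial_ok (arr s 7) (i * (m + 2 * D)) (reg s' 11))"], goal_cases)
  case (10 u s')
  have e: "env2 s'" by (rule env2_agree_off[OF 10(3)]) (use assms in simp_all)
  have r: "arr s' 7 = arr s 7" using 10(3) by (simp add: agree_off_def)
  show ?case
  proof (rule wp_use[OF wp_TRIAL[OF e]], goal_cases)
    case (2 j)
    have "u * (m + 2 * D) + j < Suc u * (m + 2 * D)" using 2 by simp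
    also have "\<dots> \<le> N * (m + 2 * D)" using 10(1) by (intro mult_le_mono1) simp
    finally show ?case using assms(3) r 10(4) by simp
  next
    case (4 s'' b)
    then show ?case using 10(4) r trial_ok_mono by (auto simp: less_Suc_eq)
  qed (use 10(4) in simp_all)
next
  case 9 show ?case using envD[OF env2_env[OF assms(1)]] by (simp add: out_ok_def)
qed (use assms envD[OF env2_env[OF assms(1)]] in \<open>simp_all\<close>)

end

section \<open>Programs that compute the parameters\<close>

definition LOGS :: com where
  "LOGS = Seq (Const 12 1) (Seq (Const 40 1)
    (Seq (For 20 0 21 (Seq (Sub 41 0 40) (Cond 41 (Seq (Add 40 40 40) (Add 3 3 12)) SKIP)))
    (Seq (Const 4 1)
         (For 20 1 21 (Seq (Sub 41 1 4) (Cond 41 (Seq (Add 4 4 4) (Add 5 5 12)) SKIP))))))"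

definition COUNTS :: "nat \<Rightarrow> nat \<Rightarrow> nat \<Rightarrow> com" where
  "COUNTS C \<beta> R = Seq (Const 6 1) (Seq (Const 41 C) (Seq (Const 42 \<beta>)
    (Seq (For 20 3 21 (Add 6 6 41)) (Seq (For 20 3 21 (Add 14 14 42))
    (Seq (Const 7 R) (For 20 14 21 (Add 7 7 7)))))))"

definition SIZES :: "nat \<Rightarrow> com" where
  "SIZES q = Seq (Add 8 1 6) (Seq (Add 8 8 6)
    (Seq (For 20 7 21 (Add 9 9 8))
    (Seq (Cond 3 (Const 41 q) (Const 41 0))
         (For 20 1 21 (Add 10 10 41)))))"

definition SETUP :: "nat \<Rightarrow> nat \<Rightarrow> nat \<Rightarrow> nat \<Rightarrow> com" where
  "SETUP C \<beta> q R = Seq LOGS (Seq (COUNTS C \<beta> R) (SIZES q))"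

definition PREPARE :: "nat \<Rightarrow> nat \<Rightarrow> nat \<Rightarrow> nat \<Rightarrow> com" where
  "PREPARE C \<beta> q R = Seq (SETUP C \<beta> q R) (Seq (COPY 0 2) (Seq FIX (Seq (COPY 2 3) WEIGHTS)))"

lemma mult_add_inj:
  fixes t t' T i j :: nat
  assumes "t < T" "t' < T" "i * T + t = j * T + t'"
  shows "i = j \<and> t = t'"
proof -
  have "(i * T + t) div T = i" "(j * T + t') div T = j" using assms(1,2) by simp_all
  then show ?thesis using assms(3) by simp
qed

section \<open>Correctness of the weights phase\<close>

context votes
begin

definition score :: "(nat \<Rightarrow> nat) \<Rightarrow> nat \<Rightarrow> nat" where
  "score w j = (\<Sum>i<n. w i * of_bool (V i j))"

definition selects_top :: "(nat \<Rightarrow> nat) \<Rightarrow> (nat \<Rightarrow> bool) \<Rightarrow> nat \<Rightarrow> bool" where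
  "selects_top sc y a \<longleftrightarrow> ones m y = a \<and> (\<forall>j<m. \<forall>j'<m. y j \<longrightarrow> \<not> y j' \<longrightarrow> sc j' \<le> sc j)"

text \<open>Selecting the \<open>k\<close> columns of largest weighted score minimises the weighted total distance
  to the votes, so \<open>z t\<close> is a best response to the weights \<open>w t\<close>.\<close>

definition mw_run :: "nat \<Rightarrow> nat \<Rightarrow> (nat \<Rightarrow> nat \<Rightarrow> bool) \<Rightarrow> (nat \<Rightarrow> nat \<Rightarrow> nat) \<Rightarrow> bool" where
  "mw_run Q T z w \<longleftrightarrow> (\<forall>i<n. w 0 i = 1) \<and> (\<forall>t<T. selects_top (score (w t)) (z t) k \<and>
     (\<forall>i<n. w (Suc t) i = w t i * (Q + hdist m (z t) (V i))))"

lemma hdist_le: "hdist m y x \<le> m"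
  unfolding hdist_def by (rule order_trans[OF sum_bounded_above[where K = 1]]) auto

lemma wp_SCORE:
  assumes "env s" "\<And>i. i < n \<Longrightarrow> arr s 4 i = w i"
  shows "wp SCORE (5 + m * (16 + 13 * n)) (\<lambda>s' _. \<forall>j<m. arr s' 5 j = score w j) s"
  unfolding SCORE_def
proof (rule wp_For[where N = m and B = "11 + 13 * n" and I = "\<lambda>j s'. \<forall>i<j. arr s' 5 i = score w i"], goal_cases)
  case (10 j s')
  have e: "env s'" by (rule env_agree_off[OF 10(3) assms(1)]) simp_all
  have w: "arr s' 4 = arr s 4" using 10(3) by (simp add: agree_off_def)
  have "wp (For 26 0 27 (Seq (Load 30 0 32) (Seq (Load 33 4 26) (Seq (Add 32 32 1)
        (Cond 30 (Add 31 31 33) SKIP))))) (5 + 13 * n)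
        (\<lambda>s'' _. reg s'' 31 = score w j) (set_reg 32 j (set_reg 31 0 s'))"
  proof (rule wp_For[where N = n and B = 8 and
      I = "\<lambda>i s'. reg s' 31 = (\<Sum>i<i. w i * of_bool (V i j)) \<and> reg s' 32 = j + i * m"], goal_cases)
    case (10 i s'')
    have e2: "env s''" by (rule env_agree_off[OF 10(3)]) (use e in simp_all)
    have "arr s'' 4 i = w i" using 10(1,3) w assms(2) by (simp add: agree_off_def)
    moreover have "arr s'' 0 (j + i * m) = of_bool (V i j)"
      using envD(6)[OF e2 10(1) \<open>j < m\<close>] by (simp add: add.commute)
    ultimately show ?case using 10(2,4) envD(1-5)[OF e2] by (cases "V i j") simp_all
  qed (use envD[OF e] in \<open>simp_all add: score_def\<close>)
  then show ?case
    using 10(2) envD[OF e] apply simp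
    apply (erule wp_use)
    using 10(4) by (auto simp: agree_off_def less_Suc_eq)
qed (use envD[OF assms(1)] in simp_all)

lemma wp_TOP:
  assumes "env s" "\<And>j. j < m \<Longrightarrow> arr s 5 j = sc j"
  shows "wp TOP (11 + 6 * m + k * (16 + 18 * m)) (\<lambda>s' _. \<exists>y. holds_str s' 2 m y \<and> selects_top sc y k) s"
proof -
  have inner: "wp (For 26 1 27 (Seq (Load 30 2 26) (Cond 30 SKIP (Seq (Load 31 5 26) (Seq (Add 31 31 12)
       (Seq (Sub 33 31 34) (Cond 33 (Seq (Add 34 31 13) (Add 35 26 13)) SKIP)))))))
       (5 + 18 * m) (\<lambda>s' _. reg s' 35 < m \<and> \<not> y (reg s' 35) \<and> (\<forall>j<m. \<not> y j \<longrightarrow> sc j \<le> sc (reg s' 35))) s'"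
    if e: "env s'" and h: "holds_str s' 2 m y" and sc: "\<And>j. j < m \<Longrightarrow> arr s' 5 j = sc j"
      and r: "reg s' 34 = 0" and y: "ones m y < m" for s' y
  proof (rule wp_For[where N = m and B = 13 and
      I = "\<lambda>j s'. (\<forall>i<j. \<not> y i \<longrightarrow> sc i < reg s' 34) \<and>
         (reg s' 34 = 0 \<or> (reg s' 35 < j \<and> \<not> y (reg s' 35) \<and> reg s' 34 = Suc (sc (reg s' 35))))"], goal_cases)
    case (10 j s'')
    have e2: "env s''" by (rule env_agree_off[OF 10(3) e]) simp_all
    have v: "arr s'' 2 j = of_bool (y j)" "arr s'' 5 j = sc j"
      using 10(1,3) h sc by (simp_all add: agree_off_def holds_str_def)
    show ?case
    proof (cases "y j")
      case True
      then have "\<forall>i<Suc j. \<not> y i \<longrightarrow> sc i < reg s'' 34"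
        "reg s'' 34 = 0 \<or> (reg s'' 35 < Suc j \<and> \<not> y (reg s'' 35) \<and> reg s'' 34 = Suc (sc (reg s'' 35)))"
        using 10(4) less_SucI less_Suc_eq by blast+
      then show ?thesis using True by (simp add: v 10(2))
    next
      case False
      show ?thesis
      proof (cases "reg s'' 34 < Suc (sc j)")
        case True
        have "\<forall>i<Suc j. \<not> y i \<longrightarrow> sc i < Suc (sc j)"
        proof (intro allI impI)
          fix i assume "i < Suc j" "\<not> y i"
          then consider "i = j" | "sc i < reg s'' 34" using 10(4) less_Suc_eq by blast
          then show "sc i < Suc (sc j)" using True by cases simp_all
        qed
        then show ?thesis using False True by (simp add: v 10(2) envD(1-5)[OF e2])
      next
        case False2: False
        have "\<forall>i<Suc j. \<not> y i \<longrightarrow> sc i < reg s'' 34"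
        proof (intro allI impI)
          fix i assume "i < Suc j" "\<not> y i"
          then consider "i = j" | "sc i < reg s'' 34" using 10(4) less_Suc_eq by blast
          then show "sc i < reg s'' 34" using False2 by cases simp_all
        qed
        moreover have "reg s'' 34 = 0 \<or> (reg s'' 35 < Suc j \<and> \<not> y (reg s'' 35) \<and> reg s'' 34 = Suc (sc (reg s'' 35)))"
          using 10(4) less_SucI by blast
        ultimately show ?thesis using False False2 by (simp add: v 10(2) envD(1-5)[OF e2])
      qed
    qed
  next
    case (12 s'' b)
    \<comment> \<open>With fewer than \<open>m\<close> columns selected, some column is free; hence
      register 34 cannot still be 0, and register 35 is the index of an actual candidate rather than
      its initial value.\<close>
    have "\<exists>j<m. \<not> y j"
    proof (rule ccontr)
      assume "\<not> (\<exists>j<m. \<not> y j)"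
      then have "ones m y = (\<Sum>j<m. 1)" unfolding ones_def by (intro sum.cong refl) simp
      with y show False by simp
    qed
    with 12(1) show ?case by auto
  qed (use envD[OF e] r in auto)
  have outer: "wp (For 22 2 23 (Seq (Const 34 0) (Seq (Const 35 0)
     (Seq (For 26 1 27 (Seq (Load 30 2 26) (Cond 30 SKIP (Seq (Load 31 5 26) (Seq (Add 31 31 12)
       (Seq (Sub 33 31 34) (Cond 33 (Seq (Add 34 31 13) (Add 35 26 13)) SKIP)))))))
     (Store 2 35 12))))) (5 + k * (16 + 18 * m)) (\<lambda>s' _. \<exists>y. holds_str s' 2 m y \<and> selects_top sc y k) s1"
    if e: "env s1" and h: "holds_str s1 2 m (\<lambda>_. False)" and sc: "\<And>j. j < m \<Longrightarrow> arr s1 5 j = sc j" for s1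
  proof (rule wp_For[where N = k and B = "11 + 18 * m" and
      I = "\<lambda>a s'. \<exists>y. holds_str s' 2 m y \<and> selects_top sc y a"], goal_cases)
    case 9
    show ?case using h by (intro exI[of _ "\<lambda>_. False"]) (simp add: selects_top_def ones_def)
  next
    case (10 a s')
    then obtain y where y: "holds_str s' 2 m y" "selects_top sc y a" by blast
    have e2: "env s'" by (rule env_agree_off[OF 10(3) e]) simp_all
    have sc2: "arr s' 5 j = sc j" if "j < m" for j using 10(3) sc that by (simp add: agree_off_def)
    have y_lt: "ones m y < m" using y(2) 10(1) k_le_m by (simp add: selects_top_def)
    show ?case
      apply simp
      apply (rule wp_use[OF inner[where y = y, simplified]])
      subgoal using e2 by simp
      subgoal using y by simp
      subgoal using sc2 by simp
      subgoal by simp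
      subgoal by (rule y_lt)
      subgoal by simp
      subgoal premises p for s3 b3
      proof -
        define i where "i = reg s3 35"
        have i: "i < m" "\<not> y i" "\<forall>j<m. \<not> y j \<longrightarrow> sc j \<le> sc i" using p(1) by (auto simp: i_def)
        have "holds_str s3 2 m y" using p(2) y(1) by (simp add: agree_off_def holds_str_def)
        from holds_str_upd[OF this, of i True]
        have "holds_str (set_arr 2 i (Suc 0) s3) 2 m (y(i := True))" by simp
        moreover have "selects_top sc (y(i := True)) (Suc a)"
          using y(2) i ones_upd[OF i(1), of y True] unfolding selects_top_def by auto
        moreover have "reg s3 12 = 1" using p(2) envD[OF e2] by (simp add: agree_off_def)
        ultimately show ?thesis using p(3) by (auto simp: i_def)
      qed
      done
  qed (use envD[OF e] in simp_all)
  show ?thesis unfolding TOP_def wp_Seq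
  proof (intro conjI, simp, rule wp_For[where N = m and B = 1 and
      I = "\<lambda>i s'. \<forall>j<i. arr s' 2 j = 0"], goal_cases)
    case (10 i s')
    then show ?case using envD[OF env_agree_off[OF 10(3) assms(1)]] by (auto simp: less_Suc_eq)
  next
    case (12 s' b)
    show ?case
      by (rule wp_use[OF outer])
         (use 12 env_agree_off[OF 12(2) assms(1)] assms(2) in \<open>auto simp: agree_off_def holds_str_def\<close>)
  qed (use envD[OF assms(1)] in simp_all)
qed

lemma wp_UPDATE:
  assumes "env s" "holds_str s 2 m y" "\<And>i. i < n \<Longrightarrow> arr s 4 i = w i" "reg s 10 = Q"
  shows "wp UPDATE (7 + n * (26 + 20 * m + 6 * Q))
    (\<lambda>s' _. \<forall>i<n. arr s' 4 i = w i * (Q + hdist m y (V i))) s"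
  unfolding UPDATE_def
  apply simp
proof (rule wp_For[where N = n and B = "21 + 20 * m + 6 * Q" and
    I = "\<lambda>i s'. reg s' 32 = i * m \<and> (\<forall>i'<n. arr s' 4 i' = (if i' < i then w i' * (Q + hdist m y (V i')) else w i'))"], goal_cases)
  case (10 i s')
  have e: "env s'" by (rule env_agree_off[OF 10(3)]) (use assms in simp_all)
  have h: "holds_str s' 2 m y" by (rule holds_agree_off[OF 10(3)]) (use assms in simp_all)
  show ?case unfolding wp_Seq[of HAM]
  proof (intro conjI, simp, rule wp_use[OF wp_HAM[OF e h, of "V i"]], goal_cases)
    case 1
    then show ?case using envD(6)[OF e] 10(1,4) by simp
  next
    case 2
    then show ?case by simp
  next
    case (3 s2 b2)
    have r2: "reg s2 10 = Q" "arr s2 4 = arr s' 4" "reg s2 22 = i" "reg s2 12 = 1"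
      using 3(2) 10(2,3) assms(4) envD[OF e] by (simp_all add: agree_off_def)
    let ?h = "hdist m y (V i)"
    have H: "?h \<le> m" by (rule hdist_le)
    have W: "arr s' 4 i = w i" using 10(1,4) by simp
    show ?case using 3(1) r2 W 10(1)
      apply simp
      apply (intro conjI; (use 3(3) in linarith)?)
      apply (rule wp_For[where N = "Q + ?h" and B = 1 and I = "\<lambda>a s'. reg s' 36 = a * w i"])
                 apply (simp_all add: add.commute)
      subgoal by (auto simp: agree_off_def)
      subgoal using 3(3) H by simp
      subgoal premises p for s3 b3
      proof -
        have "arr s3 4 = arr s' 4" "reg s3 22 = i" "reg s3 32 = (i + 1) * m"
          using p 10(4) by (simp_all add: agree_off_def)
        moreover have "b2 - (12 + 6 * Q + 6 * ?h) \<le> b3" using p by (simp add: algebra_simps)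
        then have "b3 \<ge> 1" using 3(3) H by linarith
        ultimately show ?thesis using p 10(4) by (auto simp: algebra_simps less_Suc_eq)
      qed
      done
  qed
qed (use assms envD[OF assms(1)] in simp_all)

lemma wp_SAVE:
  assumes "env s" "holds_str s 2 m y" "reg s 20 = t" "reg s 4 = T" "t < T"
  shows "wp SAVE (7 + 10 * m) (\<lambda>s' _. (\<forall>j<m. arr s' 6 (j * T + t) = of_bool (y j)) \<and>
     (\<forall>j t'. t' < T \<longrightarrow> t' \<noteq> t \<longrightarrow> arr s' 6 (j * T + t') = arr s 6 (j * T + t'))) s"
  unfolding SAVE_def
  apply simp
proof (rule wp_For[where N = m and B = 5 and
    I = "\<lambda>i s'. reg s' 45 = i * T + t \<and> (\<forall>j<i. arr s' 6 (j * T + t) = of_bool (y j)) \<and>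
     (\<forall>j t'. t' < T \<longrightarrow> t' \<noteq> t \<longrightarrow> arr s' 6 (j * T + t') = arr s 6 (j * T + t'))"], goal_cases)
  case (10 i s')
  have v: "arr s' 2 i = of_bool (y i)" "reg s' 4 = T"
    using 10(1,3) assms(2,4) by (simp_all add: agree_off_def holds_str_def)
  have "j * T + t' = i * T + t \<longleftrightarrow> j = i \<and> t' = t" if "t' < T" for j t'
    using mult_add_inj[of t' T t j i] assms(5) that by auto
  then show ?case using 10(2,4) v assms(5) by (simp add: less_Suc_eq)
qed (use assms envD[OF assms(1)] in simp_all)

abbreviation round_time :: "nat \<Rightarrow> nat" where
  "round_time Q \<equiv> (5 + m * (16 + 13 * n)) + (11 + 6 * m + k * (16 + 18 * m)) +
     (7 + n * (26 + 20 * m + 6 * Q)) + (7 + 10 * m) + 8"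

lemma wp_WEIGHTS:
  assumes "env s" "reg s 4 = T" "reg s 10 = Q"
  shows "wp WEIGHTS (11 + 6 * n + T * round_time Q) (\<lambda>s' _. \<exists>z w. mw_run Q T z w \<and>
     (\<forall>j<m. \<forall>t<T. arr s' 6 (j * T + t) = of_bool (z t j))) s"
proof -
  have loop: "wp (For 20 4 21 (Seq SCORE (Seq TOP (Seq UPDATE SAVE)))) (5 + T * round_time Q)
    (\<lambda>s' _. \<exists>z w. mw_run Q T z w \<and> (\<forall>j<m. \<forall>t<T. arr s' 6 (j * T + t) = of_bool (z t j))) s1"
    if e: "env s1" "\<And>i. i < n \<Longrightarrow> arr s1 4 i = 1" "reg s1 4 = T" "reg s1 10 = Q" for s1
  proof (rule wp_For[where N = T and B = "(5 + m * (16 + 13 * n)) + (11 + 6 * m + k * (16 + 18 * m)) +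
     (7 + n * (26 + 20 * m + 6 * Q)) + (7 + 10 * m) + 3" and
      I = "\<lambda>a s'. \<exists>z w. mw_run Q a z w \<and> (\<forall>i<n. arr s' 4 i = w a i) \<and>
        (\<forall>j<m. \<forall>t<a. arr s' 6 (j * T + t) = of_bool (z t j))"], goal_cases)
    case 9
    show ?case using e by (intro exI[of _ "\<lambda>_ _. False"] exI[of _ "\<lambda>_ _. 1"]) (simp add: mw_run_def)
  next
    case (10 t s')
    then obtain z w where zw: "mw_run Q t z w" "\<forall>i<n. arr s' 4 i = w t i"
      "\<forall>j<m. \<forall>t'<t. arr s' 6 (j * T + t') = of_bool (z t' j)" by blast
    have e1: "env s'" by (rule env_agree_off[OF 10(3) e(1)]) simp_all
    have r1: "reg s' 4 = T" "reg s' 10 = Q" "reg s' 20 = t"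
      using 10(2,3) e by (simp_all add: agree_off_def)
    show ?case unfolding wp_Seq
    proof (intro conjI, simp, rule wp_use[OF wp_SCORE[OF e1, where w = "w t"]], goal_cases)
      case 1 then show ?case using zw(2) by simp
    next
      case 2 then show ?case by simp
    next
      case (3 s2 b2)
      have e2: "env s2" by (rule env_agree_off[OF 3(2) e1]) simp_all
      have r2: "reg s2 4 = T" "reg s2 10 = Q" "reg s2 20 = t" "arr s2 4 = arr s' 4" "arr s2 6 = arr s' 6"
        using 3(2) r1 by (simp_all add: agree_off_def)
      have b2: "(11 + 6 * m + k * (16 + 18 * m)) +
         (7 + n * (26 + 20 * m + 6 * Q)) + (7 + 10 * m) + 2 \<le> b2" using 3(3) by linarith
      show ?case
      proof (intro conjI, use b2 in linarith, rule wp_use[OF wp_TOP[OF e2, where sc = "score (w t)"]], goal_cases)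
        case 1 then show ?case using 3(1) by simp
      next
        case 2 then show ?case using b2 by linarith
      next
        case (3 s3 b3)
        then obtain y where y: "holds_str s3 2 m y" "selects_top (score (w t)) y k" by blast
        have e3: "env s3" by (rule env_agree_off[OF 3(2) e2]) simp_all
        have r3: "reg s3 4 = T" "reg s3 10 = Q" "reg s3 20 = t" "arr s3 4 = arr s' 4" "arr s3 6 = arr s' 6"
          using 3(2) r2 by (simp_all add: agree_off_def)
        have b3: "(7 + n * (26 + 20 * m + 6 * Q)) + (7 + 10 * m) + 1 \<le> b3" using 3(3) b2 by linarith
        show ?case
        proof (intro conjI, use b3 in linarith, rule wp_use[OF wp_UPDATE[OF e3 y(1), where w = "w t" and Q = Q]], goal_cases)
          case 1 then show ?case using zw(2) r3 by simp
        next
          case 2 then show ?case using r3 by simp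
        next
          case 3 then show ?case using b3 by linarith
        next
          case (4 s4 b4)
          have e4: "env s4" by (rule env_agree_off[OF 4(2) e3]) simp_all
          have h4: "holds_str s4 2 m y" by (rule holds_agree_off[OF 4(2) y(1)]) simp
          have r4: "reg s4 4 = T" "reg s4 20 = t" "arr s4 6 = arr s' 6"
            using 4(2) r3 by (simp_all add: agree_off_def)
          show ?case
          proof (rule wp_use[OF wp_SAVE[OF e4 h4 r4(2,1) 10(1)]], goal_cases)
            case 1 then show ?case using b3 4(3) by linarith
          next
            case (2 s5 b5)
            \<comment> \<open>The history exists only as ghost functions: array 4 holds just the
              current weights, while \<open>z\<close> and \<open>w\<close> record every round for
              the later potential argument.\<close>
            let ?z = "z(t := y)" and ?w = "w(Suc t := \<lambda>i. w t i * (Q + hdist m y (V i)))"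
            have "mw_run Q (Suc t) ?z ?w"
              using zw(1) y(2) by (auto simp: mw_run_def less_Suc_eq)
            moreover have "\<forall>i<n. arr s5 4 i = ?w (Suc t) i"
              using 2(2) 4(1) by (simp add: agree_off_def)
            moreover have "\<forall>j<m. \<forall>t'<Suc t. arr s5 6 (j * T + t') = of_bool (?z t' j)"
              using 2(1) zw(3) r4(3) 10(1) by (auto simp: less_Suc_eq)
            ultimately show ?case by blast
          qed
        qed
      qed
    qed
  qed (use envD[OF e(1)] e in auto)
  show ?thesis unfolding WEIGHTS_def wp_Seq
  proof (intro conjI, simp, rule wp_For[where N = n and B = 1 and
      I = "\<lambda>i s'. \<forall>j<i. arr s' 4 j = 1"], goal_cases)
    case (10 i s')
    then show ?case using envD[OF env_agree_off[OF 10(3) assms(1)]] by (auto simp: less_Suc_eq)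
  next
    case (12 s' b)
    show ?case
      by (rule wp_use[OF loop])
         (use 12 env_agree_off[OF 12(2) assms(1)] assms(2,3) in \<open>auto simp: agree_off_def\<close>)
  qed (use envD[OF assms(1)] in simp_all)
qed

end

section \<open>Arithmetic of the parameters\<close>

lemma wp_accumulate:
  assumes "reg s 12 = 1" "reg s y = N" "x \<notin> {12, 20, 21, v, y}" "y \<notin> {20, 21}" "v \<notin> {20, 21}"
  shows "wp (For 20 y 21 (Add x x v)) (5 + N * 6) (\<lambda>s' _. reg s' x = reg s x + N * reg s v) s"
  by (rule wp_For[where N = N and B = 1 and I = "\<lambda>i s'. reg s' x = reg s x + i * reg s v"])
     (use assms in \<open>auto simp: agree_off_def\<close>)

lemma wp_double:
  assumes "reg s 12 = 1" "reg s y = N" "x \<notin> {12, 20, 21, y}" "y \<notin> {20, 21}"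
  shows "wp (For 20 y 21 (Add x x x)) (5 + N * 6) (\<lambda>s' _. reg s' x = reg s x * 2 ^ N) s"
  by (rule wp_For[where N = N and B = 1 and I = "\<lambda>i s'. reg s' x = reg s x * 2 ^ i"])
     (use assms in \<open>auto simp: agree_off_def\<close>)

text \<open>Doubling stops once the power reaches \<open>N\<close>, but the loop runs a fixed
  \<open>N\<close> rounds. If it never stopped, the exponent is \<open>N\<close>, and
  \<open>N < 2 ^ N\<close>. The last clause, minimality, makes the exponent unique.\<close>

lemma wp_ceil_log:
  assumes "reg s 12 = 1" "reg s y = N" "p \<notin> {12, 20, 21, 39, 41, y, l}" "l \<notin> {12, 20, 21, 39, 41, y}"
    "y \<notin> {12, 20, 21, 39, 41}" "reg s p = 1" "reg s l = 0"
  shows "wp (For 20 y 21 (Seq (Sub 41 y p) (Cond 41 (Seq (Add p p p) (Add l l 12)) SKIP)))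
    (5 + N * 11) (\<lambda>s' _. reg s' p = 2 ^ reg s' l \<and> N \<le> 2 ^ reg s' l \<and>
      (reg s' l = 0 \<or> 2 ^ (reg s' l - 1) < N)) s"
proof (rule wp_For[where N = N and B = 6 and I = "\<lambda>i s'. reg s' p = 2 ^ reg s' l \<and>
    (N \<le> reg s' p \<or> reg s' l = i) \<and> (reg s' l = 0 \<or> 2 ^ (reg s' l - 1) < N)"], goal_cases)
  case (10 i s')
  have "reg s' y = N" "reg s' 12 = 1" using 10(3) assms by (auto simp: agree_off_def)
  then show ?case using 10(4) assms by (cases "N \<le> reg s' p") auto
next
  case (12 s' b)
  then show ?case using less_exp[of N] by auto
qed (use assms in auto)

lemma wp_seq_use:
  assumes "wp c Bc (\<lambda>s' _. R s') s"
    and "\<And>s'. R s' \<Longrightarrow> agree_off (mod_regs c) (mod_arrs c) s s' \<Longrightarrow> wp d Bd (\<lambda>s' _. Q s') s'"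
    and "1 + Bc + Bd \<le> B"
  shows "wp (Seq c d) B (\<lambda>s' _. Q s') s"
  unfolding wp_Seq
proof (intro conjI)
  show "wp c (B - 1) (\<lambda>s' B'. wp d B' (\<lambda>s' _. Q s') s') s"
  proof (rule wp_use[OF assms(1)])
    fix s' b assume *: "R s'" "agree_off (mod_regs c) (mod_arrs c) s s'" "B - 1 - Bc \<le> b"
    show "wp d b (\<lambda>s' _. Q s') s'"
      by (rule wp_use[OF assms(2)[OF *(1,2)]]) (use *(3) assms(3) in auto)
  qed (use assms(3) in auto)
qed (use assms(3) in auto)

context votes
begin

lemma wp_LOGS:
  assumes "env (set_reg 12 1 s)" "reg s 3 = 0" "reg s 5 = 0"
  shows "wp LOGS (19 + n * 11 + m * 11)
    (\<lambda>s' _. n \<le> 2 ^ reg s' 3 \<and> (reg s' 3 = 0 \<or> 2 ^ (reg s' 3 - 1) < n) \<and>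
       reg s' 4 = 2 ^ reg s' 5 \<and> m \<le> 2 ^ reg s' 5 \<and> (reg s' 5 = 0 \<or> 2 ^ (reg s' 5 - 1) < m) \<and>
       reg s' 12 = 1) s"
proof -
  let ?Q = "\<lambda>s'. n \<le> 2 ^ reg s' 3 \<and> (reg s' 3 = 0 \<or> 2 ^ (reg s' 3 - 1) < n) \<and>
       reg s' 4 = 2 ^ reg s' 5 \<and> m \<le> 2 ^ reg s' 5 \<and> (reg s' 5 = 0 \<or> 2 ^ (reg s' 5 - 1) < m) \<and>
       reg s' 12 = 1"
  let ?s = "set_reg 40 1 (set_reg 12 1 s)"
  let ?l1 = "For 20 0 21 (Seq (Sub 41 0 40) (Cond 41 (Seq (Add 40 40 40) (Add 3 3 12)) SKIP))"
  let ?l2 = "For 20 1 21 (Seq (Sub 41 1 4) (Cond 41 (Seq (Add 4 4 4) (Add 5 5 12)) SKIP))"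
  have c: "reg s 0 = n" "reg s 1 = m" using envD[OF assms(1)] by simp_all
  have 1: "wp (Seq ?l1 (Seq (Const 4 1) ?l2)) (13 + n * 11 + m * 11)
    (\<lambda>s' _. ?Q s') ?s"
  proof (rule wp_seq_use[OF wp_ceil_log[where N = n]])
    fix s1 assume s1: "reg s1 40 = 2 ^ reg s1 3 \<and> n \<le> 2 ^ reg s1 3 \<and> (reg s1 3 = 0 \<or> 2 ^ (reg s1 3 - 1) < n)"
      "agree_off (mod_regs ?l1) (mod_arrs ?l1) ?s s1"
    have r1: "reg s1 5 = 0" "reg s1 1 = m" "reg s1 12 = 1"
      using s1(2) assms c by (simp_all add: agree_off_def)
    show "wp (Seq (Const 4 1) ?l2) (7 + m * 11)
      (\<lambda>s' _. ?Q s') s1"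
    proof (rule wp_seq_use[where R = "\<lambda>s'. s' = set_reg 4 1 s1" and Bc = 1 and Bd = "5 + m * 11"])
      fix s2 assume s2: "s2 = set_reg 4 1 s1"
      show "wp ?l2 (5 + m * 11) (\<lambda>s' _. ?Q s') s2"
      proof (rule wp_use[OF wp_ceil_log[where N = m]])
        fix s3 b3
        assume s3: "reg s3 4 = 2 ^ reg s3 5 \<and> m \<le> 2 ^ reg s3 5 \<and> (reg s3 5 = 0 \<or> 2 ^ (reg s3 5 - 1) < m)"
          "agree_off (mod_regs ?l2) (mod_arrs ?l2) s2 s3"
        have "reg s3 3 = reg s1 3" "reg s3 12 = 1"
          using s3(2) r1 by (simp_all add: agree_off_def s2)
        with s1(1) s3(1) show "?Q s3" by metis
      qed (use r1 in \<open>simp_all add: s2\<close>)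
    qed simp_all
  qed (use c assms in simp_all)
  show ?thesis unfolding LOGS_def
    by (rule wp_seq_use[where R = "\<lambda>s'. s' = set_reg 12 1 s" and Bc = 1 and Bd = "15 + n * 11 + m * 11"],
        simp, rule wp_seq_use[where R = "\<lambda>s'. s' = ?s" and Bc = 1 and Bd = "13 + n * 11 + m * 11"])
       (use 1 in auto)
qed

lemma wp_COUNTS:
  assumes "reg s 12 = 1" "reg s 3 = L" "reg s 14 = 0"
  shows "wp (COUNTS C \<beta> R) (26 + L * 12 + (\<beta> * L) * 6)
    (\<lambda>s' _. reg s' 6 = 1 + C * L \<and> reg s' 7 = R * 2 ^ (\<beta> * L)) s"
proof -
  let ?s = "set_reg 42 \<beta> (set_reg 41 C (set_reg 6 1 s))"
  have 1: "wp (Seq (For 20 3 21 (Add 6 6 41)) (Seq (For 20 3 21 (Add 14 14 42))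
    (Seq (Const 7 R) (For 20 14 21 (Add 7 7 7))))) (20 + L * 12 + (\<beta> * L) * 6)
      (\<lambda>s' _. reg s' 6 = 1 + C * L \<and> reg s' 7 = R * 2 ^ (\<beta> * L)) ?s"
  proof (rule wp_seq_use[OF wp_accumulate[where N = L], where Bd = "14 + L * 6 + (\<beta> * L) * 6"], goal_cases)
    case (6 s1)
    have r1: "reg s1 12 = 1" "reg s1 3 = L" "reg s1 14 = 0" "reg s1 42 = \<beta>" "reg s1 6 = 1 + C * L"
      using 6 assms by (simp_all add: agree_off_def)
    show ?case
    proof (rule wp_seq_use[OF wp_accumulate[where N = L], where Bd = "7 + (\<beta> * L) * 6"], goal_cases)
      case (6 s2)
      have r2: "reg s2 12 = 1" "reg s2 14 = \<beta> * L" "reg s2 6 = 1 + C * L"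
        using 6 r1 by (simp_all add: agree_off_def)
      show ?case
      proof (rule wp_seq_use[where R = "\<lambda>s'. s' = set_reg 7 R s2" and Bc = 1 and Bd = "5 + (\<beta> * L) * 6"], goal_cases)
        case (2 s3)
        show ?case
        proof (rule wp_use[OF wp_double[where N = "\<beta> * L"]], goal_cases)
          case (6 s4 b4)
          then show ?case using r2 2(1) by (simp add: agree_off_def)
        qed (use r2 2(1) in simp_all)
      qed simp_all
    qed (use r1 in simp_all)
  qed (use assms in simp_all)
  show ?thesis unfolding COUNTS_def
    by (rule wp_seq_use[where R = "\<lambda>s'. s' = set_reg 6 1 s" and Bc = 1 and Bd = "24 + L * 12 + (\<beta> * L) * 6"], simp,
        rule wp_seq_use[where R = "\<lambda>s'. s' = set_reg 41 C (set_reg 6 1 s)" and Bc = 1 and Bd = "22 + L * 12 + (\<beta> * L) * 6"], simp,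
        rule wp_seq_use[where R = "\<lambda>s'. s' = ?s" and Bc = 1 and Bd = "20 + L * 12 + (\<beta> * L) * 6"])
       (use 1 in auto)
qed

lemma wp_SIZES:
  assumes "reg s 12 = 1" "reg s 1 = m" "reg s 6 = D" "reg s 7 = N" "reg s 9 = 0" "reg s 10 = 0"
  shows "wp (SIZES q) (18 + N * 6 + m * 6)
    (\<lambda>s' _. reg s' 9 = N * (m + 2 * D) \<and> reg s' 10 = m * (if reg s 3 = 0 then 0 else q)) s"
proof -
  let ?s = "set_reg 8 (m + 2 * D) (set_reg 8 (m + D) s)" and ?q = "if reg s 3 = 0 then 0 else q"
  have 1: "wp (Seq (For 20 7 21 (Add 9 9 8)) (Seq (Cond 3 (Const 41 q) (Const 41 0)) (For 20 1 21 (Add 10 10 41))))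
    (14 + N * 6 + m * 6) (\<lambda>s' _. reg s' 9 = N * (m + 2 * D) \<and> reg s' 10 = m * ?q) ?s"
  proof (rule wp_seq_use[OF wp_accumulate[where N = N], where Bd = "8 + m * 6"], goal_cases)
    case (6 s1)
    have r1: "reg s1 12 = 1" "reg s1 1 = m" "reg s1 10 = 0" "reg s1 3 = reg s 3" "reg s1 9 = N * (m + 2 * D)"
      using 6 assms by (simp_all add: agree_off_def)
    show ?case
    proof (rule wp_seq_use[where R = "\<lambda>s'. s' = set_reg 41 ?q s1" and Bc = 2 and Bd = "5 + m * 6"], goal_cases)
      case (2 s2)
      show ?case
      proof (rule wp_use[OF wp_accumulate[where N = m]], goal_cases)
        case (7 s3 b3)
        then show ?case using r1 2(1) by (simp add: agree_off_def)
      qed (use r1 2(1) in simp_all)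
    qed (use r1 in simp_all)
  qed (use assms in simp_all)
  show ?thesis unfolding SIZES_def
    by (rule wp_seq_use[where R = "\<lambda>s'. s' = set_reg 8 (m + D) s" and Bc = 1 and Bd = "16 + N * 6 + m * 6"],
        use assms in simp,
        rule wp_seq_use[where R = "\<lambda>s'. s' = ?s" and Bc = 1 and Bd = "14 + N * 6 + m * 6"])
       (use 1 assms in \<open>auto simp: mult_2 add.assoc\<close>)
qed

lemma mod_LOGS [simp]: "mod_regs LOGS = {3, 4, 5, 12, 20, 21, 39, 40, 41}" "mod_arrs LOGS = {}"
  and mod_COUNTS [simp]: "mod_regs (COUNTS C \<beta> R) = {6, 7, 14, 20, 21, 41, 42}" "mod_arrs (COUNTS C \<beta> R) = {}"
  and mod_SIZES [simp]: "mod_regs (SIZES q) = {8, 9, 10, 20, 21, 41}" "mod_arrs (SIZES q) = {}"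
  by (auto simp: LOGS_def COUNTS_def SIZES_def)

text \<open>The factor \<open>q\<close> is switched off for a single vote, where \<open>L = 0\<close>: the running time
  may then not depend on \<open>\<epsilon>\<close>.\<close>

lemma wp_SETUP:
  assumes "env (set_reg 12 1 s)" "reg s 3 = 0" "reg s 5 = 0" "reg s 9 = 0" "reg s 10 = 0" "reg s 14 = 0"
    and L: "\<And>l. n \<le> 2 ^ l \<Longrightarrow> l = 0 \<or> 2 ^ (l - 1) < n \<Longrightarrow> l = L"
    and D: "D = 1 + C * L" and N: "N = R * 2 ^ (\<beta> * L)"
  shows "wp (SETUP C \<beta> q R) (65 + n * 11 + m * 17 + L * 12 + (\<beta> * L) * 6 + N * 6)
    (\<lambda>s' _. env s' \<and> reg s' 4 = 2 ^ reg s' 5 \<and> m \<le> 2 ^ reg s' 5 \<and> (reg s' 5 = 0 \<or> 2 ^ (reg s' 5 - 1) < m) \<and>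
       reg s' 6 = D \<and> reg s' 7 = N \<and> reg s' 9 = N * (m + 2 * D) \<and>
       reg s' 10 = m * (if L = 0 then 0 else q)) s"
  unfolding SETUP_def
proof (rule wp_seq_use[OF wp_LOGS[OF assms(1-3)], where Bd = "45 + m * 6 + L * 12 + (\<beta> * L) * 6 + N * 6"], goal_cases)
  case (1 s1)
  \<comment> \<open>In the initial state register 12 is still 0 and \<open>env\<close> fails, so the
    final state is compared with the initial one in which register 12 is already set.\<close>
  have "agree_off {3, 4, 5, 20, 21, 39, 40, 41} {} (set_reg 12 1 s) s1"
    using 1 by (auto simp: agree_off_def)
  then have e1: "env s1" by (rule env_agree_off[OF _ assms(1)]) simp_all
  have r1: "reg s1 3 = L" "reg s1 9 = 0" "reg s1 10 = 0" "reg s1 14 = 0"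
    using 1 L assms by (simp_all add: agree_off_def)
  show ?case
  proof (rule wp_seq_use[OF wp_COUNTS[where L = L], where Bd = "18 + N * 6 + m * 6"], goal_cases)
    case (4 s2)
    have e2: "env s2" by (rule env_agree_off[OF 4(2) e1]) simp_all
    have r2: "reg s2 3 = L" "reg s2 9 = 0" "reg s2 10 = 0" "reg s2 6 = D" "reg s2 7 = N"
      "reg s2 4 = reg s1 4" "reg s2 5 = reg s1 5"
      using 4 r1 D N by (simp_all add: agree_off_def)
    show ?case
    proof (rule wp_use[OF wp_SIZES[where D = D and N = N]], goal_cases)
      case (8 s3 b3)
      have "env s3" by (rule env_agree_off[OF 8(2) e2]) simp_all
      moreover have "reg s3 4 = reg s1 4" "reg s3 5 = reg s1 5" "reg s3 6 = D" "reg s3 7 = N"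
        using 8(2) r2 by (simp_all add: agree_off_def)
      ultimately show ?case using 8(1) 1(1) r2(1) by metis
    qed (use envD[OF e2] r2 in simp_all)
  qed (use envD[OF e1] r1 in simp_all)
qed simp

end

section \<open>Filling an array with random numbers\<close>

text \<open>The joint distribution couples the sampled value with the resulting state, and the number
  of steps does not depend on the coins.\<close>

definition samples :: "com \<Rightarrow> state \<Rightarrow> nat \<Rightarrow> 'a pmf \<Rightarrow> ('a \<Rightarrow> state \<Rightarrow> bool) \<Rightarrow> bool" where
  "samples c s t p Q \<longleftrightarrow> (\<exists>J. map_pmf fst J = p \<and>
     (\<forall>K. steps t (c # K, s) = map_pmf (\<lambda>a. (K, snd a)) J) \<and>
     (\<forall>x s'. (x, s') \<in> set_pmf J \<longrightarrow> Q x s'))"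

lemma samples_map:
  assumes "samples c s t p Q" "\<And>x s'. Q x s' \<Longrightarrow> x \<in> set_pmf p \<Longrightarrow> Q' (f x) s'"
  shows "samples c s t (map_pmf f p) Q'"
proof -
  from assms(1) obtain J where J: "map_pmf fst J = p"
    "\<And>K. steps t (c # K, s) = map_pmf (\<lambda>a. (K, snd a)) J"
    "\<And>x s'. (x, s') \<in> set_pmf J \<Longrightarrow> Q x s'" unfolding samples_def by blast
  have mem: "x \<in> set_pmf p" if "(x, s') \<in> set_pmf J" for x s'
    using that by (auto simp: J(1)[symmetric] intro: rev_image_eqI)
  show ?thesis unfolding samples_def
    by (rule exI[of _ "map_pmf (apfst f) J"])
       (auto simp: J(1)[symmetric] J(2) map_pmf_comp case_prod_beta intro!: assms(2) J(3) mem)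
qed

lemma samples_det_seq:
  assumes "big_step c s t s'" "samples d s' u p Q"
  shows "samples (Seq c d) s (1 + t + u) p Q"
proof -
  have "steps (1 + t + u) (Seq c d # K, s) = steps u (d # K, s')" for K
    using steps_big_step[OF assms(1)] by (simp add: steps_add bind_return_pmf)
  then show ?thesis using assms(2) unfolding samples_def by simp
qed

lemma samples_seq_det:
  assumes "samples c s t p Q" "\<And>x s'. Q x s' \<Longrightarrow> \<exists>s''. big_step d s' u s'' \<and> Q' x s''"
  shows "samples (Seq c d) s (1 + t + u) p Q'"
proof -
  from assms(1) obtain J where J: "map_pmf fst J = p"
    "\<And>K. steps t (c # K, s) = map_pmf (\<lambda>a. (K, snd a)) J"
    "\<And>x s'. (x, s') \<in> set_pmf J \<Longrightarrow> Q x s'" unfolding samples_def by blast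
  from assms(2) J(3) have "\<forall>xs\<in>set_pmf J. \<exists>s''. big_step d (snd xs) u s'' \<and> Q' (fst xs) s''" by auto
  then obtain f where f: "\<And>x s'. (x, s') \<in> set_pmf J \<Longrightarrow> big_step d s' u (f (x, s')) \<and> Q' x (f (x, s'))"
    by (metis fst_conv snd_conv bchoice)
  have "steps (1 + t + u) (Seq c d # K, s) = map_pmf (\<lambda>xs. (K, f xs)) J" for K
  proof -
    have "steps (1 + t + u) (Seq c d # K, s) = bind_pmf J (\<lambda>a. steps u (d # K, snd a))"
      by (simp add: steps_add bind_return_pmf J(2) bind_map_pmf)
    also have "\<dots> = bind_pmf J (\<lambda>xs. return_pmf (K, f xs))"
      by (intro bind_pmf_cong refl) (use f steps_big_step in fastforce)
    finally show ?thesis by (simp add: map_pmf_def)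
  qed
  then show ?thesis unfolding samples_def
    by (intro exI[of _ "map_pmf (\<lambda>xs. (fst xs, f xs)) J"]) (auto simp: map_pmf_comp J(1) f)
qed

lemma steps_1: "steps 1 cf = step cf"
proof -
  have "steps 0 = return_pmf" by (rule ext) simp
  then show ?thesis by (simp add: bind_return_pmf')
qed

lemma samples_Flip:
  "samples (Flip x) s 1 (bernoulli_pmf (1 / 2)) (\<lambda>b s'. s' = set_reg x (of_bool b) s)"
  unfolding samples_def
  by (rule exI[of _ "map_pmf (\<lambda>b. (b, set_reg x (of_bool b) s)) (bernoulli_pmf (1 / 2))"])
     (auto simp: map_pmf_comp of_bool_def steps_1 simp del: steps.simps One_nat_def)

text \<open>The invariant is indexed by the list of values drawn so far. One iteration has the same
  law and the same exact number of steps whatever was drawn before, so the values are independent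
  and the loop is in lockstep on all branches.\<close>

lemma samples_While:
  assumes "\<And>xs s. length xs < N \<Longrightarrow> I xs s \<Longrightarrow> reg s t \<noteq> 0 \<and> samples c s u p (\<lambda>x s'. I (xs @ [x]) s')"
    and "\<And>xs s. length xs = N \<Longrightarrow> I xs s \<Longrightarrow> reg s t = 0"
    and "I xs s" "length xs + r = N"
  shows "samples (While t c) s (1 + r * (u + 1)) (replicate_pmf r p) (\<lambda>ys s'. I (xs @ ys) s')"
  using assms(3,4)
proof (induction r arbitrary: xs s)
  case 0
  then have "reg s t = 0" using assms(2) by simp
  then show ?case unfolding samples_def
    by (intro exI[of _ "return_pmf ([], s)"]) (use 0 in \<open>auto simp: bind_return_pmf\<close>)
next
  case (Suc r)
  from assms(1)[of xs s] Suc.prems have nz: "reg s t \<noteq> 0"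
    and b: "samples c s u p (\<lambda>x s'. I (xs @ [x]) s')" by auto
  from b obtain J where J: "map_pmf fst J = p"
    "\<And>K. steps u (c # K, s) = map_pmf (\<lambda>a. (K, snd a)) J"
    "\<And>x s'. (x, s') \<in> set_pmf J \<Longrightarrow> I (xs @ [x]) s'" unfolding samples_def by blast
  have "\<forall>a\<in>set_pmf J. \<exists>J'. map_pmf fst J' = replicate_pmf r p \<and>
     (\<forall>K. steps (1 + r * (u + 1)) (While t c # K, snd a) = map_pmf (\<lambda>a. (K, snd a)) J') \<and>
     (\<forall>ys s'. (ys, s') \<in> set_pmf J' \<longrightarrow> I ((xs @ [fst a]) @ ys) s')"
  proof
    fix a assume "a \<in> set_pmf J"
    then have "I (xs @ [fst a]) (snd a)" using J(3) by (cases a) auto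
    moreover have "length (xs @ [fst a]) + r = N" using Suc.prems by simp
    ultimately show "\<exists>J'. map_pmf fst J' = replicate_pmf r p \<and>
     (\<forall>K. steps (1 + r * (u + 1)) (While t c # K, snd a) = map_pmf (\<lambda>a. (K, snd a)) J') \<and>
     (\<forall>ys s'. (ys, s') \<in> set_pmf J' \<longrightarrow> I ((xs @ [fst a]) @ ys) s')"
      using Suc.IH[of "xs @ [fst a]" "snd a"] unfolding samples_def by blast
  qed
  then obtain G where G: "\<And>a. a \<in> set_pmf J \<Longrightarrow> map_pmf fst (G a) = replicate_pmf r p"
    "\<And>a K. a \<in> set_pmf J \<Longrightarrow> steps (1 + r * (u + 1)) (While t c # K, snd a) = map_pmf (\<lambda>a. (K, snd a)) (G a)"
    "\<And>a ys s'. a \<in> set_pmf J \<Longrightarrow> (ys, s') \<in> set_pmf (G a) \<Longrightarrow> I ((xs @ [fst a]) @ ys) s'"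
    by (metis bchoice)
  \<comment> \<open>The coupling for the whole loop: after each outcome of the first iteration, the
    coupling chosen for the remaining ones is attached.\<close>
  define H where "H = bind_pmf J (\<lambda>a. map_pmf (\<lambda>(ys, s'). (fst a # ys, s')) (G a))"
  have "map_pmf fst H = bind_pmf J (\<lambda>a. map_pmf (\<lambda>ys. fst a # ys) (map_pmf fst (G a)))"
    by (simp add: H_def map_bind_pmf map_pmf_comp case_prod_beta)
  also have "\<dots> = bind_pmf J (\<lambda>a. map_pmf (\<lambda>ys. fst a # ys) (replicate_pmf r p))"
    by (intro bind_pmf_cong refl) (simp add: G(1))
  also have "\<dots> = replicate_pmf (Suc r) p"
    by (simp only: J(1)[symmetric] bind_map_pmf replicate_pmf.simps) (simp add: map_pmf_def)
  finally have 1: "map_pmf fst H = replicate_pmf (Suc r) p" .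
  have 2: "steps (1 + Suc r * (u + 1)) (While t c # K, s) = map_pmf (\<lambda>a. (K, snd a)) H" for K
  proof -
    have "steps (1 + Suc r * (u + 1)) (While t c # K, s) = steps (u + (1 + r * (u + 1))) (c # While t c # K, s)"
      using nz by (simp add: bind_return_pmf algebra_simps)
    also have "\<dots> = bind_pmf J (\<lambda>a. steps (1 + r * (u + 1)) (While t c # K, snd a))"
      by (simp only: steps_add J(2) bind_map_pmf case_prod_beta)
    also have "\<dots> = bind_pmf J (\<lambda>a. map_pmf (\<lambda>a. (K, snd a)) (G a))"
      by (intro bind_pmf_cong refl) (simp only: G(2))
    also have "\<dots> = map_pmf (\<lambda>a. (K, snd a)) H"
      by (simp add: H_def map_bind_pmf map_pmf_comp case_prod_beta)
    finally show ?thesis .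
  qed
  have 3: "I (xs @ ys) s'" if "(ys, s') \<in> set_pmf H" for ys s'
    using that G(3) by (fastforce simp: H_def)
  show ?case unfolding samples_def using 1 2 3 by blast
qed

section \<open>Uniform lists and uniform numbers from coins\<close>

lemma pair_pmf_of_set:
  assumes "finite A" "A \<noteq> {}" "finite B" "B \<noteq> {}"
  shows "pair_pmf (pmf_of_set A) (pmf_of_set B) = pmf_of_set (A \<times> B)"
proof (rule pmf_eqI)
  fix x
  show "pmf (pair_pmf (pmf_of_set A) (pmf_of_set B)) x = pmf (pmf_of_set (A \<times> B)) x"
    using assms by (cases x) (auto simp: pmf_pair card_cartesian_product indicator_def)
qed

text \<open>Through this lemma every later probability becomes a count of lists.\<close>

lemma replicate_pmf_of_set:
  assumes "finite A" "A \<noteq> {}"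
  shows "replicate_pmf n (pmf_of_set A) = pmf_of_set {xs. set xs \<subseteq> A \<and> length xs = n}"
proof (induction n)
  case 0
  have "{xs. set xs \<subseteq> A \<and> length xs = 0} = {[]}" by auto
  then show ?case by (simp add: pmf_of_set_singleton)
next
  case (Suc n)
  let ?L = "\<lambda>n. {xs. set xs \<subseteq> A \<and> length xs = n}"
  have fin: "finite (?L n)" "?L n \<noteq> {}" for n
    using finite_lists_length_eq[OF assms(1)] assms(2) Ex_list_of_length[of n]
    by (auto intro!: exI[of _ "replicate n (SOME x. x \<in> A)"] simp: some_in_eq)
  have "replicate_pmf (Suc n) (pmf_of_set A)
      = map_pmf (\<lambda>(x, xs). x # xs) (pair_pmf (pmf_of_set A) (pmf_of_set (?L n)))"
    by (simp add: Suc pair_pmf_def map_bind_pmf)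
  also have "\<dots> = map_pmf (\<lambda>(x, xs). x # xs) (pmf_of_set (A \<times> ?L n))"
    using assms fin by (subst pair_pmf_of_set) auto
  also have "\<dots> = pmf_of_set ((\<lambda>(x, xs). x # xs) ` (A \<times> ?L n))"
    using assms fin[of n] by (intro map_pmf_of_set_inj) (auto simp: inj_on_def)
  also have "(\<lambda>(x, xs). x # xs) ` (A \<times> ?L n) = ?L (Suc n)"
    by (auto simp: length_Suc_conv image_iff)
  finally show ?case .
qed

definition bits_val :: "bool list \<Rightarrow> nat" where
  "bits_val = foldl (\<lambda>v b. v + v + of_bool b) 0"

lemma foldl_bits: "foldl (\<lambda>v b. v + v + of_bool b) a bs = a * 2 ^ length bs + bits_val bs"
proof (induction bs arbitrary: a)
  case (Cons b bs)
  have "bits_val (b # bs) = of_bool b * 2 ^ length bs + bits_val bs"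
    using Cons[of "of_bool b"] by (simp add: bits_val_def)
  then show ?case by (simp only: foldl.simps Cons) (simp add: algebra_simps)
qed (simp add: bits_val_def)

lemma bits_val_Cons: "bits_val (b # bs) = of_bool b * 2 ^ length bs + bits_val bs"
  using foldl_bits[of "of_bool b" bs] by (simp add: bits_val_def)

lemma bits_val_less: "bits_val bs < 2 ^ length bs"
proof (induction bs)
  case (Cons b bs)
  then show ?case by (cases b) (simp_all add: bits_val_Cons)
qed (simp add: bits_val_def)

lemma inj_bits_val: "inj_on bits_val {bs. length bs = b}"
proof (rule inj_onI)
  fix xs ys assume "xs \<in> {bs. length bs = b}" "ys \<in> {bs. length bs = b}" "bits_val xs = bits_val ys"
  then have "length xs = length ys" "bits_val xs = bits_val ys" by auto
  then show "xs = ys"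
  proof (induction xs ys rule: list_induct2)
    case (Cons x xs y ys)
    then show ?case using bits_val_less[of xs] bits_val_less[of ys]
      by (cases x; cases y) (auto simp: bits_val_Cons)
  qed simp
qed

text \<open>\<open>bits_val\<close> is injective on lists of \<open>b\<close> bits and maps them
  into a set of the same size. Exact uniformity within a fixed number of flips is the reason for
  taking \<open>T\<close> as a power of two.\<close>

lemma map_bits_val_replicate:
  "map_pmf bits_val (replicate_pmf b (bernoulli_pmf (1 / 2))) = pmf_of_set {..<2 ^ b}"
proof -
  let ?L = "{bs :: bool list. length bs = b}"
  have fin: "finite ?L" "?L \<noteq> {}"
    using finite_lists_length_eq[of "UNIV :: bool set" b] Ex_list_of_length[of b] by auto
  have "replicate_pmf b (bernoulli_pmf (1 / 2)) = pmf_of_set ?L"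
    unfolding bernoulli_pmf_half_conv_pmf_of_set by (subst replicate_pmf_of_set) auto
  moreover have "bits_val ` ?L = {..<2 ^ b}"
  proof (rule card_subset_eq)
    show "bits_val ` ?L \<subseteq> {..<2 ^ b}" using bits_val_less by auto
    show "card (bits_val ` ?L) = card {..<(2 :: nat) ^ b}"
      using card_lists_length_eq[of "UNIV :: bool set" b] by (simp add: card_image inj_bits_val)
  qed simp
  ultimately show ?thesis using map_pmf_of_set_inj[OF inj_bits_val fin(2,1)] by simp
qed

definition RANDOM :: com where
  "RANDOM = Seq (Const 30 0) (For 22 5 23 (Seq (Flip 31) (Seq (Add 30 30 30) (Add 30 30 31))))"

definition FILL :: com where
  "FILL = For 20 9 21 (Seq RANDOM (Store 7 20 30))"

lemma samples_RANDOM: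
  assumes "reg s 12 = 1" "reg s 5 = b"
  shows "samples RANDOM s (7 + 10 * b) (pmf_of_set {..<2 ^ b})
    (\<lambda>v s'. reg s' 30 = v \<and> agree_off {22, 23, 30, 31} {} s s')"
proof -
  let ?Q = "\<lambda>v s'. reg s' 30 = v \<and> agree_off {22, 23, 30, 31} {} s s'"
  let ?c = "Seq (Flip 31) (Seq (Add 30 30 30) (Add 30 30 31))"
  let ?body = "Seq ?c (Seq (Add 22 22 12) (Sub 23 5 22))"
  let ?I = "\<lambda>bs s'. reg s' 22 = length bs \<and> reg s' 23 = b - length bs \<and> reg s' 30 = bits_val bs \<and>
    agree_off {22, 23, 30, 31} {} s s'"
  let ?s = "set_reg 23 b (set_reg 22 0 (set_reg 30 0 s))"
  have body: "samples ?body s1 9 (bernoulli_pmf (1 / 2)) (\<lambda>x s'. ?I (bs @ [x]) s')" if "?I bs s1" for bs s1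
  proof -
    have r: "reg s1 12 = 1" "reg s1 5 = b" using that assms by (auto simp: agree_off_def)
    have "samples ?c s1 (1 + 1 + (1 + 1 + 1)) (bernoulli_pmf (1 / 2))
      (\<lambda>x s'. reg s' 30 = bits_val (bs @ [x]) \<and> reg s' 22 = length bs \<and> agree_off {22, 23, 30, 31} {} s s')"
    proof (rule samples_seq_det[OF samples_Flip])
      fix x s2 assume *: "s2 = set_reg 31 (of_bool x) s1"
      show "\<exists>s''. big_step (Seq (Add 30 30 30) (Add 30 30 31)) s2 (1 + 1 + 1) s'' \<and>
        reg s'' 30 = bits_val (bs @ [x]) \<and> reg s'' 22 = length bs \<and> agree_off {22, 23, 30, 31} {} s s''"
        by (rule exI, rule conjI, rule big_step.Seq[OF big_step.Add big_step.Add], insert * that)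
           (auto simp: bits_val_def agree_off_def)
    qed
    then have "samples ?body s1 (1 + (1 + 1 + (1 + 1 + 1)) + (1 + 1 + 1)) (bernoulli_pmf (1 / 2)) (\<lambda>x s'. ?I (bs @ [x]) s')"
    proof (rule samples_seq_det)
      fix x s2 assume *: "reg s2 30 = bits_val (bs @ [x]) \<and> reg s2 22 = length bs \<and> agree_off {22, 23, 30, 31} {} s s2"
      then have **: "reg s2 12 = 1" "reg s2 5 = b" using assms by (auto simp: agree_off_def)
      show "\<exists>s''. big_step (Seq (Add 22 22 12) (Sub 23 5 22)) s2 (1 + 1 + 1) s'' \<and> ?I (bs @ [x]) s''"
        by (rule exI, rule conjI, rule big_step.Seq[OF big_step.Add big_step.Sub], insert * **)
           (auto simp: agree_off_def)
    qed
    then show ?thesis by (simp add: numeral_eq_Suc)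
  qed
  have "samples (While 23 ?body) ?s (1 + b * (9 + 1)) (replicate_pmf b (bernoulli_pmf (1 / 2)))
     (\<lambda>ys s'. ?I ([] @ ys) s')"
    by (rule samples_While[where N = b]) (use body in \<open>auto simp: bits_val_def agree_off_def\<close>)
  from samples_map[OF this, of ?Q bits_val]
  have w: "samples (While 23 ?body) ?s (1 + b * (9 + 1)) (pmf_of_set {..<2 ^ b})
     ?Q"
    by (simp add: map_bits_val_replicate)
  have s: "?s = set_reg 23 (reg (set_reg 22 0 (set_reg 30 0 s)) 5 - reg (set_reg 22 0 (set_reg 30 0 s)) 22) (set_reg 22 0 (set_reg 30 0 s))"
    using assms by simp
  have "samples RANDOM s (1 + 1 + (1 + 1 + (1 + 1 + (1 + b * (9 + 1))))) (pmf_of_set {..<2 ^ b})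
     ?Q"
    unfolding RANDOM_def For_def
    by (intro samples_det_seq[OF big_step.Const] samples_det_seq[OF big_step.Sub]) (use w s in simp)
  moreover have "1 + 1 + (1 + 1 + (1 + 1 + (1 + b * (9 + 1)))) = 7 + 10 * b" by simp
  ultimately show ?thesis by metis
qed

lemma samples_FILL:
  assumes "reg s 12 = 1" "reg s 5 = b" "reg s 9 = LEN"
  shows "samples FILL s (5 + LEN * (14 + 10 * b)) (replicate_pmf LEN (pmf_of_set {..<2 ^ b}))
    (\<lambda>xs s'. length xs = LEN \<and> (\<forall>j<LEN. arr s' 7 j = xs ! j) \<and> agree_off {20, 21, 22, 23, 30, 31} {7} s s')"
proof -
  let ?Q = "\<lambda>xs s'. length xs = LEN \<and> (\<forall>j<LEN. arr s' 7 j = xs ! j) \<and> agree_off {20, 21, 22, 23, 30, 31} {7} s s'"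
  let ?c = "Seq RANDOM (Store 7 20 30)"
  let ?body = "Seq ?c (Seq (Add 20 20 12) (Sub 21 9 20))"
  let ?I = "\<lambda>xs s'. reg s' 20 = length xs \<and> reg s' 21 = LEN - length xs \<and>
    (\<forall>j<length xs. arr s' 7 j = xs ! j) \<and> agree_off {20, 21, 22, 23, 30, 31} {7} s s'"
  let ?s = "set_reg 21 LEN (set_reg 20 0 s)"
  have body: "samples ?body s1 (13 + 10 * b) (pmf_of_set {..<2 ^ b}) (\<lambda>x s'. ?I (xs @ [x]) s')" if "?I xs s1" for xs s1
  proof -
    have r: "reg s1 12 = 1" "reg s1 5 = b" using that assms by (auto simp: agree_off_def)
    have "samples ?c s1 (1 + (7 + 10 * b) + 1) (pmf_of_set {..<2 ^ b})
      (\<lambda>x s'. reg s' 20 = length xs \<and> (\<forall>j<length (xs @ [x]). arr s' 7 j = (xs @ [x]) ! j) \<and>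
         agree_off {20, 21, 22, 23, 30, 31} {7} s s')"
    proof (rule samples_seq_det[OF samples_RANDOM[OF r]])
      fix x s2 assume *: "reg s2 30 = x \<and> agree_off {22, 23, 30, 31} {} s1 s2"
      show "\<exists>s''. big_step (Store 7 20 30) s2 1 s'' \<and>
        reg s'' 20 = length xs \<and> (\<forall>j<length (xs @ [x]). arr s'' 7 j = (xs @ [x]) ! j) \<and>
         agree_off {20, 21, 22, 23, 30, 31} {7} s s''"
        by (rule exI, rule conjI, rule big_step.Store, insert * that)
           (auto simp: agree_off_def nth_append less_Suc_eq)
    qed
    then have "samples ?body s1 (1 + (1 + (7 + 10 * b) + 1) + (1 + 1 + 1)) (pmf_of_set {..<2 ^ b}) (\<lambda>x s'. ?I (xs @ [x]) s')"
    proof (rule samples_seq_det)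
      fix x s2 assume *: "reg s2 20 = length xs \<and> (\<forall>j<length (xs @ [x]). arr s2 7 j = (xs @ [x]) ! j) \<and>
         agree_off {20, 21, 22, 23, 30, 31} {7} s s2"
      then have **: "reg s2 12 = 1" "reg s2 9 = LEN" using assms by (auto simp: agree_off_def)
      show "\<exists>s''. big_step (Seq (Add 20 20 12) (Sub 21 9 20)) s2 (1 + 1 + 1) s'' \<and> ?I (xs @ [x]) s''"
        by (rule exI, rule conjI, rule big_step.Seq[OF big_step.Add big_step.Sub], insert * **)
           (auto simp: agree_off_def)
    qed
    then show ?thesis by (simp add: numeral_eq_Suc)
  qed
  have w: "samples (While 21 ?body) ?s (1 + LEN * (13 + 10 * b + 1)) (replicate_pmf LEN (pmf_of_set {..<2 ^ b}))
     (\<lambda>ys s'. ?I ([] @ ys) s')"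
    by (rule samples_While[where N = LEN]) (use body in \<open>auto simp: agree_off_def\<close>)
  have w': "samples (While 21 ?body) ?s (1 + LEN * (13 + 10 * b + 1)) (replicate_pmf LEN (pmf_of_set {..<2 ^ b}))
     ?Q"
    using samples_map[OF w, of ?Q "\<lambda>x. x"]
    by (simp add: set_replicate_pmf)
  have s: "?s = set_reg 21 (reg (set_reg 20 0 s) 9 - reg (set_reg 20 0 s) 20) (set_reg 20 0 s)"
    using assms by simp
  have "samples FILL s (1 + 1 + (1 + 1 + (1 + LEN * (13 + 10 * b + 1)))) (replicate_pmf LEN (pmf_of_set {..<2 ^ b}))
     ?Q"
    unfolding FILL_def For_def
    by (intro samples_det_seq[OF big_step.Const] samples_det_seq[OF big_step.Sub]) (use w' s in simp)
  moreover have "1 + 1 + (1 + 1 + (1 + LEN * (13 + 10 * b + 1))) = 5 + LEN * (14 + 10 * b)" by simp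
  ultimately show ?thesis by metis
qed

section \<open>Multiplicative weights\<close>

context votes
begin

text \<open>Exchange argument: \<open>X - Z\<close> and \<open>Z - X\<close> have equal size, and
  every score in \<open>Z - X\<close> is at least the largest score in \<open>X - Z\<close>.\<close>

lemma top_maximal:
  assumes z: "selects_top sc z k" and x: "ones m x = k"
  shows "(\<Sum>j<m. of_bool (x j) * sc j) \<le> (\<Sum>j<m. of_bool (z j) * sc j)"
proof -
  define X Z where "X = {j. j < m \<and> x j}" and "Z = {j. j < m \<and> z j}"
  have fin: "finite X" "finite Z" by (auto simp: X_def Z_def)
  have sums: "(\<Sum>j<m. of_bool (y j) * f j) = (\<Sum>j | j < m \<and> y j. f j)" for y :: "nat \<Rightarrow> bool" and f :: "nat \<Rightarrow> nat"
    by (rule sum.mono_neutral_cong_right) auto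
  have card: "card X = card Z"
    using z x sums[of x "\<lambda>_. 1"] sums[of z "\<lambda>_. 1"] by (simp add: selects_top_def ones_def X_def Z_def)
  have cd: "card (X - Z) = card (Z - X)"
    using card fin by (simp add: card_Diff_subset_Int Int_commute)
  have "sum sc (X - Z) \<le> sum sc (Z - X)"
  proof (cases "X - Z = {}")
    case False
    define c where "c = Max (sc ` (X - Z))"
    have "sum sc (X - Z) \<le> (\<Sum>j\<in>X - Z. c)" unfolding c_def using fin by (intro sum_mono Max_ge) auto
    also have "\<dots> = (\<Sum>j\<in>Z - X. c)" using cd by simp
    also have "\<dots> \<le> sum sc (Z - X)"
    proof (rule sum_mono)
      fix j assume j: "j \<in> Z - X"
      have "c \<in> sc ` (X - Z)" unfolding c_def using False fin by (intro Max_in) auto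
      then obtain j' where "j' \<in> X - Z" "c = sc j'" by auto
      then show "c \<le> sc j" using z j by (auto simp: selects_top_def X_def Z_def)
    qed
    finally show ?thesis .
  next
    case True
    show ?thesis unfolding True by simp
  qed
  moreover have "sum sc X = sum sc (X - Z) + sum sc (X \<inter> Z)" "sum sc Z = sum sc (Z - X) + sum sc (X \<inter> Z)"
    using fin by (simp_all add: sum.Int_Diff[of X sc Z] sum.Int_Diff[of Z sc X] Int_commute)
  ultimately show ?thesis unfolding sums X_def Z_def by simp
qed

lemma hdist_ones: "hdist m y v + 2 * (\<Sum>j<m. of_bool (y j) * of_bool (v j)) = ones m y + ones m v"
  unfolding hdist_def ones_def sum_distrib_left sum.distrib[symmetric]
  by (intro sum.cong) auto

text \<open>For a fixed number of ones the right-hand side is a constant, so a small weighted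
  distance is the same as a large total score.\<close>

lemma weighted_hdist:
  "(\<Sum>i<n. w i * hdist m y (V i)) + 2 * (\<Sum>j<m. of_bool (y j) * score w j)
     = (\<Sum>i<n. w i * (ones m y + ones m (V i)))"
proof -
  have "(\<Sum>j<m. of_bool (y j) * score w j) = (\<Sum>i<n. w i * (\<Sum>j<m. of_bool (y j) * of_bool (V i j)))"
    unfolding score_def sum_distrib_left
    by (subst sum.swap) (intro sum.cong refl, simp add: mult_ac)
  then show ?thesis
    unfolding hdist_ones[symmetric] by (simp add: sum_distrib_left sum.distrib[symmetric] distrib_left mult_ac)
qed

lemma best_response:
  assumes "selects_top (score w) z k" "ones m x = k"
  shows "(\<Sum>i<n. w i * hdist m z (V i)) \<le> (\<Sum>i<n. w i * hdist m x (V i))"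
  using weighted_hdist[of w z] weighted_hdist[of w x] top_maximal[OF assms] assms
  by (simp add: selects_top_def)

text \<open>One round multiplies the total weight by at most \<open>Q + d\<close>: the weighted
  distance of the best response does not exceed that of \<open>x\<close>, which is within
  \<open>d\<close> of every vote.\<close>

lemma mw_potential:
  assumes run: "mw_run Q T z w" and x: "ones m x = k" "\<And>i. i < n \<Longrightarrow> hdist m x (V i) \<le> d"
  shows "t \<le> T \<Longrightarrow> (\<Sum>i<n. w t i) \<le> n * (Q + d) ^ t"
proof (induction t)
  case 0
  then show ?case using run by (simp add: mw_run_def)
next
  case (Suc t)
  then have t: "t < T" by simp
  have "(\<Sum>i<n. w (Suc t) i) = Q * (\<Sum>i<n. w t i) + (\<Sum>i<n. w t i * hdist m (z t) (V i))"
    using run t by (simp add: mw_run_def sum_distrib_left sum.distrib[symmetric] algebra_simps)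
  also have "(\<Sum>i<n. w t i * hdist m (z t) (V i)) \<le> (\<Sum>i<n. w t i * hdist m x (V i))"
    using run t x(1) by (intro best_response) (auto simp: mw_run_def)
  also have "\<dots> \<le> (\<Sum>i<n. w t i * d)" using x(2) by (intro sum_mono mult_le_mono2) auto
  finally have "(\<Sum>i<n. w (Suc t) i) \<le> (Q + d) * (\<Sum>i<n. w t i)"
    by (simp add: sum_distrib_left sum.distrib algebra_simps)
  also have "\<dots> \<le> (Q + d) * (n * (Q + d) ^ t)" using Suc by (intro mult_le_mono2) auto
  finally show ?case by (simp add: mult_ac)
qed

lemma mw_weight:
  assumes "mw_run Q T z w" "i < n"
  shows "t \<le> T \<Longrightarrow> w t i = (\<Prod>t'<t. Q + hdist m (z t') (V i))"
  using assms by (induction t) (auto simp: mw_run_def)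

text \<open>A single weight is a product of factors \<open>Q + h\<close> and is at most the total
  weight. Dividing by \<open>Q ^ T\<close> and taking logarithms compares the sum of the distances
  with \<open>T * d\<close>. The choice \<open>Q = m * q\<close> keeps \<open>h / Q\<close> at most
  \<open>1 / q\<close>, which limits the second-order loss.\<close>

lemma mw_average:
  assumes run: "mw_run (m * q) T z w" and x: "ones m x = k" "\<And>i. i < n \<Longrightarrow> hdist m x (V i) \<le> d"
    and q: "q \<ge> 2" and m: "m > 0" "m \<le> T" and i: "i < n"
    and d: "real q ^ 2 * ln (real n) \<le> real d"
  shows "(real q - 1) * (\<Sum>t<T. real (hdist m (z t) (V i))) \<le> (real q + 1) * (real T * real d)"
proof -
  define Q where "Q = real m * real q"
  have Q: "Q > 0" using q m by (simp add: Q_def)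
  let ?h = "\<lambda>t. real (hdist m (z t) (V i))"
  have "(\<Prod>t<T. m * q + hdist m (z t) (V i)) = w T i" using mw_weight[OF run i, of T] by simp
  also have "\<dots> \<le> (\<Sum>i<n. w T i)" using i by (intro member_le_sum) auto
  also have "\<dots> \<le> n * (m * q + d) ^ T" by (rule mw_potential[OF run x]) simp_all
  finally have "real (\<Prod>t<T. m * q + hdist m (z t) (V i)) \<le> real (n * (m * q + d) ^ T)"
    by (rule of_nat_mono)
  then have "(\<Prod>t<T. Q + ?h t) \<le> real n * (Q + d) ^ T" by (simp add: Q_def)
  then have "(\<Prod>t<T. Q + ?h t) / Q ^ T \<le> real n * (Q + d) ^ T / Q ^ T"
    using Q by (intro divide_right_mono) auto
  moreover have "(\<Prod>t<T. Q + ?h t) / Q ^ T = (\<Prod>t<T. 1 + ?h t / Q)"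
  proof -
    have "(\<Prod>t<T. Q + ?h t) / Q ^ T = (\<Prod>t<T. Q + ?h t) / (\<Prod>t<T. Q)" by simp
    also have "\<dots> = (\<Prod>t<T. (Q + ?h t) / Q)" by (rule prod_dividef[symmetric])
    finally show ?thesis using Q by (simp add: add_divide_distrib)
  qed
  moreover have "real n * (Q + d) ^ T / Q ^ T = real n * (1 + d / Q) ^ T"
  proof -
    have "1 + d / Q = (Q + d) / Q" using Q by (simp add: field_simps)
    then show ?thesis by (simp add: power_divide)
  qed
  ultimately have le: "(\<Prod>t<T. 1 + ?h t / Q) \<le> real n * (1 + d / Q) ^ T" by simp
  have pos: "(\<Prod>t<T. 1 + ?h t / Q) > 0" using Q by (intro prod_pos) (auto intro: add_pos_nonneg)
  have "(\<Sum>t<T. (1 - 1 / q) * (?h t / Q)) \<le> (\<Sum>t<T. ln (1 + ?h t / Q))"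
  proof (rule sum_mono)
    fix t
    have h: "0 \<le> ?h t / Q" "?h t / Q \<le> 1 / q"
      using hdist_le[of "z t" "V i"] m q by (auto simp: Q_def field_simps)
    have "?h t / Q \<le> 1" using h(2) q by (smt (verit) divide_le_eq_1 of_nat_1 of_nat_le_iff one_le_numeral order_trans)
    \<comment> \<open>From \<open>ln (1 + y) \<ge> y - y^2\<close> with
      \<open>y \<le> 1 / q\<close>, so that only a fraction \<open>1 / q\<close> of \<open>y\<close>
      is lost.\<close>
    then have "?h t / Q - (?h t / Q)\<^sup>2 \<le> ln (1 + ?h t / Q)"
      using h by (intro ln_one_plus_pos_lower_bound) auto
    moreover have "(?h t / Q)\<^sup>2 \<le> (1 / q) * (?h t / Q)"
      unfolding power2_eq_square using h by (intro mult_right_mono) auto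
    ultimately show "(1 - 1 / q) * (?h t / Q) \<le> ln (1 + ?h t / Q)"
      unfolding left_diff_distrib by linarith
  qed
  also have "\<dots> = ln (\<Prod>t<T. 1 + ?h t / Q)"
    using Q by (intro ln_prod[symmetric]) (simp, smt (verit) divide_nonneg_pos of_nat_0_le_iff)
  also have "\<dots> \<le> ln (real n * (1 + d / Q) ^ T)" using le pos by simp
  also have "\<dots> = ln (real n) + T * ln (1 + d / Q)"
  proof -
    have "1 + d / Q > 0" using Q by (intro add_pos_nonneg) auto
    then show ?thesis using n_pos by (simp add: ln_mult ln_realpow)
  qed
  also have "\<dots> \<le> ln (real n) + T * (d / Q)"
    using Q by (intro add_left_mono mult_left_mono ln_add_one_self_le_self) auto
  finally have "(1 - 1 / q) * (\<Sum>t<T. ?h t) / Q \<le> ln (real n) + T * (d / Q)"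
    by (simp add: sum_distrib_left sum_divide_distrib)
  then have "(1 - 1 / q) * (\<Sum>t<T. ?h t) \<le> (ln (real n) + T * (d / Q)) * Q"
    using Q by (simp only: pos_divide_le_eq)
  also have "\<dots> = Q * ln (real n) + T * d" using Q by (simp add: field_simps)
  finally have "(1 - 1 / q) * (\<Sum>t<T. ?h t) \<le> Q * ln (real n) + T * d" .
  \<comment> \<open>The additive error \<open>m * q * ln n\<close> is at most another fraction
    \<open>1 / q\<close> of \<open>T * d\<close>, by \<open>m \<le> T\<close> and
    \<open>q^2 * ln n \<le> d\<close>. This is where the optimum has to be large.\<close>
  moreover have "Q * ln (real n) \<le> T * (d / q)"
  proof -
    have "q * ln (real n) \<le> d / q" using d q by (simp add: field_simps power2_eq_square)
    moreover have "0 \<le> q * ln (real n)" using n_pos by simp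
    ultimately have "real m * (q * ln (real n)) \<le> real T * (d / q)"
      using m by (intro mult_mono) auto
    then show ?thesis by (simp add: Q_def mult_ac)
  qed
  ultimately have "(1 - 1 / q) * (\<Sum>t<T. ?h t) \<le> T * (d / q) + T * d" by linarith
  then have "q * ((1 - 1 / q) * (\<Sum>t<T. ?h t)) \<le> q * (T * (d / q) + T * d)"
    by (rule mult_left_mono) simp
  moreover have "q * ((1 - 1 / q) * S) = (real q - 1) * S" "q * (T * (d / q) + T * d) = (real q + 1) * (real T * d)" for S
    using q by (simp_all add: field_simps)
  ultimately show ?thesis by simp
qed

end

section \<open>Concentration of independent rounding\<close>

definition lists_of :: "'a set \<Rightarrow> nat \<Rightarrow> 'a list set" where
  "lists_of A n = {xs. set xs \<subseteq> A \<and> length xs = n}"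

lemma finite_lists_of: "finite A \<Longrightarrow> finite (lists_of A n)"
  and card_lists_of: "finite A \<Longrightarrow> card (lists_of A n) = card A ^ n"
  unfolding lists_of_def by (simp_all add: finite_lists_length_eq card_lists_length_eq)

lemma lists_of_0 [simp]: "lists_of A 0 = {[]}"
  by (auto simp: lists_of_def)

lemma lists_of_Suc: "lists_of A (Suc n) = (\<lambda>(x, xs). x # xs) ` (A \<times> lists_of A n)"
  by (auto simp: lists_of_def length_Suc_conv image_iff)

lemma sum_lists_of_Suc: "sum f (lists_of A (Suc n)) = (\<Sum>x\<in>A. \<Sum>xs\<in>lists_of A n. f (x # xs))"
  unfolding lists_of_Suc by (subst sum.reindex) (auto simp: inj_on_def sum.cartesian_product case_prod_beta)

text \<open>Independence in counting form: the moment of a product over the positions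
  factorises.\<close>

lemma sum_prod_lists_of:
  fixes g :: "nat \<Rightarrow> 'a \<Rightarrow> real"
  shows "(\<Sum>xs\<in>lists_of A n. \<Prod>j<n. g j (xs ! j)) = (\<Prod>j<n. \<Sum>x\<in>A. g j x)"
proof (induction n arbitrary: g)
  case (Suc n)
  show ?case
    by (simp add: sum_lists_of_Suc prod.lessThan_Suc_shift sum_distrib_left[symmetric]
        sum_distrib_right[symmetric] Suc.IH[of "\<lambda>j. g (Suc j)"] del: prod.lessThan_Suc)
qed simp

text \<open>Both signs are needed, since the summands of the Chernoff bound may be negative. For
  \<open>y = - x\<close> it follows from \<open>1 \<le> (1 + x) * (1 - x + x^2)\<close> and
  \<open>1 + x \<le> exp x\<close>.\<close>

lemma exp_le_quadratic:
  fixes y :: real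
  assumes "\<bar>y\<bar> \<le> 1"
  shows "exp y \<le> 1 + y + y\<^sup>2"
proof (cases "y \<ge> 0")
  case True
  then show ?thesis using assms exp_bound by simp
next
  case False
  define x where "x = - y"
  have x: "0 \<le> x" "x \<le> 1" using False assms by (auto simp: x_def)
  have "1 \<le> 1 + x ^ 3" using x by simp
  also have "\<dots> = (1 + x) * (1 - x + x\<^sup>2)" by (simp add: algebra_simps power2_eq_square power3_eq_cube)
  also have "\<dots> \<le> exp x * (1 - x + x\<^sup>2)"
  proof (rule mult_right_mono)
    have "0 \<le> (1 - x) + x\<^sup>2" using x by (intro add_nonneg_nonneg) auto
    then show "0 \<le> 1 - x + x\<^sup>2" by simp
  qed (rule exp_ge_add_one_self)
  finally have "exp (- x) * 1 \<le> exp (- x) * (exp x * (1 - x + x\<^sup>2))"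
    by (intro mult_left_mono) auto
  also have "exp (- x) * (exp x * (1 - x + x\<^sup>2)) = 1 - x + x\<^sup>2"
    by (simp add: mult.assoc[symmetric] exp_add[symmetric])
  finally show ?thesis by (simp add: x_def)
qed

text \<open>Exponential moments, with counts in place of probabilities. The second-order term is
  governed by the expected number of nonzero summands, at most \<open>2 * d\<close>, and not by the
  number of positions; this is what permits a deviation relative to \<open>d\<close>.\<close>

lemma chernoff_lists_of:
  fixes \<xi> :: "nat \<Rightarrow> 'a \<Rightarrow> real" and d c :: real
  assumes A: "finite A" "A \<noteq> {}" and \<xi>: "\<And>j x. \<xi> j x \<in> {-1, 0, 1}"
    and supp: "(\<Sum>j<n. \<Sum>x\<in>A. \<bar>\<xi> j x\<bar>) \<le> 2 * d * card A"
    and c: "0 < c" "c \<le> 1" and d: "d \<ge> 0"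
  shows "real (card {xs \<in> lists_of A n. (\<Sum>j<n. \<xi> j (xs ! j)) \<ge> (\<Sum>j<n. \<Sum>x\<in>A. \<xi> j x) / card A + c * d})
     \<le> real (card A) ^ n * exp (- (c\<^sup>2 * d / 8))"
proof -
  \<comment> \<open>Minimises the final exponent \<open>2 * l^2 * d - l * c * d\<close>; moreover
    \<open>l \<le> 1\<close> keeps the arguments of \<open>exp\<close> in the range of the quadratic
    bound.\<close>
  define l where "l = c / 4"
  define M where "M = (\<Sum>j<n. \<Sum>x\<in>A. \<xi> j x) / card A"
  let ?B = "{xs \<in> lists_of A n. (\<Sum>j<n. \<xi> j (xs ! j)) \<ge> M + c * d}"
  have cA: "real (card A) > 0" using A by (simp add: card_gt_0_iff)
  have "real (card ?B) * exp (l * (M + c * d)) = (\<Sum>xs\<in>?B. exp (l * (M + c * d)))" by simp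
  also have "\<dots> \<le> (\<Sum>xs\<in>?B. exp (l * (\<Sum>j<n. \<xi> j (xs ! j))))"
    using c by (intro sum_mono) (auto simp: l_def intro!: mult_left_mono)
  also have "\<dots> \<le> (\<Sum>xs\<in>lists_of A n. exp (l * (\<Sum>j<n. \<xi> j (xs ! j))))"
    by (intro sum_mono2 finite_lists_of A) auto
  also have "\<dots> = (\<Sum>xs\<in>lists_of A n. \<Prod>j<n. exp (l * \<xi> j (xs ! j)))"
    by (simp add: sum_distrib_left exp_sum)
  also have "\<dots> = (\<Prod>j<n. \<Sum>x\<in>A. exp (l * \<xi> j x))" by (rule sum_prod_lists_of)
  also have "\<dots> \<le> (\<Prod>j<n. card A * exp ((\<Sum>x\<in>A. l * \<xi> j x + l\<^sup>2 * \<bar>\<xi> j x\<bar>) / card A))"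
  proof (rule prod_mono, intro conjI sum_nonneg)
    fix j
    have "(\<Sum>x\<in>A. exp (l * \<xi> j x)) \<le> (\<Sum>x\<in>A. 1 + (l * \<xi> j x + l\<^sup>2 * \<bar>\<xi> j x\<bar>))"
    proof (rule sum_mono)
      fix x
      have "\<bar>l * \<xi> j x\<bar> \<le> 1" "(l * \<xi> j x)\<^sup>2 = l\<^sup>2 * \<bar>\<xi> j x\<bar>" using \<xi>[of j x] c by (auto simp: l_def)
      then show "exp (l * \<xi> j x) \<le> 1 + (l * \<xi> j x + l\<^sup>2 * \<bar>\<xi> j x\<bar>)"
        using exp_le_quadratic[of "l * \<xi> j x"] by simp
    qed
    also have "\<dots> = card A * (1 + (\<Sum>x\<in>A. l * \<xi> j x + l\<^sup>2 * \<bar>\<xi> j x\<bar>) / card A)"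
    proof -
      have "card A * (1 + S / card A) = card A + S" for S :: real using cA by (simp add: field_simps)
      then show ?thesis by (simp add: sum.distrib)
    qed
    also have "\<dots> \<le> card A * exp ((\<Sum>x\<in>A. l * \<xi> j x + l\<^sup>2 * \<bar>\<xi> j x\<bar>) / card A)"
      by (intro mult_left_mono exp_ge_add_one_self) auto
    finally show "(\<Sum>x\<in>A. exp (l * \<xi> j x)) \<le> card A * exp ((\<Sum>x\<in>A. l * \<xi> j x + l\<^sup>2 * \<bar>\<xi> j x\<bar>) / card A)" .
  qed auto
  also have "\<dots> = real (card A) ^ n * exp (\<Sum>j<n. (\<Sum>x\<in>A. l * \<xi> j x + l\<^sup>2 * \<bar>\<xi> j x\<bar>) / card A)"
    by (simp add: prod.distrib exp_sum)
  also have "(\<Sum>j<n. (\<Sum>x\<in>A. l * \<xi> j x + l\<^sup>2 * \<bar>\<xi> j x\<bar>) / card A) = l * M + l\<^sup>2 * ((\<Sum>j<n. \<Sum>x\<in>A. \<bar>\<xi> j x\<bar>) / card A)"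
    by (simp add: M_def sum.distrib sum_distrib_left sum_divide_distrib add_divide_distrib)
  also have "real (card A) ^ n * exp (l * M + l\<^sup>2 * ((\<Sum>j<n. \<Sum>x\<in>A. \<bar>\<xi> j x\<bar>) / card A))
     \<le> real (card A) ^ n * exp (l * M + l\<^sup>2 * (2 * d))"
  proof -
    have "(\<Sum>j<n. \<Sum>x\<in>A. \<bar>\<xi> j x\<bar>) / card A \<le> 2 * d" using supp cA by (simp add: divide_le_eq)
    from mult_left_mono[OF this, of "l\<^sup>2"] show ?thesis by (intro mult_left_mono) auto
  qed
  finally have "real (card ?B) * exp (l * (M + c * d)) \<le> real (card A) ^ n * exp (l * M + l\<^sup>2 * (2 * d))" .
  then have "real (card ?B) \<le> real (card A) ^ n * exp (l * M + l\<^sup>2 * (2 * d)) / exp (l * (M + c * d))"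
    by (simp add: field_simps)
  also have "\<dots> = real (card A) ^ n * exp (l * M + l\<^sup>2 * (2 * d) - l * (M + c * d))"
    by (simp add: exp_diff)
  also have "l * M + l\<^sup>2 * (2 * d) - l * (M + c * d) = - (c\<^sup>2 * d / 8)"
    by (simp add: l_def power2_eq_square algebra_simps)
  finally show ?thesis by (simp add: M_def)
qed

section \<open>Success probability of a trial\<close>

lemma lists_of_add: "lists_of A (a + b) = (\<lambda>(xs, ys). xs @ ys) ` (lists_of A a \<times> lists_of A b)"
proof (intro equalityI subsetI)
  fix xs assume "xs \<in> lists_of A (a + b)"
  then have "take a xs \<in> lists_of A a" "drop a xs \<in> lists_of A b"
    using set_take_subset[of a xs] set_drop_subset[of a xs] by (auto simp: lists_of_def)
  then show "xs \<in> (\<lambda>(xs, ys). xs @ ys) ` (lists_of A a \<times> lists_of A b)"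
    by (intro image_eqI[of _ _ "(take a xs, drop a xs)"]) auto
qed (auto simp: lists_of_def)

text \<open>Product rule for events that depend on disjoint blocks of random numbers.\<close>

lemma card_lists_of_take_drop:
  "card {xs \<in> lists_of A (a + b). P (take a xs) \<and> Q (drop a xs)}
     = card {xs \<in> lists_of A a. P xs} * card {xs \<in> lists_of A b. Q xs}"
proof -
  have "{xs \<in> lists_of A (a + b). P (take a xs) \<and> Q (drop a xs)}
      = (\<lambda>(xs, ys). xs @ ys) ` ({xs \<in> lists_of A a. P xs} \<times> {xs \<in> lists_of A b. Q xs})"
    unfolding lists_of_add by (auto simp: lists_of_def image_iff)
  moreover have "inj_on (\<lambda>(xs, ys). xs @ ys) ({xs \<in> lists_of A a. P xs} \<times> {xs \<in> lists_of A b. Q xs})"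
    by (auto simp: inj_on_def lists_of_def)
  ultimately show ?thesis by (simp add: card_image card_cartesian_product)
qed

lemma card_filter_eq_sum: "finite S \<Longrightarrow> card {x \<in> S. P x} = (\<Sum>x\<in>S. of_bool (P x))"
  by (simp add: Int_def)

lemma hdist_triangle: "hdist m x z \<le> hdist m x y + hdist m y z"
  unfolding hdist_def sum.distrib[symmetric] by (intro sum_mono) auto

lemma hdist_commute: "hdist m x y = hdist m y x"
  unfolding hdist_def by (intro sum.cong) auto

text \<open>Reducing a uniform number modulo \<open>g = length A\<close> is not uniform, but every
  residue is hit at least \<open>T div g\<close> times. Since \<open>g \<le> T\<close>, that is at
  least \<open>T / (2 * g)\<close>, so at most a factor 2 is lost.\<close>

lemma mod_rank_count:
  fixes A :: "nat list"
  assumes "distinct A" "A \<noteq> []" "length A \<le> T"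
  shows "T * card {j \<in> set A. P j} \<le> 2 * length A * card {v. v < T \<and> P (A ! (v mod length A))}"
proof -
  let ?g = "length A"
  have g: "?g > 0" using assms by simp
  let ?R = "{r. r < ?g \<and> P (A ! r)}"
  have "{j \<in> set A. P j} = (!) A ` ?R" by (auto simp: in_set_conv_nth)
  then have cR: "card {j \<in> set A. P j} = card ?R"
    using assms(1) by (simp add: card_image inj_on_def nth_eq_iff_index_eq)
  have "(\<lambda>(r, b). b * ?g + r) ` (?R \<times> {..<T div ?g}) \<subseteq> {v. v < T \<and> P (A ! (v mod ?g))}"
  proof clarsimp
    fix r b assume rb: "r < ?g" "P (A ! r)" "b < T div ?g"
    have "b * ?g + r < Suc b * ?g" using rb(1) by simp
    also have "\<dots> \<le> (T div ?g) * ?g" using rb(3) by (intro mult_le_mono1) simp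
    also have "\<dots> \<le> T" by simp
    finally show "b * ?g + r < T" .
  qed
  moreover have "inj_on (\<lambda>(r, b). b * ?g + r) (?R \<times> {..<T div ?g})"
    using mult_add_inj[of _ ?g] by (auto simp: inj_on_def)
  ultimately have "card (?R \<times> {..<T div ?g}) \<le> card {v. v < T \<and> P (A ! (v mod ?g))}"
    by (intro card_inj_on_le) auto
  then have 1: "card ?R * (T div ?g) \<le> card {v. v < T \<and> P (A ! (v mod ?g))}"
    by (simp add: card_cartesian_product)
  have "T div ?g \<ge> 1" using assms(3) g by (simp add: Suc_le_eq div_greater_zero_iff)
  then have "?g \<le> ?g * (T div ?g)" by simp
  moreover have "T < ?g * (T div ?g) + ?g" using dividend_less_times_div[OF g, of T] by simp
  ultimately have "T \<le> 2 * (?g * (T div ?g))" by linarith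
  then have "T * card ?R \<le> 2 * (?g * (T div ?g)) * card ?R" by (rule mult_le_mono1)
  also have "\<dots> = 2 * ?g * (card ?R * (T div ?g))" by simp
  also have "\<dots> \<le> 2 * ?g * card {v. v < T \<and> P (A ! (v mod ?g))}" using 1 by (rule mult_le_mono2)
  finally show ?thesis by (simp add: cR)
qed

section \<open>Success of the random walk\<close>

context votes
begin

text \<open>Compare \<open>y\<close> with a vote that is too far away: since \<open>x\<close> is close to that vote, many
  positions where \<open>y\<close> and the vote differ should be changed, and as \<open>x\<close> and \<open>y\<close> have equally
  many ones, many in either direction.\<close>

lemma many_good_positions:
  assumes x: "ones m x = k" "\<And>i. i < n \<Longrightarrow> hdist m x (V i) \<le> d"
    and y: "ones m y = k" and i: "i < n" and far: "(E + 1) * d < E * hdist m y (V i)" and E: "E \<ge> 1"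
  shows "length (gains y i m) \<le> 4 * E * card {j \<in> set (gains y i m). x j}"
    and "length (losses y i m) \<le> 4 * E * card {j \<in> set (losses y i m). \<not> x j}"
    and "gains y i m \<noteq> []" and "losses y i m \<noteq> []"
proof -
  let ?P = "hdist m y (V i)"
  define a b a' b' g l :: nat where "a = (\<Sum>j<m. of_bool (\<not> y j \<and> V i j \<and> x j))"
    and "b = (\<Sum>j<m. of_bool (y j \<and> \<not> V i j \<and> \<not> x j))"
    and "a' = (\<Sum>j<m. of_bool (\<not> y j \<and> \<not> V i j \<and> x j))"
    and "b' = (\<Sum>j<m. of_bool (y j \<and> V i j \<and> \<not> x j))"
    and "g = (\<Sum>j<m. of_bool (\<not> y j \<and> V i j))"
    and "l = (\<Sum>j<m. of_bool (y j \<and> \<not> V i j))"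
  have 1: "hdist m x (V i) + a + b = ?P + a' + b'"
    unfolding hdist_def a_def b_def a'_def b'_def sum.distrib[symmetric] by (intro sum.cong) auto
  have 2: "ones m x + (b + b') = ones m y + (a + a')"
    unfolding ones_def a_def b_def a'_def b'_def sum.distrib[symmetric] by (intro sum.cong) auto
  have 3: "?P = g + l"
    unfolding hdist_def g_def l_def sum.distrib[symmetric] by (intro sum.cong) auto
  \<comment> \<open>With equal numbers of ones, the second identity says
    \<open>a - b' = b - a'\<close>. In the first, the excess of \<open>?P\<close> over the distance
    of \<open>x\<close> is the sum of these two differences, hence twice either of them.\<close>
  have ab: "?P \<le> d + 2 * a" "?P \<le> d + 2 * b" using 1 2 x y i by force+
  \<comment> \<open>Being too far means that \<open>d\<close> is less than the fraction
    \<open>E / (E + 1)\<close> of \<open>?P\<close>; the rest of \<open>?P\<close> must come from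
    \<open>2 * c\<close>.\<close>
  have key: "?P < 4 * E * c" if "?P \<le> d + 2 * c" for c
  proof -
    have "(E + 1) * ?P \<le> (E + 1) * (d + 2 * c)" using that by (rule mult_le_mono2)
    also have "\<dots> = (E + 1) * d + (E + 1) * (2 * c)" by (simp add: distrib_left)
    also have "\<dots> < E * ?P + (E + 1) * (2 * c)" using far by simp
    finally have "?P < (E + 1) * (2 * c)" by simp
    also have "\<dots> \<le> (2 * E) * (2 * c)" using E by (intro mult_le_mono1) simp
    finally show ?thesis by simp
  qed
  have card: "card {j. j < m \<and> Q j} = (\<Sum>j<m. of_bool (Q j))" for Q :: "nat \<Rightarrow> bool"
    using card_filter_eq_sum[of "{..<m}" Q] by simp
  have "distinct (gains y i m)" "distinct (losses y i m)" by (simp_all add: gains_def losses_def)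
  then have len: "length (gains y i m) = g" "length (losses y i m) = l"
    unfolding g_def l_def card[symmetric] set_gains[symmetric] set_losses[symmetric]
    by (simp_all add: distinct_card)
  have good: "card {j \<in> set (gains y i m). x j} = a" "card {j \<in> set (losses y i m). \<not> x j} = b"
    unfolding a_def b_def card[symmetric] set_gains set_losses by (auto intro!: arg_cong[of _ _ card])
  show "length (gains y i m) \<le> 4 * E * card {j \<in> set (gains y i m). x j}"
    "length (losses y i m) \<le> 4 * E * card {j \<in> set (losses y i m). \<not> x j}"
    using key[OF ab(1)] key[OF ab(2)] 3 by (simp_all add: len good)
  have "a > 0" "b > 0" using key[OF ab(1)] key[OF ab(2)] by (auto intro: gr0I)
  then have "{j \<in> set (gains y i m). x j} \<noteq> {}" "{j \<in> set (losses y i m). \<not> x j} \<noteq> {}"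
    using good by (metis card.empty less_irrefl)+
  then show "gains y i m \<noteq> []" "losses y i m \<noteq> []" by auto
qed

lemma swap_step_closer:
  assumes "gains y i m \<noteq> []" "losses y i m \<noteq> []"
    and "x (gains y i m ! (v mod length (gains y i m)))"
    and "\<not> x (losses y i m ! (w mod length (losses y i m)))"
  shows "hdist m (swap_step y i v w) x + 2 = hdist m y x"
proof -
  define a b where "a = gains y i m ! (v mod length (gains y i m))"
    and "b = losses y i m ! (w mod length (losses y i m))"
  have ab: "a < m" "\<not> y a" "b < m" "y b"
    using nth_gains[of y i v] nth_losses[of y i w] assms by (auto simp: a_def b_def)
  then have "a \<noteq> b" by auto
  have "swap_step y i v w = y(a := True, b := False)"
    using assms by (auto simp: swap_step_def Let_def a_def b_def)
  then show ?thesis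
    using hdist_upd[OF ab(3), of "y(a := True)" False x] hdist_upd[OF ab(1), of y True x] ab \<open>a \<noteq> b\<close>
      assms(3,4)[folded a_def b_def] by simp
qed

text \<open>Unlike \<open>walk\<close>, this recursion peels off the first swap and varies the
  start, which is the form required by an induction on the remaining distance.\<close>

primrec walk_from :: "(nat \<Rightarrow> bool) \<Rightarrow> (nat \<Rightarrow> nat) \<Rightarrow> nat \<Rightarrow> nat \<Rightarrow> (nat \<Rightarrow> bool)" where
  "walk_from y c p 0 = y"
| "walk_from y c p (Suc h) =
     walk_from (swap_step y (far y n) (c p) (c (Suc p))) c (p + 2) h"

lemma walk_from_cong:
  "(\<And>j. j < 2 * h \<Longrightarrow> c (p + j) = c' (p' + j)) \<Longrightarrow> walk_from y c p h = walk_from y c' p' h"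
proof (induction h arbitrary: y p p')
  case (Suc h)
  have "c p = c' p'" "c (Suc p) = c' (Suc p')" using Suc.prems[of 0] Suc.prems[of 1] by auto
  moreover have "c (p + 2 + j) = c' (p' + 2 + j)" if "j < 2 * h" for j
    using Suc.prems[of "2 + j"] that by (simp add: add.assoc)
  ultimately show ?case using Suc.IH[of "p + 2" "p' + 2"] by simp
qed simp

lemma walk_from_Suc':
  "walk_from y c p (Suc h) = swap_step (walk_from y c p h) (far (walk_from y c p h) n)
     (c (p + 2 * h)) (c (Suc (p + 2 * h)))"
  by (induction h arbitrary: y p) simp_all

text \<open>Induction on the number of swaps that still separate \<open>y\<close> from
  \<open>x\<close>. Unless \<open>y\<close> is already good, each of the next two numbers is lucky
  for a fraction at least \<open>1 / (8 * E)\<close> of its values: \<open>4 * E\<close> comes from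
  the far vote, 2 from the reduction modulo the length. At distance 0 the cost is at most
  \<open>d\<close>. Allowing any \<open>g \<le> h\<close> lets the walk stray once a good string has
  been visited.\<close>

lemma walk_success_count:
  assumes x: "ones m x = k" "\<And>i. i < n \<Longrightarrow> hdist m x (V i) \<le> d" and E: "E \<ge> 1" and T: "m \<le> T"
    and y: "ones m y = k" "hdist m y x \<le> 2 * h"
  shows "T ^ (2 * h) \<le> (8 * E) ^ (2 * h) *
    card {vs \<in> lists_of {..<T} (2 * h). \<exists>g\<le>h. E * cost (walk_from y (nth vs) 0 g) \<le> (E + 1) * d}"
  using y
proof (induction h arbitrary: y)
  case 0
  then have "hdist m y x = 0" by simp
  then have "hdist m y (V i) \<le> d" if "i < n" for i
    using hdist_triangle[of m y "V i" x] x(2)[OF that] by simp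
  then have "cost y \<le> d" unfolding cost_def using far_less n_pos by simp
  then have "E * cost y \<le> (E + 1) * d" by (intro mult_le_mono) simp_all
  then have "{vs \<in> lists_of {..<T} (2 * 0). \<exists>g\<le>0. E * cost (walk_from y (nth vs) 0 g) \<le> (E + 1) * d} = {[]}"
    by auto
  then show ?case by simp
next
  case (Suc h)
  let ?good = "\<lambda>y. E * cost y \<le> (E + 1) * d"
  let ?P = "\<lambda>y h vs. \<exists>g\<le>h. ?good (walk_from y (nth vs) 0 g)"
  have fin: "finite (lists_of {..<T} l)" for l by (rule finite_lists_of) simp
  show ?case
  proof (cases "?good y")
    case True
    then have "{vs \<in> lists_of {..<T} (2 * Suc h). ?P y (Suc h) vs} = lists_of {..<T} (2 * Suc h)"
      by (auto intro: exI[of _ 0])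
    then show ?thesis using E by (simp add: card_lists_of)
  next
    case False
    define i where "i = far y n"
    have i: "i < n" unfolding i_def using far_less n_pos by simp
    have fr: "(E + 1) * d < E * hdist m y (V i)" using False by (simp add: cost_def i_def)
    note mg = many_good_positions[OF x Suc.prems(1) i fr E]
    let ?A = "gains y i m" and ?B = "losses y i m"
    define G0 G1 where "G0 = {v. v < T \<and> x (?A ! (v mod length ?A))}"
      and "G1 = {v. v < T \<and> \<not> x (?B ! (v mod length ?B))}"
    have dist: "distinct ?A" "distinct ?B" by (simp_all add: gains_def losses_def)
    have "length ?A \<le> m" "length ?B \<le> m"
      unfolding gains_def losses_def using length_filter_le[of _ "[0..<m]"] by (metis length_upt diff_zero)+
    then have lenT: "length ?A \<le> T" "length ?B \<le> T" using T by auto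
    have "T * length ?A \<le> T * (4 * E * card {j \<in> set ?A. x j})" using mg(1) by (rule mult_le_mono2)
    also have "\<dots> = 4 * E * (T * card {j \<in> set ?A. x j})" by simp
    also have "\<dots> \<le> 4 * E * (2 * length ?A * card G0)"
      unfolding G0_def by (intro mult_le_mono2 mod_rank_count dist mg lenT)
    finally have "T * length ?A \<le> (8 * E * card G0) * length ?A" by (simp add: mult_ac)
    then have G0: "T \<le> 8 * E * card G0" using mg(3) by simp
    have "T * length ?B \<le> T * (4 * E * card {j \<in> set ?B. \<not> x j})" using mg(2) by (rule mult_le_mono2)
    also have "\<dots> = 4 * E * (T * card {j \<in> set ?B. \<not> x j})" by simp
    also have "\<dots> \<le> 4 * E * (2 * length ?B * card G1)"
      unfolding G1_def by (intro mult_le_mono2 mod_rank_count dist mg lenT)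
    finally have "T * length ?B \<le> (8 * E * card G1) * length ?B" by (simp add: mult_ac)
    then have G1: "T \<le> 8 * E * card G1" using mg(4) by simp
    let ?y = "\<lambda>v w. swap_step y i v w"
    have IH: "T ^ (2 * h) \<le> (8 * E) ^ (2 * h) * (\<Sum>vs\<in>lists_of {..<T} (2 * h). of_bool (?P y (Suc h) (v # w # vs)))"
      if "v \<in> G0" "w \<in> G1" for v w
    proof -
      have "hdist m (?y v w) x + 2 = hdist m y x"
        using that by (intro swap_step_closer mg) (auto simp: G0_def G1_def)
      then have "hdist m (?y v w) x \<le> 2 * h" using Suc.prems(2) by simp
      moreover have "ones m (?y v w) = k" by (simp add: ones_swap_step Suc.prems)
      ultimately have "T ^ (2 * h) \<le> (8 * E) ^ (2 * h) * card {vs \<in> lists_of {..<T} (2 * h). ?P (?y v w) h vs}"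
        by (intro Suc.IH)
      moreover have "card {vs \<in> lists_of {..<T} (2 * h). ?P (?y v w) h vs}
          \<le> card {vs \<in> lists_of {..<T} (2 * h). ?P y (Suc h) (v # w # vs)}"
      proof (rule card_mono)
        show "{vs \<in> lists_of {..<T} (2 * h). ?P (?y v w) h vs} \<subseteq> {vs \<in> lists_of {..<T} (2 * h). ?P y (Suc h) (v # w # vs)}"
        proof
          fix vs assume "vs \<in> {vs \<in> lists_of {..<T} (2 * h). ?P (?y v w) h vs}"
          then obtain g where vs: "vs \<in> lists_of {..<T} (2 * h)" "g \<le> h" "?good (walk_from (?y v w) (nth vs) 0 g)"
            by blast
          have "walk_from y (nth (v # w # vs)) 0 (Suc g) = walk_from (?y v w) (nth vs) 0 g"
            by (simp add: i_def, rule walk_from_cong) simp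
          with vs have "?P y (Suc h) (v # w # vs)"
            by (intro exI[of _ "Suc g"]) (simp only: Suc_le_mono)
          with vs(1) show "vs \<in> {vs \<in> lists_of {..<T} (2 * h). ?P y (Suc h) (v # w # vs)}" by blast
        qed
      qed (use fin in auto)
      ultimately have "T ^ (2 * h) \<le> (8 * E) ^ (2 * h) *
          card {vs \<in> lists_of {..<T} (2 * h). ?P y (Suc h) (v # w # vs)}"
        by (meson mult_le_mono2 order_trans)
      then show ?thesis unfolding card_filter_eq_sum[OF fin] .
    qed
    \<comment> \<open>The two factors \<open>T\<close> pay for the lucky pairs of first numbers; for
      each such pair the induction hypothesis counts the continuations.\<close>
    have "T ^ (2 * Suc h) = T ^ (2 * h) * (T * T)" by (simp add: mult_ac)
    also have "\<dots> \<le> T ^ (2 * h) * ((8 * E * card G0) * (8 * E * card G1))"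
      using G0 G1 by (intro mult_le_mono2 mult_le_mono)
    also have "\<dots> = (8 * E) ^ 2 * (\<Sum>v\<in>G0. \<Sum>w\<in>G1. T ^ (2 * h))" by (simp add: power2_eq_square mult_ac)
    also have "\<dots> \<le> (8 * E) ^ 2 * (\<Sum>v\<in>G0. \<Sum>w\<in>G1. (8 * E) ^ (2 * h) *
        (\<Sum>vs\<in>lists_of {..<T} (2 * h). of_bool (?P y (Suc h) (v # w # vs))))"
      by (intro mult_le_mono2 sum_mono IH)
    also have "\<dots> = (8 * E) ^ (2 * Suc h) * (\<Sum>v\<in>G0. \<Sum>w\<in>G1.
        (\<Sum>vs\<in>lists_of {..<T} (2 * h). of_bool (?P y (Suc h) (v # w # vs))))"
      by (simp add: sum_distrib_left[symmetric] power2_eq_square mult_ac del: sum_of_bool_eq)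
    also have "\<dots> \<le> (8 * E) ^ (2 * Suc h) * (\<Sum>v\<in>{..<T}. \<Sum>w\<in>{..<T}.
        (\<Sum>vs\<in>lists_of {..<T} (2 * h). of_bool (?P y (Suc h) (v # w # vs))))"
    proof (rule mult_le_mono2)
      have "(\<Sum>v\<in>G0. \<Sum>w\<in>G1. f v w) \<le> (\<Sum>v\<in>{..<T}. \<Sum>w\<in>{..<T}. f v w)" for f :: "nat \<Rightarrow> nat \<Rightarrow> nat"
        by (rule order_trans[OF sum_mono[OF sum_mono2] sum_mono2]) (auto simp: G0_def G1_def)
      then show "(\<Sum>v\<in>G0. \<Sum>w\<in>G1. (\<Sum>vs\<in>lists_of {..<T} (2 * h). of_bool (?P y (Suc h) (v # w # vs))))
        \<le> (\<Sum>v\<in>{..<T}. \<Sum>w\<in>{..<T}. (\<Sum>vs\<in>lists_of {..<T} (2 * h). of_bool (?P y (Suc h) (v # w # vs)) :: nat))" .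
    qed
    also have "(\<Sum>v\<in>{..<T}. \<Sum>w\<in>{..<T}. (\<Sum>vs\<in>lists_of {..<T} (2 * h). of_bool (?P y (Suc h) (v # w # vs)) :: nat))
        = (\<Sum>vs\<in>lists_of {..<T} (Suc (Suc (2 * h))). of_bool (?P y (Suc h) vs))"
      by (simp only: sum_lists_of_Suc)
    also have "\<dots> = card {vs \<in> lists_of {..<T} (2 * Suc h). ?P y (Suc h) vs}"
      unfolding card_filter_eq_sum[OF fin] by simp
    finally show ?thesis .
  qed
qed

end

section \<open>Amplification by independent repetition\<close>

lemma two_mult_add_two_le_cube:
  fixes n :: real
  assumes "n \<ge> 2"
  shows "2 * (n + 2) \<le> n ^ 3"
proof -
  have "4 \<le> n ^ 2" using power_mono[of 2 n 2] assms by simp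
  then have "4 * n \<le> n ^ 2 * n" using assms by (intro mult_right_mono) auto
  also have "n ^ 2 * n = n ^ 3" by (simp add: power3_eq_cube power2_eq_square)
  finally have *: "4 * n \<le> n ^ 3" .
  have "2 * (n + 2) \<le> 4 * n" using assms by simp
  from order_trans[OF this *] show ?thesis .
qed

lemma card_never_good:
  assumes "finite A"
  shows "card {xs \<in> lists_of A (N * M). \<forall>u<N. \<not> G (take M (drop (u * M) xs))}
     = card {xs \<in> lists_of A M. \<not> G xs} ^ N"
proof (induction N)
  case 0
  have "{xs \<in> lists_of A 0. True} = {[]}" by simp
  then show ?case by (simp add: Collect_conv_if)
next
  case (Suc N)
  have "{xs \<in> lists_of A (Suc N * M). \<forall>u<Suc N. \<not> G (take M (drop (u * M) xs))} =
      {xs \<in> lists_of A (M + N * M). \<not> G (take M xs) \<and> (\<forall>u<N. \<not> G (take M (drop (u * M) (drop M xs))))}"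
    by (auto simp: All_less_Suc2 add.commute)
  then show ?case
    using card_lists_of_take_drop[of A M "N * M" "\<lambda>xs. \<not> G xs" "\<lambda>xs. \<forall>u<N. \<not> G (take M (drop (u * M) xs))"] Suc
    by simp
qed

text \<open>Each block succeeds on a fraction at least \<open>1 / X\<close>, and
  \<open>(1 - 1 / X) ^ (R * X) \<le> exp (- R)\<close>.\<close>

lemma card_never_good_le:
  assumes A: "finite A" "A \<noteq> {}" and X: "X > 0"
    and p: "card A ^ M \<le> X * card {xs \<in> lists_of A M. G xs}"
  shows "real (card {xs \<in> lists_of A (R * X * M). \<forall>u<R * X. \<not> G (take M (drop (u * M) xs))})
     \<le> exp (- real R) * real (card A) ^ (R * X * M)"
proof -
  have fin: "finite (lists_of A M)" using A(1) by (rule finite_lists_of)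
  have "card {xs \<in> lists_of A M. G xs} + card {xs \<in> lists_of A M. \<not> G xs} = card (lists_of A M)"
    using fin by (subst card_Un_disjoint[symmetric]) (auto intro!: arg_cong[of _ _ card])
  then have s: "real (card {xs \<in> lists_of A M. G xs}) + real (card {xs \<in> lists_of A M. \<not> G xs}) = real (card A) ^ M"
    using A by (simp add: card_lists_of flip: of_nat_add of_nat_power)
  have "real (card A ^ M) \<le> real (X * card {xs \<in> lists_of A M. G xs})" using p by (rule of_nat_mono)
  then have "real (card A) ^ M / X \<le> card {xs \<in> lists_of A M. G xs}" using X by (simp add: field_simps)
  then have "real (card {xs \<in> lists_of A M. \<not> G xs}) \<le> real (card A) ^ M * (1 - 1 / X)"
    using s by (simp add: algebra_simps)
  also have "\<dots> \<le> real (card A) ^ M * exp (- 1 / X)"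
    using exp_ge_add_one_self[of "- 1 / real X"] by (intro mult_left_mono) auto
  finally have "real (card {xs \<in> lists_of A M. \<not> G xs}) ^ (R * X) \<le> (real (card A) ^ M * exp (- 1 / X)) ^ (R * X)"
    by (intro power_mono) auto
  also have "\<dots> = real (card A) ^ (R * X * M) * exp (- 1 / X) ^ (R * X)"
    by (simp add: power_mult_distrib mult.commute flip: power_mult)
  also have "exp (- 1 / X) ^ (R * X) = exp (- real R)"
    using X by (simp flip: exp_of_nat_mult)
  finally show ?thesis using card_never_good[OF A(1), of "R * X" M G] by (simp add: mult.commute)
qed

section \<open>Both methods within one trial\<close>

context trials
begin

lemma walk_eq_walk_from: "walk c p h = walk_from y0 c p h"
  by (induction h) (simp_all add: walk_from_Suc' del: walk_from.simps(2))

text \<open>Counterpart of \<open>trial_ok\<close>: whichever repaired string the program produces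
  must be cheap, so the quantifier here is universal where that one is existential. Together they
  bound the record.\<close>

definition good_coins :: "real \<Rightarrow> (nat \<Rightarrow> nat) \<Rightarrow> nat \<Rightarrow> bool" where
  "good_coins B c p \<longleftrightarrow>
     (\<forall>y. ones m y = k \<longrightarrow> int (hdist m y (rounded c p)) = \<bar>int (ones m (rounded c p)) - int k\<bar> \<longrightarrow>
        real (cost y) \<le> B) \<or>
     (\<exists>h<D. real (cost (walk c (p + m) h)) \<le> B)"

lemma trial_ok_good_coins: "trial_ok c p b \<Longrightarrow> good_coins B c p \<Longrightarrow> real b \<le> B"
proof -
  assume t: "trial_ok c p b" and g: "good_coins B c p"
  have "\<exists>y. b \<le> cost y \<and> real (cost y) \<le> B"
    using t g unfolding trial_ok_def good_coins_def by blast
  then show "real b \<le> B" by (meson of_nat_mono order_trans)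
qed

lemma rounded_cong:
  assumes "\<And>j. j < m \<Longrightarrow> c (p + j) = c' (p' + j)"
  shows "ones m (rounded c p) = ones m (rounded c' p')" "hdist m y (rounded c p) = hdist m y (rounded c' p')"
  unfolding ones_def hdist_def rounded_def by (intro sum.cong refl; simp add: assms)+

text \<open>A trial depends only on its own block of numbers, so trial \<open>u\<close> can be
  judged on that block shifted to offset 0; this makes the trials independent.\<close>

lemma good_coins_cong:
  assumes "\<And>j. j < m + 2 * D \<Longrightarrow> c (p + j) = c' (p' + j)"
  shows "good_coins B c p = good_coins B c' p'"
proof -
  have "walk c (p + m) h = walk c' (p' + m) h" if "h < D" for h
    unfolding walk_eq_walk_from
  proof (rule walk_from_cong)
    fix j assume "j < 2 * h"
    then show "c (p + m + j) = c' (p' + m + j)" using assms[of "m + j"] that by (simp add: add.assoc)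
  qed
  moreover note rounded_cong[of c p c' p'] assms
  ultimately show ?thesis unfolding good_coins_def by auto
qed

text \<open>One tail bound for both the distance to a vote and the number of ones. In either case
  the summands vanish where the strings agree with vote \<open>i\<close>, and the average distance
  to that vote bounds the expected number of nonzero ones.\<close>

lemma rounding_tail:
  fixes \<xi> :: "nat \<Rightarrow> nat \<Rightarrow> real" and d c :: real
  assumes \<xi>: "\<And>j v. \<xi> j v \<in> {-1, 0, 1}" "\<And>j v. \<bar>\<xi> j v\<bar> = of_bool (z v j \<noteq> V i j)"
    and avg: "(\<Sum>t<T. real (hdist m (z t) (V i))) \<le> T * (d * (1 + c))"
    and c: "0 < c" "c \<le> 1" "d \<ge> 0" and T: "T > 0"
  shows "real (card {xs \<in> lists_of {..<T} m. (\<Sum>j<m. \<xi> j (xs ! j)) \<ge> (\<Sum>j<m. \<Sum>v<T. \<xi> j v) / T + c * d})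
     \<le> real T ^ m * exp (- (c\<^sup>2 * d / 8))"
proof -
  have "(\<Sum>j<m. \<Sum>v<T. \<bar>\<xi> j v\<bar>) = (\<Sum>t<T. real (hdist m (z t) (V i)))"
    unfolding hdist_def \<xi>(2) by (subst sum.swap) (simp only: of_nat_sum of_nat_of_bool)
  also have "\<dots> \<le> T * (d * (1 + c))" by (rule avg)
  also have "\<dots> \<le> T * (d * 2)" using c by (intro mult_left_mono) auto
  finally have "(\<Sum>j<m. \<Sum>v<T. \<bar>\<xi> j v\<bar>) \<le> 2 * d * card {..<T}" by (simp add: mult_ac)
  moreover have "{..<T} \<noteq> {}" using T by auto
  ultimately show ?thesis using chernoff_lists_of[of "{..<T}" \<xi> m d c] \<xi>(1) c by simp
qed

text \<open>Union bound over \<open>n\<close> distances and the two directions in which the number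
  of ones can deviate. With \<open>c = 1 / (4 * E)\<close> the tail exponent is
  \<open>d / (128 * E^2)\<close>; the constant \<open>384 = 3 * 128\<close> makes it at least
  \<open>3 * ln n\<close>, and \<open>n + 2\<close> events of relative size \<open>n ^ (-3)\<close>
  cover at most half of all lists.\<close>

lemma rounding_success:
  fixes d :: nat and E :: nat
  assumes avg: "\<And>i. i < n \<Longrightarrow> (\<Sum>t<T. real (hdist m (z t) (V i))) \<le> T * (d * (1 + 1 / (4 * E)))"
    and z: "\<And>t. t < T \<Longrightarrow> ones m (z t) = k"
    and n: "n \<ge> 2" and E: "E \<ge> 1" and T: "T > 0" and d: "384 * E ^ 2 * ln n \<le> d"
  shows "T ^ m \<le> 2 * card {xs \<in> lists_of {..<T} m.
     (\<forall>i<n. hdist m (rounded (nth xs) 0) (V i) \<le> d * (1 + 2 / (4 * E))) \<and>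
     \<bar>real (ones m (rounded (nth xs) 0)) - k\<bar> \<le> d / (4 * E)}"
proof -
  define c where "c = 1 / (4 * real E)"
  have c: "0 < c" "c \<le> 1" using E by (auto simp: c_def field_simps)
  define e where "e = exp (- (c\<^sup>2 * d / 8))"
  define Om where "Om = lists_of {..<T} m"
  have fin: "finite Om" unfolding Om_def by (rule finite_lists_of) simp
  let ?r = "\<lambda>xs. rounded (nth xs) 0"
  define B where "B i = {xs \<in> Om. real (hdist m (?r xs) (V i)) > d * (1 + 2 * c)}" for i
  define U where "U \<sigma> = {xs \<in> Om. \<sigma> * (real (ones m (?r xs)) - k) \<ge> c * d}" for \<sigma> :: real
  have cB: "real (card (B i)) \<le> real T ^ m * e" if i: "i < n" for i
  proof -
    let ?\<xi> = "\<lambda>j v. of_bool (z v j \<noteq> V i j) :: real"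
    have "(\<Sum>j<m. \<Sum>v<T. ?\<xi> j v) = (\<Sum>t<T. real (hdist m (z t) (V i)))"
      unfolding hdist_def by (subst sum.swap) (simp only: of_nat_sum of_nat_of_bool)
    then have "(\<Sum>j<m. \<Sum>v<T. ?\<xi> j v) / T \<le> d * (1 + c)"
      using avg[OF i] T by (simp add: c_def divide_le_eq mult.commute)
    moreover have "(\<Sum>j<m. ?\<xi> j (xs ! j)) = hdist m (?r xs) (V i)" for xs
      unfolding hdist_def rounded_def by (simp only: of_nat_sum of_nat_of_bool add_0)
    moreover have "real d * (1 + 2 * c) = d * (1 + c) + c * d" by (simp add: algebra_simps)
    ultimately have "B i \<subseteq> {xs \<in> Om. (\<Sum>j<m. ?\<xi> j (xs ! j)) \<ge> (\<Sum>j<m. \<Sum>v<T. ?\<xi> j v) / T + c * d}"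
      unfolding B_def by fastforce
    then have "real (card (B i)) \<le> card {xs \<in> Om. (\<Sum>j<m. ?\<xi> j (xs ! j)) \<ge> (\<Sum>j<m. \<Sum>v<T. ?\<xi> j v) / T + c * d}"
      using fin by (intro of_nat_mono card_mono) auto
    also have "\<dots> \<le> real T ^ m * e"
      unfolding Om_def e_def
    proof (rule rounding_tail[where i = i])
      show "(\<Sum>t<T. real (hdist m (z t) (V i))) \<le> T * (d * (1 + c))" using avg[OF i] by (simp add: c_def)
    qed (use c T in auto)
    finally show ?thesis .
  qed
  have cU: "real (card (U \<sigma>)) \<le> real T ^ m * e" if \<sigma>: "\<sigma> \<in> {-1, 1}" for \<sigma>
  proof -
    \<comment> \<open>Ones are counted relative to vote 0. The number \<open>k\<close> itself may be
      far larger than \<open>d\<close>, whereas the strings differ from the vote in few positions on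
      average; the shift cancels in the deviation.\<close>
    let ?\<xi> = "\<lambda>j v. \<sigma> * (of_bool (z v j) - of_bool (V 0 j)) :: real"
    have o: "(\<Sum>j<m. of_bool (y j) :: real) = ones m y" for y by (simp only: ones_def of_nat_sum of_nat_of_bool)
    have "(\<Sum>j<m. \<Sum>v<T. ?\<xi> j v) = (\<Sum>v<T. \<sigma> * (real (ones m (z v)) - ones m (V 0)))"
      by (subst sum.swap) (simp only: sum_distrib_left[symmetric] sum_subtractf o)
    also have "\<dots> = T * (\<sigma> * (real k - ones m (V 0)))" using z by simp
    finally have mean: "(\<Sum>j<m. \<Sum>v<T. ?\<xi> j v) / T = \<sigma> * (real k - ones m (V 0))" using T by simp
    have s: "(\<Sum>j<m. ?\<xi> j (xs ! j)) = \<sigma> * (real (ones m (?r xs)) - ones m (V 0))" for xs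
      by (simp only: sum_distrib_left[symmetric] sum_subtractf o[symmetric] rounded_def add_0)
    have "U \<sigma> = {xs \<in> Om. (\<Sum>j<m. ?\<xi> j (xs ! j)) \<ge> (\<Sum>j<m. \<Sum>v<T. ?\<xi> j v) / T + c * d}"
      unfolding mean s by (auto simp: U_def algebra_simps)
    also have "real (card \<dots>) \<le> real T ^ m * e"
      unfolding Om_def e_def
    proof (rule rounding_tail[where i = 0])
      show "(\<Sum>t<T. real (hdist m (z t) (V 0))) \<le> T * (d * (1 + c))" using avg[OF n_pos] by (simp add: c_def)
    qed (use \<sigma> c T in auto)
    finally show ?thesis .
  qed
  define Bad where "Bad = (\<Union>i<n. B i) \<union> (U 1 \<union> U (-1))"
  have "card Bad \<le> (\<Sum>i<n. card (B i)) + (card (U 1) + card (U (-1)))"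
    unfolding Bad_def by (intro order_trans[OF card_Un_le] add_mono card_UN_le card_Un_le) simp
  then have "real (card Bad) \<le> (\<Sum>i<n. real (card (B i))) + (real (card (U 1)) + real (card (U (-1))))"
    by (simp flip: of_nat_sum of_nat_add)
  also have "\<dots> \<le> (\<Sum>i<n. real T ^ m * e) + (real T ^ m * e + real T ^ m * e)"
    by (intro add_mono sum_mono cB cU) auto
  also have "\<dots> = (real n + 2) * (real T ^ m * e)" by (simp add: algebra_simps)
  also have "\<dots> \<le> real T ^ m / 2"
  proof -
    have "3 * ln n \<le> c\<^sup>2 * d / 8"
    proof -
      have "c\<^sup>2 * d / 8 = d / (128 * real E ^ 2)" by (simp add: c_def power2_eq_square)
      moreover have "3 * ln n \<le> d / (128 * real E ^ 2)" using d E by (simp add: field_simps)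
      ultimately show ?thesis by simp
    qed
    then have "e \<le> exp (- (3 * ln n))" by (simp add: e_def)
    also have "\<dots> = inverse (exp (3 * ln n))" by (rule exp_minus)
    also have "exp (3 * ln n) = real n ^ 3"
    proof -
      have "exp (3 * ln n) = exp (ln n) ^ 3" by (simp flip: exp_of_nat_mult)
      then show ?thesis using n_pos by simp
    qed
    finally have "(real n + 2) * e \<le> (real n + 2) * inverse (real n ^ 3)" by (intro mult_left_mono) auto
    also have "\<dots> = (real n + 2) / real n ^ 3" by (rule divide_inverse[symmetric])
    also have "\<dots> \<le> 1 / 2"
    proof -
      have "real n ^ 3 > 0" using n by simp
      moreover have "2 * (real n + 2) \<le> real n ^ 3" by (rule two_mult_add_two_le_cube) (use n in simp)
      ultimately show ?thesis by (simp add: pos_divide_le_eq)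
    qed
    finally have "(real n + 2) * e * real T ^ m \<le> 1 / 2 * real T ^ m" by (intro mult_right_mono) auto
    then show ?thesis by (simp add: mult_ac)
  qed
  finally have bad: "real (card Bad) \<le> real T ^ m / 2" .
  let ?Good = "{xs \<in> lists_of {..<T} m.
     (\<forall>i<n. hdist m (rounded (nth xs) 0) (V i) \<le> d * (1 + 2 / (4 * E))) \<and>
     \<bar>real (ones m (rounded (nth xs) 0)) - k\<bar> \<le> d / (4 * E)}"
  have "Om \<subseteq> ?Good \<union> Bad"
  proof
    fix xs assume xs: "xs \<in> Om"
    show "xs \<in> ?Good \<union> Bad"
    proof (cases "xs \<in> Bad")
      case False
      have "real (hdist m (?r xs) (V i)) \<le> d * (1 + 2 * c)" if "i < n" for i
        using False xs that by (auto simp: Bad_def B_def not_less)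
      moreover have "real (ones m (?r xs)) - k < c * d" "k - real (ones m (?r xs)) < c * d"
        using False xs by (auto simp: Bad_def U_def not_le)
      then have "\<bar>real (ones m (?r xs)) - k\<bar> \<le> c * d" by (simp add: abs_le_iff)
      ultimately show ?thesis using xs by (auto simp: Om_def c_def)
    qed simp
  qed
  then have "card Om \<le> card ?Good + card Bad"
    using fin by (intro order_trans[OF card_mono card_Un_le]) (auto simp: Om_def Bad_def B_def U_def)
  moreover have "card Om = T ^ m" by (simp add: Om_def card_lists_of)
  ultimately have "T ^ m \<le> card ?Good + card Bad" by (simp only:)
  then have "real (T ^ m) \<le> real (card ?Good + card Bad)" by (rule of_nat_mono)
  then have "real T ^ m \<le> real (card ?Good) + real (card Bad)" by (simp only: of_nat_add of_nat_power)
  then have "real T ^ m \<le> 2 * real (card ?Good)" using bad by linarith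
  then have "real (T ^ m) \<le> real (2 * card ?Good)" by (simp only: of_nat_power of_nat_mult of_nat_numeral)
  then show ?thesis by (simp only: of_nat_le_iff)
qed

lemma trial_success_rounding:
  fixes d :: nat and E :: nat
  assumes avg: "\<And>i. i < n \<Longrightarrow> (\<Sum>t<T. real (hdist m (z t) (V i))) \<le> T * (d * (1 + 1 / (4 * E)))"
    and z: "\<And>t. t < T \<Longrightarrow> ones m (z t) = k"
    and n: "n \<ge> 2" and E: "E \<ge> 1" and T: "T > 0" and d: "384 * E ^ 2 * ln n \<le> d"
  shows "card {..<T} ^ (m + 2 * D) \<le>
    2 * card {xs \<in> lists_of {..<T} (m + 2 * D). good_coins ((1 + 1 / E) * d) (nth xs) 0}"
proof -
  let ?P = "\<lambda>xs. (\<forall>i<n. hdist m (rounded (nth xs) 0) (V i) \<le> d * (1 + 2 / (4 * E))) \<and>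
     \<bar>real (ones m (rounded (nth xs) 0)) - k\<bar> \<le> d / (4 * E)"
  have "card {..<T} ^ (m + 2 * D) = T ^ m * T ^ (2 * D)" by (simp add: power_add)
  also have "\<dots> \<le> (2 * card {xs \<in> lists_of {..<T} m. ?P xs}) * card {xs \<in> lists_of {..<T} (2 * D). True}"
    by (rule mult_le_mono[OF rounding_success[OF assms]]) (simp_all add: card_lists_of)
  also have "\<dots> = 2 * card {xs \<in> lists_of {..<T} (m + 2 * D). ?P (take m xs) \<and> True}"
    by (simp only: card_lists_of_take_drop[of "{..<T}" m "2 * D" ?P "\<lambda>_. True"] mult.assoc)
  also have "\<dots> \<le> 2 * card {xs \<in> lists_of {..<T} (m + 2 * D). good_coins ((1 + 1 / E) * d) (nth xs) 0}"
  proof (intro mult_le_mono2 card_mono finite_Collect_conjI disjI1 finite_lists_of subsetI)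
    fix xs assume "xs \<in> {xs \<in> lists_of {..<T} (m + 2 * D). ?P (take m xs) \<and> True}"
    then have xs: "xs \<in> lists_of {..<T} (m + 2 * D)" and P: "?P (take m xs)" by auto
    let ?r = "rounded (nth xs) 0"
    note rc = rounded_cong[of "nth (take m xs)" 0 "nth xs" 0]
    have r: "real (hdist m ?r (V i)) \<le> d * (1 + 2 / (4 * E))" if "i < n" for i
      using P that rc(2)[of "V i"] hdist_commute[of m _ "V i"] by auto
    have o: "\<bar>real (ones m ?r) - k\<bar> \<le> d / (4 * E)" using P rc(1) by auto
    have "real (cost y) \<le> (1 + 1 / E) * d"
      if y: "int (hdist m y ?r) = \<bar>int (ones m ?r) - int k\<bar>" for y
    proof -
      let ?i = "far y n"
      have i: "?i < n" using far_less n_pos by simp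
      have "real (hdist m y ?r) = \<bar>real (ones m ?r) - k\<bar>"
        using arg_cong[OF y, of real_of_int] by simp
      then have "real (hdist m y ?r) \<le> d / (4 * E)" using o by simp
      moreover have "real (cost y) \<le> real (hdist m y ?r) + real (hdist m ?r (V ?i))"
        unfolding cost_def using hdist_triangle[of m y "V ?i" ?r] by linarith
      \<comment> \<open>The error budget: a share \<open>1 / (4 * E)\<close> each for the weights
        phase, the random deviation and the repair.\<close>
      ultimately have "real (cost y) \<le> d / (4 * E) + d * (1 + 2 / (4 * E))" using r[OF i] by linarith
      also have "\<dots> \<le> (1 + 1 / E) * d" using E by (simp add: field_simps)
      finally show ?thesis .
    qed
    then show "xs \<in> {xs \<in> lists_of {..<T} (m + 2 * D). good_coins ((1 + 1 / E) * d) (nth xs) 0}"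
      using xs by (simp add: good_coins_def)
  qed (simp add: finite_lists_of)
  finally show ?thesis .
qed

lemma trial_success_walk:
  fixes d :: nat and E :: nat
  assumes x: "ones m x = k" "\<And>i. i < n \<Longrightarrow> hdist m x (V i) \<le> d" and E: "E \<ge> 1" and T: "m \<le> T"
    and y0: "hdist m y0 x \<le> 2 * h" and D: "D = Suc h"
  shows "card {..<T} ^ (m + 2 * D) \<le> (8 * E) ^ (2 * h) *
    card {xs \<in> lists_of {..<T} (m + 2 * D). good_coins ((1 + 1 / E) * d) (nth xs) 0}"
proof -
  let ?P = "\<lambda>vs. \<exists>g\<le>h. E * cost (walk_from y0 (nth vs) 0 g) \<le> (E + 1) * d"
  \<comment> \<open>The \<open>m\<close> numbers of the rounding and the two of the swap after the
    last evaluation may be arbitrary; they contribute the factors \<open>T ^ m\<close> and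
    \<open>T ^ 2\<close>.\<close>
  have "card {..<T} ^ (m + 2 * D) = T ^ m * (T ^ (2 * h) * T ^ 2)" by (simp add: power_add D power2_eq_square)
  also have "\<dots> \<le> T ^ m * (((8 * E) ^ (2 * h) * card {vs \<in> lists_of {..<T} (2 * h). ?P vs}) * T ^ 2)"
    by (intro mult_le_mono2 mult_le_mono1 walk_success_count[OF x E T ones_y0 y0])
  also have "\<dots> = (8 * E) ^ (2 * h) * (card {vs \<in> lists_of {..<T} m. True} *
      (card {vs \<in> lists_of {..<T} (2 * h). ?P vs} * card {vs \<in> lists_of {..<T} 2. True}))"
    by (simp add: card_lists_of mult_ac)
  also have "\<dots> = (8 * E) ^ (2 * h) * card {xs \<in> lists_of {..<T} (m + (2 * h + 2)). True \<and> ?P (take (2 * h) (drop m xs)) \<and> True}"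
    by (simp only: card_lists_of_take_drop[where P = "\<lambda>_. True" and Q = "\<lambda>xs. ?P (take (2 * h) xs) \<and> True"]
      card_lists_of_take_drop[where P = ?P and Q = "\<lambda>_. True"])
  also have "\<dots> \<le> (8 * E) ^ (2 * h) *
    card {xs \<in> lists_of {..<T} (m + 2 * D). good_coins ((1 + 1 / E) * d) (nth xs) 0}"
  proof (intro mult_le_mono2 card_mono finite_Collect_conjI disjI1 finite_lists_of subsetI)
    fix xs assume "xs \<in> {xs \<in> lists_of {..<T} (m + (2 * h + 2)). True \<and> ?P (take (2 * h) (drop m xs)) \<and> True}"
    then obtain g where xs: "xs \<in> lists_of {..<T} (m + 2 * D)" and g: "g \<le> h"
      and P: "E * cost (walk_from y0 (nth (take (2 * h) (drop m xs))) 0 g) \<le> (E + 1) * d"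
      unfolding D by auto
    have len: "length xs = m + 2 * D" using xs by (simp add: lists_of_def)
    have "walk_from y0 (nth (take (2 * h) (drop m xs))) 0 g = walk_from y0 (nth xs) m g"
      by (rule walk_from_cong) (use g len D in auto)
    then have "E * cost (walk (nth xs) (0 + m) g) \<le> (E + 1) * d" using P by (simp add: walk_eq_walk_from)
    then have "real (E * cost (walk (nth xs) (0 + m) g)) \<le> real ((E + 1) * d)" by (rule of_nat_mono)
    then have "real (cost (walk (nth xs) (0 + m) g)) \<le> (1 + 1 / E) * d"
      using E by (simp add: field_simps)
    moreover have "g < D" using g D by simp
    ultimately have "good_coins ((1 + 1 / E) * d) (nth xs) 0" unfolding good_coins_def by blast
    then show "xs \<in> {xs \<in> lists_of {..<T} (m + 2 * D). good_coins ((1 + 1 / E) * d) (nth xs) 0}"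
      using xs by blast
  qed (simp add: finite_lists_of)
  finally show ?thesis .
qed

end

section \<open>The algorithm\<close>

text \<open>Only \<open>F\<close> is random, so the final distribution is an image of the coupling
  of \<open>F\<close>. The running times of \<open>M\<close> differ between outcomes, but a halted
  configuration stays put, so every branch is inspected after the full budget
  \<open>B\<close>.\<close>

lemma run_prepare_sample_main:
  assumes "big_step P s t s1" "samples F s1 u p Q"
    and main: "\<And>x s'. Q x s' \<Longrightarrow> x \<in> set_pmf p \<Longrightarrow> wp M B (\<lambda>s'' _. R x s'') s'"
    and G: "\<And>x s''. x \<in> H \<Longrightarrow> R x s'' \<Longrightarrow> G s''"
  shows "halts_within (2 + t + u + B) (Seq P (Seq F M)) s"
    and "measure_pmf.prob (run (2 + t + u + B) (Seq P (Seq F M)) s) {cf. G (snd cf)} \<ge> measure_pmf.prob p H"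
proof -
  from assms(2) obtain J where J: "map_pmf fst J = p"
    "\<And>K. steps u (F # K, s1) = map_pmf (\<lambda>a. (K, snd a)) J"
    "\<And>x s'. (x, s') \<in> set_pmf J \<Longrightarrow> Q x s'" unfolding samples_def by blast
  have "\<exists>s''. steps B ([M], snd a) = return_pmf ([], s'') \<and> R (fst a) s''" if a: "a \<in> set_pmf J" for a
  proof -
    have "fst a \<in> set_pmf p" using a by (auto simp: J(1)[symmetric])
    then have "wp M B (\<lambda>s'' _. R (fst a) s'') (snd a)" using main J(3) a by (cases a) auto
    then obtain v s'' where v: "big_step M (snd a) v s''" "v \<le> B" "R (fst a) s''" unfolding wp_def by blast
    have "steps (v + (B - v)) ([M], snd a) = return_pmf ([], s'')"
      by (simp only: steps_add steps_big_step[OF v(1)] bind_return_pmf steps_halted)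
    with v show ?thesis by auto
  qed
  then have "\<forall>a\<in>set_pmf J. \<exists>s''. steps B ([M], snd a) = return_pmf ([], s'') \<and> R (fst a) s''" by blast
  from bchoice[OF this] obtain f where
    f: "\<And>a. a \<in> set_pmf J \<Longrightarrow> steps B ([M], snd a) = return_pmf ([], f a)"
    "\<And>a. a \<in> set_pmf J \<Longrightarrow> R (fst a) (f a)" by blast
  have "2 + t + u + B = Suc (t + Suc (u + B))" by simp
  then have "run (2 + t + u + B) (Seq P (Seq F M)) s = bind_pmf J (\<lambda>a. steps B ([M], snd a))"
    unfolding run_def
    by (simp only: steps.simps step.simps bind_return_pmf steps_add steps_big_step[OF assms(1)] J(2) bind_map_pmf)
  also have "\<dots> = bind_pmf J (\<lambda>a. return_pmf ([], f a))"
    by (intro bind_pmf_cong refl f)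
  finally have run: "run (2 + t + u + B) (Seq P (Seq F M)) s = map_pmf (\<lambda>a. ([], f a)) J"
    by (simp add: map_pmf_def)
  show "halts_within (2 + t + u + B) (Seq P (Seq F M)) s"
    unfolding halts_within_def run by auto
  have "measure_pmf.prob p H = measure_pmf.prob J (fst -` H)"
    unfolding J(1)[symmetric] by (simp add: measure_map_pmf)
  also have "\<dots> \<le> measure_pmf.prob J ((\<lambda>a. ([] :: com list, f a)) -` {cf. G (snd cf)})"
    by (rule measure_pmf.finite_measure_mono_AE) (auto simp: AE_measure_pmf_iff intro: G f)
  also have "\<dots> = measure_pmf.prob (run (2 + t + u + B) (Seq P (Seq F M)) s) {cf. G (snd cf)}"
    unfolding run by (simp add: measure_map_pmf)
  finally show "measure_pmf.prob (run (2 + t + u + B) (Seq P (Seq F M)) s) {cf. G (snd cf)} \<ge> measure_pmf.prob p H" .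
qed

lemma prob_some_good:
  fixes T X M R :: nat
  assumes T: "T > 0" and X: "X > 0" and p: "card {..<T} ^ M \<le> X * card {xs \<in> lists_of {..<T} M. G xs}"
  shows "1 - exp (- real R) \<le> measure_pmf.prob (replicate_pmf (R * X * M) (pmf_of_set {..<T}))
     {xs. \<exists>u<R * X. G (take M (drop (u * M) xs))}"
proof -
  let ?Om = "lists_of {..<T} (R * X * M)"
  let ?H = "{xs. \<exists>u<R * X. G (take M (drop (u * M) xs))}"
  let ?Bad = "{xs \<in> ?Om. \<forall>u<R * X. \<not> G (take M (drop (u * M) xs))}"
  have ne: "{..<T} \<noteq> {}" using T by auto
  have fin: "finite ?Om" by (rule finite_lists_of) simp
  have card: "card ?Om = T ^ (R * X * M)" by (simp add: card_lists_of)
  then have cpos: "card ?Om > 0" using T by simp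
  then have Om: "?Om \<noteq> {}" by (metis card.empty less_irrefl)
  have rep: "replicate_pmf (R * X * M) (pmf_of_set {..<T}) = pmf_of_set ?Om"
    unfolding lists_of_def by (rule replicate_pmf_of_set) (use ne in auto)
  have "card (?Om \<inter> ?H) + card ?Bad = card ?Om"
    using fin by (subst card_Un_disjoint[symmetric]) (auto intro!: arg_cong[of _ _ card])
  then have "real (card (?Om \<inter> ?H)) + real (card ?Bad) = real (card ?Om)" by (simp only: flip: of_nat_add)
  moreover have "real (card ?Bad) \<le> exp (- real R) * real (card ?Om)"
    using card_never_good_le[OF finite_lessThan ne X p, of R] by (simp add: card)
  ultimately have "(1 - exp (- real R)) * real (card ?Om) \<le> real (card (?Om \<inter> ?H))"
    unfolding left_diff_distrib by linarith
  then have "1 - exp (- real R) \<le> real (card (?Om \<inter> ?H)) / real (card ?Om)"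
    using cpos by (simp add: pos_le_divide_eq)
  then show ?thesis unfolding rep using measure_pmf_of_set[OF Om fin] by simp
qed

definition ALG :: "nat \<Rightarrow> nat \<Rightarrow> nat \<Rightarrow> nat \<Rightarrow> com" where
  "ALG C \<beta> q R = Seq (PREPARE C \<beta> q R) (Seq FILL TRIALS)"

lemma ones_diff_le: "\<bar>int (ones m x) - int (ones m y)\<bar> \<le> int (hdist m x y)"
proof -
  have "ones m x \<le> ones m y + hdist m x y" "ones m y \<le> ones m x + hdist m x y"
    unfolding ones_def hdist_def sum.distrib[symmetric] by (intro sum_mono; auto)+
  then show ?thesis by linarith
qed

context votes
begin

abbreviation prepare_time :: "nat \<Rightarrow> nat \<Rightarrow> nat \<Rightarrow> nat \<Rightarrow> nat \<Rightarrow> nat" where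
  "prepare_time L bL N T Q \<equiv> (65 + n * 11 + m * 17 + L * 12 + bL * 6 + N * 6) +
     (5 + 8 * m) + (13 + 22 * m) + (5 + 8 * m) + (11 + 6 * n + T * round_time Q) + 4"

lemma wp_PREPARE:
  assumes s: "env (set_reg 12 1 s)" "reg s 3 = 0" "reg s 5 = 0" "reg s 9 = 0" "reg s 10 = 0" "reg s 14 = 0"
    and L: "\<And>l. n \<le> 2 ^ l \<Longrightarrow> l = 0 \<or> 2 ^ (l - 1) < n \<Longrightarrow> l = L"
    and b: "\<And>l. m \<le> 2 ^ l \<Longrightarrow> l = 0 \<or> 2 ^ (l - 1) < m \<Longrightarrow> l = b"
    and D: "D = 1 + C * L" and N: "N = R * 2 ^ (\<beta> * L)" and Q: "Q = m * (if L = 0 then 0 else q)"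
  shows "wp (PREPARE C \<beta> q R) (prepare_time L (\<beta> * L) N (2 ^ b) Q)
    (\<lambda>s' _. \<exists>y0 z w. env s' \<and> reg s' 4 = 2 ^ b \<and> reg s' 5 = b \<and> reg s' 6 = D \<and> reg s' 7 = N \<and>
       reg s' 9 = N * (m + 2 * D) \<and> holds_str s' 3 m y0 \<and> ones m y0 = k \<and>
       int (hdist m y0 (V 0)) = \<bar>int (ones m (V 0)) - int k\<bar> \<and> mw_run Q (2 ^ b) z w \<and>
       (\<forall>j<m. \<forall>t<2 ^ b. arr s' 6 (j * 2 ^ b + t) = of_bool (z t j))) s"
proof -
  let ?r = "\<lambda>s'. env s' \<and> reg s' 4 = 2 ^ b \<and> reg s' 5 = b \<and> reg s' 6 = D \<and> reg s' 7 = N \<and>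
       reg s' 9 = N * (m + 2 * D) \<and> reg s' 10 = Q"
  have keep: "?r s2" if "agree_off X A s1 s2" "?r s1" "X \<inter> {0, 1, 2, 4, 5, 6, 7, 9, 10, 12, 13} = {}" "0 \<notin> A" for X A s1 s2
  proof -
    have "env s2" by (rule env_agree_off[OF that(1)]) (use that in auto)
    moreover have "reg s2 i = reg s1 i" if "i \<in> {4, 5, 6, 7, 9, 10}" for i
      using \<open>agree_off X A s1 s2\<close> \<open>X \<inter> _ = {}\<close> that by (auto simp: agree_off_def)
    ultimately show ?thesis using that(2) by auto
  qed
  let ?W = "11 + 6 * n + 2 ^ b * round_time Q"
  show ?thesis unfolding PREPARE_def
  proof (rule wp_seq_use[OF wp_SETUP[where L = L and D = D and N = N, OF s L D N], where
      Bd = "(5 + 8 * m) + (13 + 22 * m) + (5 + 8 * m) + ?W + 3"], goal_cases)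
    case (1 l) then show ?case by simp
  next
    case (2 l) then show ?case by simp
  next
    case (3 s1)
    then have r1: "?r s1" using b[of "reg s1 5"] Q by auto
    have h1: "holds_str s1 0 m (V 0)"
      using envD(6)[of s1 0] r1 n_pos by (auto simp: holds_str_def)
    show ?case
    proof (rule wp_seq_use[OF wp_COPY[of s1 0 "V 0" 2], where
        Bd = "(13 + 22 * m) + (5 + 8 * m) + ?W + 2"], goal_cases)
      case (4 s2)
      have r2: "?r s2" by (rule keep[OF 4(2) r1]) auto
      show ?case
      proof (rule wp_seq_use[OF wp_FIX[of s2 "V 0"], where Bd = "(5 + 8 * m) + ?W + 1"], goal_cases)
        case (3 s3)
        then obtain y0 where y0: "holds_str s3 2 m y0" "ones m y0 = k"
          "int (hdist m y0 (V 0)) = \<bar>int (ones m (V 0)) - int k\<bar>" by blast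
        have r3: "?r s3" by (rule keep[OF 3(2) r2]) auto
        show ?case
        proof (rule wp_seq_use[OF wp_COPY[of s3 2 y0 3], where Bd = ?W], goal_cases)
          case (4 s4)
          have r4: "?r s4" by (rule keep[OF 4(2) r3]) auto
          show ?case
          proof (rule wp_use[OF wp_WEIGHTS[of s4 "2 ^ b" Q]], goal_cases)
            case (5 s5 b5)
            have r5: "?r s5" by (rule keep[OF 5(2) r4]) auto
            have "holds_str s5 3 m y0" by (rule holds_agree_off[OF 5(2) 4(1)]) simp
            with r5 5(1) y0 show ?case by blast
          qed (use r4 in auto)
        qed (use r3 y0 in auto)
      qed (use r2 4 in auto)
    qed (use r1 h1 in auto)
  qed simp
qed

text \<open>A single trial count covers all cases. For small \<open>d\<close> the walk starts within
  \<open>2 * d\<close> of \<open>x\<close>, since the repaired vote 0 is no farther from vote 0 than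
  \<open>x\<close> is. For large \<open>d\<close> the rounding succeeds on half of the lists, far
  more than required.\<close>

lemma trial_success:
  fixes l b L :: nat
  assumes tr: "trials n m k y0" and E: "E = 2 ^ l" and C: "C = 384 * E ^ 2" and \<beta>: "\<beta> = 2 * C * (l + 3)"
    and L: "n \<le> 2 ^ L" "L = 0 \<or> 2 ^ (L - 1) < n" and b: "m \<le> 2 ^ b"
    and x: "ones m x = k" "\<And>i. i < n \<Longrightarrow> hdist m x (V i) \<le> d" and d: "d \<le> m"
    and y0: "int (hdist m y0 (V 0)) = \<bar>int (ones m (V 0)) - int k\<bar>"
    and run: "mw_run (m * (if L = 0 then 0 else 8 * E + 1)) (2 ^ b) z w"
    and D: "D = 1 + C * L"
  shows "card {..<(2 :: nat) ^ b} ^ (m + 2 * D) \<le> 2 ^ (\<beta> * L) *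
    card {xs \<in> lists_of {..<2 ^ b} (m + 2 * D). trials.good_coins n m k V D z y0 ((1 + 1 / E) * d) (nth xs) 0}"
proof -
  interpret trials n m k V "2 ^ b" D z y0 by (rule tr)
  have E1: "E \<ge> 1" by (simp add: E)
  have hV: "hdist m x (V 0) \<le> d" using x(2) n_pos by simp
  have "\<bar>int (ones m (V 0)) - int k\<bar> \<le> int (hdist m x (V 0))"
    using ones_diff_le[of m "V 0" x] x(1) hdist_commute[of m x "V 0"] by simp
  then have y0V: "hdist m y0 (V 0) \<le> hdist m x (V 0)" using y0 by linarith
  have X: "(8 * E) ^ (2 * (C * L)) = 2 ^ (\<beta> * L)"
  proof -
    have "8 * E = 2 ^ (l + 3)" by (simp add: E power_add)
    then show ?thesis by (simp add: \<beta> mult_ac flip: power_mult)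
  qed
  consider "n = 1" | "n \<ge> 2" "d \<le> C * L" | "n \<ge> 2" "C * L < d" using n_pos by linarith
  then show ?thesis
  proof cases
    case 1
    \<comment> \<open>With one vote, the start of the walk is already optimal, and
      \<open>D \<ge> 1\<close> guarantees that it is evaluated.\<close>
    have "far y0 n = 0" using far_less[of n y0] 1 by simp
    then have "cost y0 \<le> d" using y0V hV by (simp add: cost_def)
    then have "real (cost y0) \<le> (1 + 1 / E) * d" by (simp add: distrib_right add_increasing2)
    then have "good_coins ((1 + 1 / E) * d) (nth xs) 0" for xs
      unfolding good_coins_def by (intro disjI2 exI[of _ 0]) (simp add: D)
    then show ?thesis by (simp add: card_lists_of)
  next
    case 2
    have "hdist m y0 x \<le> 2 * (C * L)"
      using hdist_triangle[of m y0 x "V 0"] y0V hV 2 hdist_commute[of m x "V 0"] by linarith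
    from trial_success_walk[OF x E1 b this] D
    have "card {..<(2 :: nat) ^ b} ^ (m + 2 * D) \<le> (8 * E) ^ (2 * (C * L)) *
      card {xs \<in> lists_of {..<2 ^ b} (m + 2 * D). good_coins ((1 + 1 / E) * d) (nth xs) 0}" by simp
    then show ?thesis unfolding X .
  next
    case 3
    have L1: "L \<ge> 1" using L(1) 3(1) by (cases L) auto
    have "real n \<le> 2 ^ L" using L(1) by (metis of_nat_le_iff of_nat_numeral of_nat_power)
    then have "ln n \<le> ln (2 ^ L)" using n_pos by simp
    also have "\<dots> = L * ln 2" by (simp add: ln_realpow)
    also have "\<dots> \<le> real L * 1" using ln_2_less_1 by (intro mult_left_mono) auto
    finally have lnL: "ln n \<le> L" by simp
    have Ed: "real (384 * E ^ 2) * L \<le> d"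
    proof -
      have "C * L \<le> d" using 3 by simp
      then have "real (C * L) \<le> real d" by (rule of_nat_mono)
      then show ?thesis by (simp add: C)
    qed
    have d1: "384 * E ^ 2 * ln n \<le> d"
      using mult_left_mono[OF lnL, of "real (384 * E ^ 2)"] Ed by simp
    \<comment> \<open>The threshold chosen for the rounding also covers the weights phase, since
      \<open>81 \<le> 384\<close>.\<close>
    have "8 * E + 1 \<le> 9 * E" using E1 by simp
    then have "(8 * E + 1) ^ 2 \<le> (9 * E) ^ 2" by (rule power_mono) simp
    also have "\<dots> \<le> 384 * E ^ 2" by (simp add: power_mult_distrib)
    finally have "real ((8 * E + 1) ^ 2) \<le> real (384 * E ^ 2)" by (rule of_nat_mono)
    then have "real ((8 * E + 1) ^ 2) * ln n \<le> real (384 * E ^ 2) * ln n"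
      using n_pos by (intro mult_right_mono) auto
    then have d2: "real (8 * E + 1) ^ 2 * ln n \<le> d" using d1 by simp
    have run': "mw_run (m * (8 * E + 1)) (2 ^ b) z w" using run L1 by simp
    have avg: "(\<Sum>t<2 ^ b. real (hdist m (z t) (V i))) \<le> (2 ^ b :: nat) * (d * (1 + 1 / (4 * E)))" if i: "i < n" for i
    proof -
      \<comment> \<open>Origin of \<open>q = 8 * E + 1\<close>: the ratio
        \<open>(q + 1) / (q - 1)\<close> is then exactly \<open>1 + 1 / (4 * E)\<close>.\<close>
      have "(real (8 * E + 1) - 1) * (\<Sum>t<2 ^ b. real (hdist m (z t) (V i)))
          \<le> (real (8 * E + 1) + 1) * (real (2 ^ b) * real d)"
        by (rule mw_average[OF run' x _ _ b i d2]) (use E1 3 d in auto)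
      then have "(8 * real E) * (\<Sum>t<2 ^ b. real (hdist m (z t) (V i))) \<le> (8 * real E + 2) * (real (2 ^ b) * real d)"
        by (simp add: add.commute)
      also have "\<dots> = (8 * real E) * (real (2 ^ b) * (d * (1 + 1 / (4 * E))))"
        using E1 by (simp add: field_simps)
      finally show ?thesis using E1 by simp
    qed
    have "card {..<(2 :: nat) ^ b} ^ (m + 2 * D) \<le>
      2 * card {xs \<in> lists_of {..<2 ^ b} (m + 2 * D). good_coins ((1 + 1 / E) * d) (nth xs) 0}"
    proof (rule trial_success_rounding[OF avg _ 3(1) E1 _ d1])
      show "ones m (z t) = k" if "t < 2 ^ b" for t
        using run that by (auto simp: mw_run_def selects_top_def)
    qed auto
    also have "\<dots> \<le> 2 ^ (\<beta> * L) * card {xs \<in> lists_of {..<2 ^ b} (m + 2 * D). good_coins ((1 + 1 / E) * d) (nth xs) 0}"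
    proof (rule mult_le_mono1)
      have "1 \<le> \<beta> * L" using L1 E1 by (simp add: \<beta> C)
      then have "(2 :: nat) ^ 1 \<le> 2 ^ (\<beta> * L)" by (rule power_increasing) simp
      then show "2 \<le> (2 :: nat) ^ (\<beta> * L)" by simp
    qed
    finally show ?thesis .
  qed
qed

end

section \<open>Running time\<close>

lemma trial_time_le:
  fixes n m D T X :: nat
  assumes "n \<ge> 1" "X \<ge> 1" "D \<le> X" "T \<le> 2 * (m + 1)"
  shows "40 + 46 * m + (40 + 8 * m + n * (25 + 14 * m)) +
     D * (66 + 16 * m + 22 * T + (40 + 8 * m + n * (25 + 14 * m))) \<le> 300 * X * n * (m + 1)"
proof -
  \<comment> \<open>Writing the positive quantities as successors turns the estimate into one
    between polynomials with natural coefficients.\<close>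
  obtain n' X' where [simp]: "n = Suc n'" "X = Suc X'" using assms(1,2) by (metis Suc_le_D One_nat_def)
  have "D * (66 + 16 * m + 22 * T + (40 + 8 * m + n * (25 + 14 * m)))
      \<le> X * (66 + 16 * m + 22 * (2 * (m + 1)) + (40 + 8 * m + n * (25 + 14 * m)))"
    using assms by (intro mult_le_mono add_mono order_refl) auto
  moreover have "40 + 46 * m + (40 + 8 * m + n * (25 + 14 * m)) +
      X * (66 + 16 * m + 22 * (2 * (m + 1)) + (40 + 8 * m + n * (25 + 14 * m))) \<le> 300 * X * n * (m + 1)"
    by (simp add: algebra_simps)
  ultimately show ?thesis by linarith
qed

lemma round_time_le:
  fixes n m k Q X :: nat
  assumes "n \<ge> 1" "X \<ge> 1" "k \<le> m" "Q \<le> m * X"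
  shows "(5 + m * (16 + 13 * n)) + (11 + 6 * m + k * (16 + 18 * m)) +
     (7 + n * (26 + 20 * m + 6 * Q)) + (7 + 10 * m) + 8 \<le> 200 * X * n * (m + 1) ^ 2"
proof -
  obtain n' X' where [simp]: "n = Suc n'" "X = Suc X'" using assms(1,2) by (metis Suc_le_D One_nat_def)
  have "k * (16 + 18 * m) \<le> m * (16 + 18 * m)" "n * (26 + 20 * m + 6 * Q) \<le> n * (26 + 20 * m + 6 * (m * X))"
    using assms by (intro mult_le_mono add_mono order_refl; simp)+
  moreover have "(5 + m * (16 + 13 * n)) + (11 + 6 * m + m * (16 + 18 * m)) +
     (7 + n * (26 + 20 * m + 6 * (m * X))) + (7 + 10 * m) + 8 \<le> 200 * X * n * (m + 1) ^ 2"
    by (simp add: algebra_simps power2_eq_square)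
  ultimately show ?thesis by linarith
qed

lemma total_time_le:
  fixes n m k L bL N R T b D Q X rt tt :: nat
  assumes "n \<ge> 1" "X \<ge> 1" "R \<ge> 1" "D \<le> X" "L \<le> X" "bL \<le> X" "N = R * X" "T \<le> 2 * (m + 1)" "b \<le> T"
    and rt: "rt \<le> 200 * X * n * (m + 1) ^ 2" and tt: "tt \<le> 300 * X * n * (m + 1)"
  shows "2 + ((65 + n * 11 + m * 17 + L * 12 + bL * 6 + N * 6) +
     (5 + 8 * m) + (13 + 22 * m) + (5 + 8 * m) + (11 + 6 * n + T * rt) + 4) +
     (5 + N * (m + 2 * D) * (14 + 10 * b)) + (9 + N * (tt + 5)) \<le> 2000 * R * (n * X ^ 2) * (m + 1) ^ 3"
proof -
  \<comment> \<open>A single monomial that dominates every summand of the running time, so that only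
    the coefficients remain to be added.\<close>
  define W where "W = R * (n * X ^ 2) * (m + 1) ^ 3"
  have Rn: "1 \<le> R" "1 \<le> n" "1 \<le> X" by fact+
  have p1: "1 \<le> X ^ 2" "X \<le> X ^ 2" using Rn by (simp_all add: power2_eq_square)
  have p2: "1 \<le> (m + 1) ^ 3" "m + 1 \<le> (m + 1) ^ 3" "(m + 1) ^ 2 \<le> (m + 1) ^ 3"
    by (simp_all add: self_le_power power_increasing)
  have w: "a * (c * e) * g \<le> W" if "a \<le> R" "c \<le> n" "e \<le> X ^ 2" "g \<le> (m + 1) ^ 3" for a c e g
    unfolding W_def using that by (intro mult_le_mono)
  have "1 \<le> W" "n \<le> W" "m \<le> W" "X \<le> W"
    using w[of 1 1 1 1] w[of 1 n 1 1] w[of 1 1 1 m] w[of 1 1 X 1] Rn p1 p2 by simp_all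
  moreover have NW: "N \<le> W" using w[of R 1 X 1] Rn p1 p2 assms(7) by simp
  moreover have "L \<le> W" "bL \<le> W" using \<open>X \<le> W\<close> assms by linarith+
  moreover have "T * rt \<le> 400 * W"
  proof -
    have "T * rt \<le> (2 * (m + 1)) * (200 * X * n * (m + 1) ^ 2)" using assms by (intro mult_le_mono)
    also have "\<dots> = 400 * (1 * (n * X) * (m + 1) ^ 3)"
    proof -
      have "(2 * a) * (200 * X * n * a ^ 2) = 400 * (1 * (n * X) * a ^ 3)" for a :: nat
        by (simp add: power2_eq_square power3_eq_cube mult_ac)
      then show ?thesis by blast
    qed
    also have "\<dots> \<le> 400 * W" by (intro mult_le_mono2 w) (use Rn p1 in auto)
    finally show ?thesis .
  qed
  moreover have "N * (m + 2 * D) * (14 + 10 * b) \<le> 100 * W"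
  proof -
    have "m + 2 * D \<le> m * X + 2 * X" using assms(4) Rn(3) by (intro add_mono) auto
    also have "\<dots> \<le> 2 * X * (m + 1)" by (simp add: algebra_simps)
    finally have "m + 2 * D \<le> 2 * X * (m + 1)" .
    moreover have "14 + 10 * b \<le> 50 * (m + 1)" using assms(8,9) by simp
    ultimately have "N * (m + 2 * D) * (14 + 10 * b) \<le> R * X * (2 * X * (m + 1)) * (50 * (m + 1))"
      unfolding assms(7) by (intro mult_le_mono order_refl)
    also have "\<dots> = 100 * (R * (1 * X ^ 2) * (m + 1) ^ 2)"
    proof -
      have "R * X * (2 * X * a) * (50 * a) = 100 * (R * (1 * X ^ 2) * a ^ 2)" for a :: nat
        by (simp add: power2_eq_square mult_ac)
      then show ?thesis by blast
    qed
    also have "\<dots> \<le> 100 * W" by (intro mult_le_mono2 w) (use Rn p2 in auto)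
    finally show ?thesis .
  qed
  moreover have "N * (tt + 5) \<le> 300 * W + 5 * W"
  proof -
    have "N * tt \<le> (R * X) * (300 * X * n * (m + 1))" unfolding assms(7) using tt by (intro mult_le_mono) simp_all
    also have "\<dots> = 300 * (R * (n * X ^ 2) * (m + 1))"
    proof -
      have "(R * X) * (300 * X * n * a) = 300 * (R * (n * X ^ 2) * a)" for a :: nat
        by (simp add: power2_eq_square mult_ac)
      then show ?thesis by blast
    qed
    also have "\<dots> \<le> 300 * W" by (intro mult_le_mono2 w) (use p2 in auto)
    finally show ?thesis using NW by (simp add: distrib_left)
  qed
  ultimately have "2 + ((65 + n * 11 + m * 17 + L * 12 + bL * 6 + N * 6) +
     (5 + 8 * m) + (13 + 22 * m) + (5 + 8 * m) + (11 + 6 * n + T * rt) + 4) +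
     (5 + N * (m + 2 * D) * (14 + 10 * b)) + (9 + N * (tt + 5)) \<le> 2000 * W" by linarith
  then show ?thesis by (simp only: W_def mult.assoc)
qed

text \<open>The uniqueness clause identifies the exponents computed by \<open>LOGS\<close> with the
  \<open>L\<close> and \<open>b\<close> of the analysis.\<close>

lemma ceil_log_exists:
  fixes n :: nat
  obtains L where "n \<le> 2 ^ L" "L = 0 \<or> 2 ^ (L - 1) < n"
    "\<And>l. n \<le> 2 ^ l \<Longrightarrow> l = 0 \<or> 2 ^ (l - 1) < n \<Longrightarrow> l = L"
proof -
  define L where "L = (LEAST l. n \<le> 2 ^ l)"
  have ex: "n \<le> 2 ^ n" using less_exp[of n] by simp
  have 1: "n \<le> 2 ^ L" unfolding L_def by (rule LeastI[of "\<lambda>l. n \<le> 2 ^ l", OF ex])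
  have min: "L \<le> l" if "n \<le> 2 ^ l" for l unfolding L_def by (rule Least_le[of "\<lambda>l. n \<le> 2 ^ l", OF that])
  have 2: "L = 0 \<or> 2 ^ (L - 1) < n"
  proof (cases "L = 0")
    case False
    have "\<not> n \<le> 2 ^ (L - 1)"
    proof
      assume "n \<le> 2 ^ (L - 1)"
      from min[OF this] False show False by simp
    qed
    then show ?thesis by simp
  qed simp
  have 3: "l = L" if "n \<le> 2 ^ l" "l = 0 \<or> 2 ^ (l - 1) < n" for l
  proof (rule ccontr)
    assume "l \<noteq> L"
    with min[OF that(1)] have "L \<le> l - 1" "l \<noteq> 0" by auto
    then have "n \<le> 2 ^ (l - 1)" using 1 power_increasing[of L "l - 1" "2 :: nat"] by linarith
    with that(2) \<open>l \<noteq> 0\<close> show False by simp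
  qed
  show ?thesis by (rule that[OF 1 2 3])
qed

text \<open>For \<open>n \<ge> 2\<close> the rounding error of the logarithm is absorbed by
  \<open>2 ^ L \<le> 2 * n \<le> n * n\<close>. Kept as a separate factor 2 it would become a
  constant \<open>2 ^ (2 * \<beta>)\<close> that depends on \<epsilon>.\<close>

lemma ceil_log_power_le:
  fixes n L \<beta> :: nat
  assumes "n \<ge> 1" "L = 0 \<or> 2 ^ (L - 1) < n" "n \<le> 2 ^ L"
  shows "n * (2 ^ (\<beta> * L)) ^ 2 \<le> n ^ (4 * \<beta> + 1)"
proof (cases "L = 0")
  case True
  then show ?thesis using assms by simp
next
  case False
  then obtain p where "L = Suc p" by (cases L) auto
  then have "2 ^ L = 2 * (2 :: nat) ^ (L - 1)" by simp
  moreover have "2 ^ (L - 1) < n" using assms(2) False by simp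
  moreover have "1 \<le> (2 :: nat) ^ (L - 1)" by simp
  ultimately have "2 ^ L \<le> 2 * n" "2 \<le> n" by linarith+
  then have "2 ^ L \<le> n * n" using mult_le_mono1[of 2 n n] by linarith
  then have "(2 ^ L) ^ (2 * \<beta>) \<le> (n * n) ^ (2 * \<beta>)" by (rule power_mono) simp
  also have "(n * n) ^ (2 * \<beta>) = n ^ (4 * \<beta>)"
    by (simp only: power2_eq_square[symmetric] power_mult[symmetric]) simp
  also have "((2 :: nat) ^ L) ^ (2 * \<beta>) = (2 ^ (\<beta> * L)) ^ 2"
    by (simp only: power_mult[symmetric]) (simp only: mult_ac)
  finally show ?thesis by simp
qed

section \<open>Strings as lists\<close>

lemma hamming_eq_hdist: "length s = m \<Longrightarrow> hamming s t = hdist m (nth s) (nth t)"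
  using card_filter_eq_sum[of "{..<m}" "\<lambda>j. s ! j \<noteq> t ! j"]
  by (simp add: hamming_def hdist_def)

lemma count_list_eq_ones: "count_list s True = ones (length s) (nth s)"
proof (induction s)
  case (Cons a s)
  then show ?case by (cases a) (simp_all add: ones_def sum.lessThan_Suc_shift del: sum.lessThan_Suc sum_of_bool_eq)
qed (simp add: ones_def)

lemma finite_mav_feasible: "finite (mav_feasible m k)"
  by (rule finite_subset[OF _ finite_lists_length_eq[of "UNIV :: bool set" m]]) (auto simp: mav_feasible_def)

lemma mav_feasible_nonempty:
  assumes "k \<le> m"
  shows "mav_feasible m k \<noteq> {}"
proof -
  have "count_list (replicate a b) True = (if b then a else 0)" for a b by (induction a) auto
  then have "replicate k True @ replicate (m - k) False \<in> mav_feasible m k"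
    using assms by (simp add: mav_feasible_def)
  then show ?thesis by blast
qed

lemma ones_cong: "(\<And>j. j < m \<Longrightarrow> y j = y' j) \<Longrightarrow> ones m y = ones m y'"
  unfolding ones_def by (intro sum.cong) auto

context votes
begin

lemma cost_cong:
  assumes "\<And>j. j < m \<Longrightarrow> y j = y' j"
  shows "cost y = cost y'"
proof -
  have h: "hdist m y x = hdist m y' x" for x unfolding hdist_def using assms by (intro sum.cong) auto
  then have "far y i = far y' i" for i by (induction i) simp_all
  then show ?thesis unfolding cost_def h by simp
qed

end

lemma mav_cost_eq_cost:
  assumes "ss \<noteq> []" "length s = m" "votes (length ss) m k"
  shows "mav_cost ss s = votes.cost (length ss) m (\<lambda>i. nth (ss ! i)) (nth s)"
proof -
  interpret votes "length ss" m k "\<lambda>i. nth (ss ! i)" by fact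
  show ?thesis unfolding mav_cost_def
  proof (rule Max_eqI)
    fix v assume "v \<in> hamming s ` set ss"
    then obtain i where "i < length ss" "v = hamming s (ss ! i)" by (auto simp: in_set_conv_nth)
    then show "v \<le> cost (nth s)" using hdist_le_cost[of i "nth s"] assms(2) by (simp add: hamming_eq_hdist)
  next
    have "far (nth s) (length ss) < length ss" using far_less n_pos by simp
    then show "cost (nth s) \<in> hamming s ` set ss"
      unfolding cost_def hamming_eq_hdist[OF assms(2), symmetric] by auto
  qed simp
qed

section \<open>The approximation scheme\<close>

text \<open>This is \<open>\<beta> = 2 * C * (l + 3)\<close> with \<open>C = 384 * E^2\<close> and
  \<open>E = 2 ^ l\<close>; the term \<open>l + 3\<close> is the logarithm of
  \<open>8 * E\<close>.\<close>

definition exponent :: "nat \<Rightarrow> nat" where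
  "exponent l = 768 * 4 ^ l * (l + 3)"

lemma ALG_correct:
  fixes l R m k :: nat
  defines "E \<equiv> 2 ^ l"
  assumes inst: "mav_instance m k ss" and R: "R \<ge> 1"
  shows "\<exists>t. t \<le> 2000 * R * length ss ^ (4 * exponent l + 1) * (m + 1) ^ 3 \<and>
    halts_within t (ALG (384 * E ^ 2) (exponent l) (8 * E + 1) R) (mav_input m k ss) \<and>
    measure_pmf.prob (run t (ALG (384 * E ^ 2) (exponent l) (8 * E + 1) R) (mav_input m k ss))
      {cf. mav_approx (1 / E) m k ss (mav_output m (snd cf))} \<ge> 1 - exp (- real R)"
proof -
  define n where "n = length ss"
  define V where "V = (\<lambda>i. nth (ss ! i))"
  define C where "C = 384 * E ^ 2"
  define \<beta> where "\<beta> = exponent l"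
  define s where "s = mav_input m k ss"
  have ss: "ss \<noteq> []" "\<And>s. s \<in> set ss \<Longrightarrow> length s = m" "k \<le> m"
    using inst by (auto simp: mav_instance_def)
  have v: "votes n m k" unfolding votes_def using ss by (simp add: n_def)
  interpret votes n m k V by (rule v)
  have E1: "E \<ge> 1" by (simp add: E_def)
  have \<beta>: "\<beta> = 2 * C * (l + 3)"
    by (simp add: \<beta>_def exponent_def C_def E_def power_mult[symmetric] power2_eq_square flip: power_mult_distrib)
  obtain L where L: "n \<le> 2 ^ L" "L = 0 \<or> 2 ^ (L - 1) < n"
    "\<And>l. n \<le> 2 ^ l \<Longrightarrow> l = 0 \<or> 2 ^ (l - 1) < n \<Longrightarrow> l = L" using ceil_log_exists by blast
  obtain b where b: "m \<le> 2 ^ b" "b = 0 \<or> 2 ^ (b - 1) < m"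
    "\<And>l. m \<le> 2 ^ l \<Longrightarrow> l = 0 \<or> 2 ^ (l - 1) < m \<Longrightarrow> l = b" using ceil_log_exists by blast
  define T :: nat where "T = 2 ^ b"
  define X :: nat where "X = 2 ^ (\<beta> * L)"
  define D where "D = 1 + C * L"
  define N where "N = R * X"
  define Q where "Q = m * (if L = 0 then 0 else 8 * E + 1)"
  define d where "d = mav_opt m k ss"

  have "mav_opt m k ss \<in> mav_cost ss ` mav_feasible m k"
    unfolding mav_opt_def using finite_mav_feasible mav_feasible_nonempty[OF ss(3)] by (intro Min_in) auto
  then obtain x where x: "x \<in> mav_feasible m k" "mav_cost ss x = d" by (auto simp: d_def)
  have lx: "length x = m" "ones m (nth x) = k"
    using x(1) count_list_eq_ones[of x] by (auto simp: mav_feasible_def)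
  have cost_eq: "mav_cost ss y = cost (nth y)" if "length y = m" for y
    using mav_cost_eq_cost[OF ss(1) that v[unfolded n_def]] by (simp add: n_def V_def)
  have dx: "hdist m (nth x) (V i) \<le> d" if "i < n" for i
    using hdist_le_cost[OF that, of "nth x"] x(2) cost_eq[OF lx(1)] by simp
  have dm: "d \<le> m" using x(2) cost_eq[OF lx(1)] hdist_le[of "nth x" "V (far (nth x) n)"] by (simp add: cost_def)

  have env: "env (set_reg 12 1 s)"
  proof -
    have "arr s 0 (i * m + j) = of_bool (V i j)" if "i < n" "j < m" for i j
    proof -
      have "i * m + j < Suc i * m" using that by simp
      also have "\<dots> \<le> n * m" using that by (intro mult_le_mono1) simp
      finally have "i * m + j < length ss * m" by (simp add: n_def)
      moreover have "(i * m + j) div m = i" "(i * m + j) mod m = j" using that by auto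
      ultimately show ?thesis by (simp add: s_def mav_input_def V_def)
    qed
    moreover have "reg s 0 = n" "reg s 1 = m" "reg s 2 = k" "reg s 13 = 0"
      by (simp_all add: s_def mav_input_def n_def)
    ultimately show ?thesis unfolding env_def by simp
  qed
  have "wp (PREPARE C \<beta> (8 * E + 1) R) (prepare_time L (\<beta> * L) N (2 ^ b) Q)
    (\<lambda>s' _. \<exists>y0 z w. env s' \<and> reg s' 4 = 2 ^ b \<and> reg s' 5 = b \<and> reg s' 6 = D \<and> reg s' 7 = N \<and>
       reg s' 9 = N * (m + 2 * D) \<and> holds_str s' 3 m y0 \<and> ones m y0 = k \<and>
       int (hdist m y0 (V 0)) = \<bar>int (ones m (V 0)) - int k\<bar> \<and> mw_run Q (2 ^ b) z w \<and>
       (\<forall>j<m. \<forall>t<2 ^ b. arr s' 6 (j * 2 ^ b + t) = of_bool (z t j))) s"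
    by (rule wp_PREPARE[OF env _ _ _ _ _ L(3) b(3)])
       (simp_all add: s_def mav_input_def D_def N_def X_def Q_def)
  then obtain t1 s1 y0 z w where prep: "big_step (PREPARE C \<beta> (8 * E + 1) R) s t1 s1"
      "t1 \<le> prepare_time L (\<beta> * L) N (2 ^ b) Q"
    and s1: "env s1" "reg s1 4 = 2 ^ b" "reg s1 5 = b" "reg s1 6 = D" "reg s1 7 = N"
       "reg s1 9 = N * (m + 2 * D)" "holds_str s1 3 m y0"
       "\<forall>j<m. \<forall>t<2 ^ b. arr s1 6 (j * 2 ^ b + t) = of_bool (z t j)"
    and y0: "ones m y0 = k" "int (hdist m y0 (V 0)) = \<bar>int (ones m (V 0)) - int k\<bar>"
    and mw: "mw_run Q (2 ^ b) z w"
    unfolding wp_def by blast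
  have tr: "trials n m k y0" unfolding trials_def trials_axioms_def using v y0(1) by simp
  interpret trials n m k V "2 ^ b" D z y0 by (rule tr)
  define M where "M = m + 2 * D"
  define B where "B = (1 + 1 / real E) * d"
  let ?G = "\<lambda>xs. good_coins B (nth xs) 0"
  have succ: "card {..<T} ^ M \<le> X * card {xs \<in> lists_of {..<T} M. ?G xs}"
    unfolding X_def M_def T_def B_def
    by (rule trial_success[OF tr _ C_def \<beta> L(1,2) b(1) lx(2) dx dm y0(2) mw[unfolded Q_def] D_def]) (simp_all add: E_def)

  have fill: "samples FILL s1 (5 + N * M * (14 + 10 * b)) (replicate_pmf (N * M) (pmf_of_set {..<2 ^ b}))
    (\<lambda>xs s'. length xs = N * M \<and> (\<forall>j<N * M. arr s' 7 j = xs ! j) \<and> agree_off {20, 21, 22, 23, 30, 31} {7} s1 s')"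
    by (rule samples_FILL) (use s1 envD[OF s1(1)] in \<open>simp_all add: M_def\<close>)
  have D1: "D \<ge> 1" by (simp add: D_def)
  have X1: "X \<ge> 1" by (simp add: X_def)
  have N1: "N \<ge> 1" using R X1 by (simp add: N_def)
  let ?R = "\<lambda>xs s''. out_ok s'' \<and> reg s'' 11 \<le> m \<and>
     (\<forall>u<N. ?G (take M (drop (u * M) xs)) \<longrightarrow> real (reg s'' 11) \<le> B)"
  have main: "wp TRIALS (9 + N * (trial_time + 5)) (\<lambda>s'' _. ?R xs s'') s'"
    if q: "length xs = N * M \<and> (\<forall>j<N * M. arr s' 7 j = xs ! j) \<and> agree_off {20, 21, 22, 23, 30, 31} {7} s1 s'"
      and xs: "xs \<in> set_pmf (replicate_pmf (N * M) (pmf_of_set {..<2 ^ b}))" for xs s'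
  proof -
    have len: "length xs = N * M" and cs: "\<And>j. j < N * M \<Longrightarrow> arr s' 7 j = xs ! j"
      and ag: "agree_off {20, 21, 22, 23, 30, 31} {7} s1 s'" using q by auto
    have lt: "xs ! j < 2 ^ b" if "j < N * M" for j
    proof -
      have "set xs \<subseteq> {..<2 ^ b}" using xs by (auto simp: set_replicate_pmf lessThan_empty_iff)
      then show ?thesis using that len by (metis lessThan_iff nth_mem subsetD)
    qed
    have e2: "env2 s'"
    proof (rule env2_agree_off[OF ag])
      show "env2 s1" using s1 by (simp add: env2_def)
    qed auto
    have r7: "reg s' 7 = N" using ag s1(5) by (simp add: agree_off_def)
    show ?thesis
    proof (rule wp_use[OF wp_TRIALS[OF e2 r7]], goal_cases)
      case (1 j) then show ?case using cs lt by (simp add: M_def)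
    next
      case 2 then show ?case by simp
    next
      case (3 s'' b')
      then have o: "out_ok s''" and t: "\<And>u. u < N \<Longrightarrow> trial_ok (arr s' 7) (u * M) (reg s'' 11)"
        by (auto simp: M_def)
      \<comment> \<open>The start of the first walk is always evaluated, so the record is at most
        \<open>m\<close>: the sentinel is excluded and array 1 holds a feasible string whatever the
        coins are.\<close>
      have "reg s'' 11 \<le> cost (walk (arr s' 7) (0 * M + m) 0)"
        using t[of 0] N1 D1 unfolding trial_ok_def by auto
      also have "\<dots> \<le> m" unfolding cost_def by (rule hdist_le)
      finally have m': "reg s'' 11 \<le> m" .
      have "real (reg s'' 11) \<le> B" if u: "u < N" and G: "?G (take M (drop (u * M) xs))" for u
      proof -
        have le: "u * M + M \<le> N * M" using mult_le_mono1[of "Suc u" N M] u by simp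
        have "good_coins B (nth (take M (drop (u * M) xs))) 0 = good_coins B (arr s' 7) (u * M)"
        proof (rule good_coins_cong)
          fix j assume "j < m + 2 * D"
          then have j: "j < M" by (simp add: M_def)
          then have "u * M + j < N * M" "u * M \<le> length xs" using le len by linarith+
          then show "take M (drop (u * M) xs) ! (0 + j) = arr s' 7 (u * M + j)" using j by (simp add: cs)
        qed
        then show ?thesis using trial_ok_good_coins[OF t[OF u]] G by simp
      qed
      with o m' show ?case by blast
    qed
  qed
  have final: "mav_approx (1 / E) m k ss (mav_output m s'')"
    if H: "xs \<in> {xs. \<exists>u<N. ?G (take M (drop (u * M) xs))}" and r: "?R xs s''" for xs s''
  proof -
    from r obtain y where y: "holds_str s'' 1 m y" "ones m y = k" "cost y = reg s'' 11"
      unfolding out_ok_def by auto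
    have out: "mav_output m s'' ! j = y j" if "j < m" for j
      using y(1) that by (simp add: mav_output_def holds_str_def)
    have len: "length (mav_output m s'') = m" by (simp add: mav_output_def)
    have "ones m (nth (mav_output m s'')) = ones m y" by (rule ones_cong) (rule out)
    then have "mav_output m s'' \<in> mav_feasible m k"
      using y(2) len count_list_eq_ones[of "mav_output m s''"] by (simp add: mav_feasible_def)
    moreover have "mav_cost ss (mav_output m s'') = cost y"
      unfolding cost_eq[OF len] by (rule cost_cong) (rule out)
    moreover have "real (reg s'' 11) \<le> B" using H r by blast
    ultimately show ?thesis by (simp add: mav_approx_def y(3) B_def d_def)
  qed

  define t where "t = 2 + t1 + (5 + N * M * (14 + 10 * b)) + (9 + N * (trial_time + 5))"
  note res = run_prepare_sample_main[where G = "\<lambda>s''. mav_approx (1 / E) m k ss (mav_output m s'')" and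
    R = ?R and H = "{xs. \<exists>u<N. ?G (take M (drop (u * M) xs))}", OF prep(1) fill main final, folded t_def ALG_def]
  have halts: "halts_within t (ALG C \<beta> (8 * E + 1) R) s" by (rule res(1))
  have T0: "T > 0" by (simp add: T_def)
  have X0: "X > 0" using X1 by simp
  have "1 - exp (- real R) \<le> measure_pmf.prob (replicate_pmf (N * M) (pmf_of_set {..<2 ^ b}))
     {xs. \<exists>u<N. ?G (take M (drop (u * M) xs))}"
    using prob_some_good[OF T0 X0 succ, of R] by (simp only: N_def T_def)
  also have "\<dots> \<le> measure_pmf.prob (run t (ALG C \<beta> (8 * E + 1) R) s)
      {cf. mav_approx (1 / E) m k ss (mav_output m (snd cf))}"
    by (rule res(2))
  finally have prob: "1 - exp (- real R) \<le> measure_pmf.prob (run t (ALG C \<beta> (8 * E + 1) R) s)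
      {cf. mav_approx (1 / E) m k ss (mav_output m (snd cf))}" .

  have "t \<le> 2000 * R * (n * X ^ 2) * (m + 1) ^ 3"
  proof -
    have Tm: "T \<le> 2 * (m + 1)"
    proof (cases "b = 0")
      case False
      then obtain p where "b = Suc p" by (cases b) auto
      then have "T = 2 * 2 ^ (b - 1)" by (simp add: T_def)
      then show ?thesis using b(2) False by simp
    qed (simp add: T_def)
    have bT: "b \<le> T" using less_exp[of b] by (simp add: T_def)
    have bX: "\<beta> * L < X" using less_exp[of "\<beta> * L"] by (simp add: X_def)
    have C\<beta>: "C \<le> \<beta>" "1 \<le> \<beta>" using E1 by (simp_all add: \<beta> C_def)
    have CL: "C * L \<le> \<beta> * L" "1 * L \<le> \<beta> * L" using C\<beta> by (intro mult_le_mono1; simp)+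
    then have DX: "D \<le> X" "L \<le> X" using bX unfolding D_def by linarith+
    \<comment> \<open>The factor \<open>8 * E + 1\<close> is charged to
      \<open>X = 2 ^ (\<beta> * L)\<close>. For \<open>L = 0\<close> the latter is only 1, but then
      \<open>Q\<close> is 0.\<close>
    have QX: "Q \<le> m * X"
    proof (cases "L = 0")
      case False
      have "8 * E + 1 \<le> 384 * E ^ 2" using E1 self_le_power[OF E1, of 2] by linarith
      also have "\<dots> \<le> \<beta> * 1" using C\<beta> by (simp add: C_def)
      also have "\<dots> \<le> \<beta> * L" using False by (intro mult_le_mono2) simp
      finally have "8 * E + 1 \<le> X" using bX by linarith
      then have "m * (8 * E + 1) \<le> m * X" by (rule mult_le_mono2)
      then show ?thesis using False unfolding Q_def by (simp only: if_False)
    qed (simp add: Q_def)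
    have n1: "n \<ge> 1" using n_pos by simp
    note rt = round_time_le[OF n1 X1 k_le_m QX] and tt = trial_time_le[OF n1 X1 DX(1) Tm]
    have "t \<le> 2 + prepare_time L (\<beta> * L) N (2 ^ b) Q + (5 + N * M * (14 + 10 * b)) + (9 + N * (trial_time + 5))"
      unfolding t_def using prep(2) by linarith
    also have "\<dots> \<le> 2000 * R * (n * X ^ 2) * (m + 1) ^ 3"
      using total_time_le[OF n1 X1 R DX less_imp_le[OF bX] N_def Tm bT rt tt] unfolding M_def T_def .
    finally show ?thesis .
  qed
  also have "\<dots> \<le> 2000 * R * n ^ (4 * \<beta> + 1) * (m + 1) ^ 3"
    unfolding X_def using ceil_log_power_le[of n L \<beta>] L(1,2) n_pos
    by (intro mult_le_mono1 mult_le_mono2) simp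
  finally have time: "t \<le> 2000 * R * n ^ (4 * \<beta> + 1) * (m + 1) ^ 3" .
  show ?thesis
  proof (intro exI[of _ t] conjI)
    show "t \<le> 2000 * R * length ss ^ (4 * exponent l + 1) * (m + 1) ^ 3"
      using time unfolding n_def \<beta>_def .
  qed (use halts prob in \<open>simp_all only: C_def \<beta>_def s_def\<close>)
qed

text \<open>For \<open>\<epsilon> \<ge> 1\<close> the logarithm is not positive and
  \<open>nat\<close> yields 0, so that \<open>E = 1\<close>.\<close>

definition precision :: "real \<Rightarrow> nat" where
  "precision \<epsilon> = nat \<lceil>log 2 (1 / \<epsilon>)\<rceil>"

lemma precision_ge:
  assumes "\<epsilon> > 0"
  shows "1 / 2 ^ precision \<epsilon> \<le> \<epsilon>"
proof -
  have "log 2 (1 / \<epsilon>) \<le> precision \<epsilon>" unfolding precision_def by linarith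
  then have "2 powr log 2 (1 / \<epsilon>) \<le> 2 powr precision \<epsilon>" by simp
  then have "1 / \<epsilon> \<le> 2 ^ precision \<epsilon>" using assms by (simp add: powr_realpow)
  then show ?thesis using assms by (simp add: field_simps)
qed

lemma exponent_bigo: "(\<lambda>\<epsilon>. real (4 * exponent (precision \<epsilon>) + 1)) \<in> O[at_right 0](\<lambda>\<epsilon>. ln (1 / \<epsilon>) / \<epsilon>\<^sup>2)"
proof (rule bigoI[where c = "61441 / ln 2"])
  have ev: "eventually (\<lambda>\<epsilon> :: real. 0 < \<epsilon> \<and> \<epsilon> < 1 / 2) (at_right 0)"
    unfolding eventually_at_right_field by (intro exI[of _ "1 / 2"]) auto
  show "eventually (\<lambda>\<epsilon>. norm (real (4 * exponent (precision \<epsilon>) + 1)) \<le> 61441 / ln 2 * norm (ln (1 / \<epsilon>) / \<epsilon>\<^sup>2)) (at_right 0)"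
    using ev
  proof eventually_elim
    case (elim \<epsilon>)
    define a where "a = log 2 (1 / \<epsilon>)"
    define l where "l = precision \<epsilon>"
    have "2 < 1 / \<epsilon>" using elim by (simp add: field_simps)
    then have a1: "a \<ge> 1" unfolding a_def using elim by (subst le_log_iff) auto
    have la: "real l \<le> a + 1" "l + 3 \<le> 5 * a" unfolding l_def precision_def a_def[symmetric] using a1 by linarith+
    have "2 powr real l \<le> 2 powr (a + 1)" using la by simp
    then have "2 ^ l \<le> 2 / \<epsilon>" using elim by (simp add: powr_realpow powr_add a_def)
    then have "(2 ^ l) ^ 2 \<le> (2 / \<epsilon>) ^ 2" by (intro power_mono) auto
    moreover have "((2 :: real) ^ l) ^ 2 = (2 ^ 2) ^ l" by (simp only: power_mult[symmetric] mult.commute)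
    ultimately have p: "(4 :: real) ^ l \<le> 4 / \<epsilon>\<^sup>2" by (simp add: power_divide)
    have e1: "1 \<le> 1 / \<epsilon>\<^sup>2" using elim by (simp add: power_le_one)
    have "real (4 * exponent l + 1) = 3072 * (4 ^ l * real (l + 3)) + 1 * 1" by (simp add: exponent_def)
    \<comment> \<open>Here \<open>4 ^ l \<le> 4 / \<epsilon>^2\<close> and
      \<open>l + 3 \<le> 5 * a\<close>, which gives \<open>3072 * 20 + 1 = 61441\<close>; the
      remaining 1 is absorbed by \<open>a \<ge> 1\<close> and
      \<open>1 / \<epsilon>^2 \<ge> 1\<close>.\<close>
    also have "\<dots> \<le> 3072 * ((4 / \<epsilon>\<^sup>2) * (5 * a)) + (1 / \<epsilon>\<^sup>2) * a"
    proof (intro add_mono mult_left_mono mult_mono p la e1 a1)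
      show "0 \<le> 1 / \<epsilon>\<^sup>2" using e1 by linarith
    qed auto
    also have "\<dots> = 61441 * (a / \<epsilon>\<^sup>2)" by (simp add: field_simps)
    also have "a = ln (1 / \<epsilon>) / ln 2" by (simp add: a_def log_def)
    finally have "real (4 * exponent l + 1) \<le> 61441 / ln 2 * (ln (1 / \<epsilon>) / \<epsilon>\<^sup>2)" by (simp add: field_simps)
    also have "\<dots> \<le> 61441 / ln 2 * norm (ln (1 / \<epsilon>) / \<epsilon>\<^sup>2)"
      unfolding real_norm_def by (rule mult_left_mono[OF abs_ge_self]) simp
    finally show ?case by (simp add: l_def)
  qed
qed

theorem theorem6:
  shows "\<exists>e :: real \<Rightarrow> real. e \<in> O[at_right 0](\<lambda>\<epsilon>. ln (1 / \<epsilon>) / \<epsilon>\<^sup>2) \<and>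
    (\<forall>r :: real. r > 0 \<longrightarrow> (\<exists>p :: real poly. \<forall>\<epsilon> :: real. \<epsilon> > 0 \<longrightarrow>
      (\<exists>A :: com. \<forall>(m :: nat) (k :: nat) (ss :: bool list list). mav_instance m k ss \<longrightarrow>
        (\<exists>t :: nat. real t \<le> real (length ss) powr e \<epsilon> * poly p (real m) \<and>
          halts_within t A (mav_input m k ss) \<and>
          measure_pmf.prob (run t A (mav_input m k ss))
            {cf. mav_approx \<epsilon> m k ss (mav_output m (snd cf))} \<ge> 1 - r))))"
proof (intro exI[of _ "\<lambda>\<epsilon>. real (4 * exponent (precision \<epsilon>) + 1)"] conjI exponent_bigo allI impI, goal_cases)
  case r: (1 r)
  \<comment> \<open>Large enough for \<open>exp (- R) \<le> r\<close>; the summand 1 ensures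
    \<open>R \<ge> 1\<close> also for \<open>r \<ge> 1\<close>, where \<open>nat\<close> may yield
    0.\<close>
  define R where "R = nat \<lceil>ln (1 / r)\<rceil> + 1"
  have "ln (1 / r) \<le> real R" unfolding R_def by linarith
  then have "exp (ln (1 / r)) \<le> exp (real R)" by simp
  then have "1 / r \<le> exp (real R)" using r by simp
  then have Rr: "exp (- real R) \<le> r" using r by (simp add: exp_minus field_simps)
  \<comment> \<open>The failure bound \<open>r\<close> enters the polynomial only through the factor
    \<open>R\<close>; its degree 3 is the same for all \<open>r\<close>, and \<epsilon> does not
    occur in it.\<close>
  show ?case
  proof (intro exI[of _ "smult (real (2000 * R)) ([:1, 1:] ^ 3)"] allI impI, goal_cases)
    case \<epsilon>: (1 \<epsilon>)
    define l where "l = precision \<epsilon>"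
    define E :: nat where "E = 2 ^ l"
    let ?A = "ALG (384 * E ^ 2) (exponent l) (8 * E + 1) R"
    have E: "1 / real E \<le> \<epsilon>" using precision_ge[OF \<epsilon>] by (simp add: E_def l_def)
    show ?case
    proof (rule exI[of _ ?A], intro allI impI, goal_cases)
      case inst: (1 m k ss)
      have "R \<ge> 1" by (simp add: R_def)
      from ALG_correct[OF inst this, of l, folded E_def] obtain t where
        t: "t \<le> 2000 * R * length ss ^ (4 * exponent l + 1) * (m + 1) ^ 3" "halts_within t ?A (mav_input m k ss)"
        "1 - exp (- real R) \<le> measure_pmf.prob (run t ?A (mav_input m k ss))
          {cf. mav_approx (1 / E) m k ss (mav_output m (snd cf))}" by blast
      have n: "length ss > 0" using inst by (simp add: mav_instance_def)
      have "real t \<le> real (2000 * R * length ss ^ (4 * exponent l + 1) * (m + 1) ^ 3)" using t(1) by (rule of_nat_mono)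
      also have "\<dots> = real (length ss) ^ (4 * exponent l + 1) * (real (2000 * R) * (real m + 1) ^ 3)"
        by (simp add: add.commute)
      also have "\<dots> = real (length ss) powr real (4 * exponent l + 1) *
          poly (smult (real (2000 * R)) ([:1, 1:] ^ 3)) (real m)"
        using n by (subst powr_realpow) (simp_all add: poly_power add.commute)
      finally have time: "real t \<le> real (length ss) powr real (4 * exponent l + 1) *
          poly (smult (real (2000 * R)) ([:1, 1:] ^ 3)) (real m)" .
      have "mav_approx \<epsilon> m k ss s" if "mav_approx (1 / E) m k ss s" for s
      proof -
        have "(1 + 1 / real E) * real (mav_opt m k ss) \<le> (1 + \<epsilon>) * real (mav_opt m k ss)"
          using E by (intro mult_right_mono) auto
        then show ?thesis using that unfolding mav_approx_def by linarith
      qed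
      then have "measure_pmf.prob (run t ?A (mav_input m k ss)) {cf. mav_approx (1 / E) m k ss (mav_output m (snd cf))}
        \<le> measure_pmf.prob (run t ?A (mav_input m k ss)) {cf. mav_approx \<epsilon> m k ss (mav_output m (snd cf))}"
        by (intro measure_pmf.finite_measure_mono) auto
      with t(3) Rr have "1 - r \<le> measure_pmf.prob (run t ?A (mav_input m k ss))
          {cf. mav_approx \<epsilon> m k ss (mav_output m (snd cf))}" by linarith
      with time t(2) show ?case
        unfolding l_def by blast
    qed
  qed
qed

end
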